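(* Let $n\ge2$, let $\theta$ be a non-empty partial commutation relation on $\{1,\ldots,n\}$, and let $\mathrm{FP(H)}$ be the group with generators $t,f_1,\ldots,f_n$ and defining relations $[f_a,f_b]=1$, $[t,f_i,f_j]=1$, $[[t,f_a],[t,f_b]]=1$ for all $i,j\in\{1,\ldots,n\}$ and all $a>b$ with $(a,b)\in\theta$. Then for every $d\ge1$ the group $\operatorname{gr}_d(\mathrm{FP(H)})=\gamma_d(\mathrm{FP(H)})/\gamma_{d+1}(\mathrm{FP(H)})$ is a free abelian group of finite rank.
   Context: Group commutators are $[x,y]=x^{-1}y^{-1}xy$, left-normed: $[x,y,z]=[[x,y],z]$. A partial commutation relation on $\{1,\ldots,n\}$ is a subset $\theta$ of $\{(a,b): a,b\in\{1,\ldots,n\}, a\ne b\}$ with $(a,b)\in\theta$ if and only if $(b,a)\in\theta$. For a group $G$, $\gamma_1(G)=G$ and $\gamma_{c+1}(G)=[\gamma_c(G),G]$. The group $\mathrm{FP(H)}$ is the Formanek–Procesi group (HNN-extension $\langle b, H\times H : b(g,g)b^{-1}=(1,g),\ g\in H\rangle$) with base the right-angled Artin group $H=\langle a_1,\ldots,a_n : [a_k,a_l]=1,\ k>l,\ (k,l)\in\theta\rangle$. *)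

theory Defs
  imports "HOL-Algebra.Algebra"
begin

section \<open>Commutators, lower central series and its quotients\<close>

definition commut :: "('a, 'b) monoid_scheme \<Rightarrow> 'a \<Rightarrow> 'a \<Rightarrow> 'a" where
  "commut G x y = inv\<^bsub>G\<^esub> x \<otimes>\<^bsub>G\<^esub> inv\<^bsub>G\<^esub> y \<otimes>\<^bsub>G\<^esub> x \<otimes>\<^bsub>G\<^esub> y"

text \<open>The series is indexed from 1, as usual; the value at 0 is a dummy.\<close>

fun lower_central :: "('a, 'b) monoid_scheme \<Rightarrow> nat \<Rightarrow> 'a set" where
  "lower_central G 0 = carrier G"
| "lower_central G (Suc 0) = carrier G"
| "lower_central G (Suc (Suc c)) =
     generate G {commut G x y |x y. x \<in> lower_central G (Suc c) \<and> y \<in> carrier G}"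

definition gr :: "('a, 'b) monoid_scheme \<Rightarrow> nat \<Rightarrow> 'a set monoid" where
  "gr G d = G\<lparr>carrier := lower_central G d\<rparr> Mod lower_central G (Suc d)"

definition free_abelian_of_finite_rank :: "('a, 'b) monoid_scheme \<Rightarrow> bool" where
  "free_abelian_of_finite_rank A \<longleftrightarrow> group A \<and> (\<exists>r::nat. A \<cong> free_Abelian_group {..<r})"


section \<open>Free groups and presentations\<close>

text \<open>The free group on \<open>S\<close> consists of the reduced words over \<open>S\<close>; the letter \<open>(x, True)\<close>
  stands for \<open>x\<close> and \<open>(x, False)\<close> for its inverse.\<close>

type_synonym 'a word = "('a \<times> bool) list"

definition flip :: "'a \<times> bool \<Rightarrow> 'a \<times> bool" where
  "flip l = (fst l, \<not> snd l)"

fun reduced :: "'a word \<Rightarrow> bool" where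
  "reduced [] \<longleftrightarrow> True"
| "reduced [l] \<longleftrightarrow> True"
| "reduced (l # m # w) \<longleftrightarrow> m \<noteq> flip l \<and> reduced (m # w)"

fun push :: "'a \<times> bool \<Rightarrow> 'a word \<Rightarrow> 'a word" where
  "push l [] = [l]"
| "push l (m # w) = (if m = flip l then w else l # m # w)"

definition free_group :: "'a set \<Rightarrow> 'a word monoid" where
  "free_group S =
     \<lparr>carrier = {w \<in> lists (S \<times> UNIV). reduced w},
      monoid.mult = (\<lambda>u v. foldr push u v),
      one = []\<rparr>"

definition free_gen :: "'a \<Rightarrow> 'a word" where
  "free_gen x = [(x, True)]"

definition normal_closure :: "('a, 'b) monoid_scheme \<Rightarrow> 'a set \<Rightarrow> 'a set" where
  "normal_closure G R = \<Inter>{N. N \<lhd> G \<and> R \<subseteq> N}"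

definition presented_group :: "'a set \<Rightarrow> 'a word set \<Rightarrow> 'a word set monoid" where
  "presented_group S R = free_group S Mod normal_closure (free_group S) R"


section \<open>The group FP(H)\<close>

definition partial_commutation :: "nat \<Rightarrow> (nat \<times> nat) set \<Rightarrow> bool" where
  "partial_commutation n \<theta> \<longleftrightarrow>
     \<theta> \<subseteq> {(a, b). a \<in> {1..n} \<and> b \<in> {1..n} \<and> a \<noteq> b} \<and>
     (\<forall>a b. (a, b) \<in> \<theta> \<longleftrightarrow> (b, a) \<in> \<theta>)"

datatype fp_gen = T | F nat

definition fp_gens :: "nat \<Rightarrow> fp_gen set" where
  "fp_gens n = insert T (F ` {1..n})"

definition fp_relators :: "nat \<Rightarrow> (nat \<times> nat) set \<Rightarrow> fp_gen word set" where
  "fp_relators n \<theta> =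
     (let t = free_gen T; f = (\<lambda>i. free_gen (F i)); c = commut (free_group (fp_gens n)) in
        {c (f a) (f b) |a b. a > b \<and> (a, b) \<in> \<theta>} \<union>
        {c (c t (f i)) (f j) |i j. i \<in> {1..n} \<and> j \<in> {1..n}} \<union>
        {c (c t (f a)) (c t (f b)) |a b. a > b \<and> (a, b) \<in> \<theta>})"

text \<open>The Formanek--Procesi group of the right-angled Artin group determined by \<open>n\<close> and
  \<open>\<theta>\<close>.  In terms of the HNN-extension, \<open>t\<close> is the stable letter \<open>b\<close>, \<open>f\<^sub>i\<close> is
  \<open>(1, a\<^sub>i)\<^sup>-\<^sup>1\<close> and \<open>[t, f\<^sub>i]\<close> is \<open>(a\<^sub>i, 1)\<close>.\<close>

definition FP :: "nat \<Rightarrow> (nat \<times> nat) set \<Rightarrow> fp_gen word set monoid" where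
  "FP n \<theta> = presented_group (fp_gens n) (fp_relators n \<theta>)"


section \<open>These are groups, and have the expected universal property\<close>

lemma flip_flip [simp]: "flip (flip l) = l"
  by (simp add: flip_def)

lemma flip_neq [simp]: "flip l \<noteq> l" "l \<noteq> flip l"
  by (auto simp: flip_def prod_eq_iff)

lemma flip_eq_iff: "m = flip l \<longleftrightarrow> l = flip m"
  by auto

lemma reduced_tl: "reduced (l # w) \<Longrightarrow> reduced w"
  by (cases w) auto

lemma reduced_push: "reduced w \<Longrightarrow> reduced (push l w)"
  by (cases w) (auto dest: reduced_tl)

lemma push_flip: "reduced w \<Longrightarrow> push l (push (flip l) w) = w"
  by (cases "(flip l, w)" rule: push.cases) (auto elim: reduced.elims)

lemma reduced_foldr_push: "reduced v \<Longrightarrow> reduced (foldr push u v)"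
  by (induction u) (auto intro: reduced_push)

lemma foldr_push_push:
  "reduced v \<Longrightarrow> foldr push (push l u) v = push l (foldr push u v)"
  using push_flip[of "foldr push (tl u) v" l] reduced_foldr_push[of v "tl u"]
  by (cases u) auto

lemma foldr_push_assoc:
  "reduced w \<Longrightarrow> foldr push (foldr push u v) w = foldr push u (foldr push v w)"
  by (induction u) (auto simp: foldr_push_push)

lemma foldr_push_Nil: "reduced u \<Longrightarrow> foldr push u [] = u"
proof (induction u)
  case (Cons l u)
  then show ?case by (cases u) auto
qed simp

lemma foldr_push_lists: "u \<in> lists A \<Longrightarrow> v \<in> lists A \<Longrightarrow> foldr push u v \<in> lists A"
proof (induction u)
  case (Cons l u)
  then have "foldr push u v \<in> lists A" "l \<in> A" by auto
  then show ?case by (cases "foldr push u v") auto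
qed simp

lemma foldr_push_inverse: "reduced v \<Longrightarrow> foldr push (rev (map flip u)) (foldr push u v) = v"
proof (induction u arbitrary: v)
  case (Cons l u)
  then show ?case
    using push_flip[of "foldr push u v" "flip l"] by (simp add: reduced_foldr_push)
qed simp

lemma free_group_group: "group (free_group S)"
proof (rule groupI)
  fix u assume u: "u \<in> carrier (free_group S)"
  let ?v = "foldr push (rev (map flip u)) []"
  have "rev (map flip u) \<in> lists (S \<times> UNIV)"
    using u by (auto simp: free_group_def flip_def lists_eq_set)
  then have "?v \<in> carrier (free_group S)"
    using foldr_push_lists[of _ _ "[]"] by (auto simp: free_group_def reduced_foldr_push)
  moreover have "foldr push ?v u = []"
    using u foldr_push_inverse[of "[]" u]
    by (simp add: free_group_def foldr_push_assoc foldr_push_Nil)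
  ultimately show "\<exists>v\<in>carrier (free_group S). v \<otimes>\<^bsub>free_group S\<^esub> u = \<one>\<^bsub>free_group S\<^esub>"
    by (intro bexI[of _ ?v]) (auto simp: free_group_def)
qed (auto simp: free_group_def reduced_foldr_push foldr_push_lists foldr_push_assoc)

lemma free_gen_closed: "x \<in> S \<Longrightarrow> free_gen x \<in> carrier (free_group S)"
  by (simp add: free_gen_def free_group_def)

lemma (in group) commut_closed:
  "x \<in> carrier G \<Longrightarrow> y \<in> carrier G \<Longrightarrow> commut G x y \<in> carrier G"
  by (simp add: commut_def)

lemma (in group) normal_closure_normal:
  assumes "R \<subseteq> carrier G"
  shows "normal_closure G R \<lhd> G"
proof -
  have ne: "carrier G \<in> {N. N \<lhd> G \<and> R \<subseteq> N}"
    using assms by (simp add: normal_inv_iff subgroup_self)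
  then have "subgroup (normal_closure G R) G"
    unfolding normal_closure_def by (intro subgroups_Inter) (auto simp: normal_def)
  then show ?thesis
    unfolding normal_inv_iff by (auto simp: normal_closure_def normal_inv_iff)
qed

lemma presented_group_group:
  assumes "R \<subseteq> carrier (free_group S)"
  shows "group (presented_group S R)"
  unfolding presented_group_def
  by (intro normal.factorgroup_is_group group.normal_closure_normal free_group_group assms)

lemma fp_relators_closed:
  assumes "partial_commutation n \<theta>"
  shows "fp_relators n \<theta> \<subseteq> carrier (free_group (fp_gens n))"
proof -
  interpret group "free_group (fp_gens n)" by (rule free_group_group)
  have "free_gen T \<in> carrier (free_group (fp_gens n))"
    "\<And>i. i \<in> {1..n} \<Longrightarrow> free_gen (F i) \<in> carrier (free_group (fp_gens n))"
    by (auto intro!: free_gen_closed simp: fp_gens_def)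
  then show ?thesis
    using assms unfolding partial_commutation_def fp_relators_def Let_def
    by (auto intro!: commut_closed)
qed

lemma FP_group: "partial_commutation n \<theta> \<Longrightarrow> group (FP n \<theta>)"
  unfolding FP_def by (intro presented_group_group fp_relators_closed)

definition eval_letter :: "('b, 'c) monoid_scheme \<Rightarrow> ('a \<Rightarrow> 'b) \<Rightarrow> 'a \<times> bool \<Rightarrow> 'b" where
  "eval_letter G \<phi> l = (if snd l then \<phi> (fst l) else inv\<^bsub>G\<^esub> (\<phi> (fst l)))"

definition eval_word :: "('b, 'c) monoid_scheme \<Rightarrow> ('a \<Rightarrow> 'b) \<Rightarrow> 'a word \<Rightarrow> 'b" where
  "eval_word G \<phi> w = foldr (\<lambda>l g. eval_letter G \<phi> l \<otimes>\<^bsub>G\<^esub> g) w \<one>\<^bsub>G\<^esub>"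

lemma eval_word_hom:
  assumes "group G" "\<phi> ` S \<subseteq> carrier G"
  shows "eval_word G \<phi> \<in> hom (free_group S) G"
proof -
  interpret group G by fact
  have l: "eval_letter G \<phi> l \<in> carrier G" if "l \<in> S \<times> UNIV" for l
    using that assms(2) by (auto simp: eval_letter_def)
  have c: "eval_word G \<phi> w \<in> carrier G" if "w \<in> lists (S \<times> UNIV)" for w
    using that by (induction w) (auto simp: eval_word_def l)
  have f: "eval_letter G \<phi> m = inv\<^bsub>G\<^esub> (eval_letter G \<phi> l)" if "m = flip l" "l \<in> S \<times> UNIV" for l m
    using that assms(2) by (auto simp: eval_letter_def flip_def)
  have p: "eval_word G \<phi> (push l w) = eval_letter G \<phi> l \<otimes>\<^bsub>G\<^esub> eval_word G \<phi> w"
    if lw: "l \<in> S \<times> UNIV" "w \<in> lists (S \<times> UNIV)" for l w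
  proof (cases w)
    case (Cons m v)
    then have v: "v \<in> lists (S \<times> UNIV)" using lw by auto
    have "eval_word G \<phi> w = eval_letter G \<phi> m \<otimes>\<^bsub>G\<^esub> eval_word G \<phi> v"
      by (simp add: Cons eval_word_def)
    then show ?thesis
      using f[of m l] lw l[OF lw(1)] c[OF v] c[OF lw(2)] Cons
      by (auto simp: m_assoc[symmetric] eval_word_def)
  qed (simp add: eval_word_def)
  have "eval_word G \<phi> (foldr push u v) = eval_word G \<phi> u \<otimes>\<^bsub>G\<^esub> eval_word G \<phi> v"
    if "u \<in> lists (S \<times> UNIV)" "v \<in> lists (S \<times> UNIV)" for u v
    using that
  proof (induction u)
    case (Cons x u)
    then have x: "x \<in> S \<times> UNIV" and u: "u \<in> lists (S \<times> UNIV)" by auto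
    show ?case
      using Cons.IH[OF that(2)] c[OF u] c[OF that(2)] l[OF x]
        p[OF x foldr_push_lists[OF u that(2)]]
      by (simp add: eval_word_def m_assoc)
  qed (use c in \<open>auto simp: eval_word_def\<close>)
  then show ?thesis
    by (auto simp: hom_def free_group_def c)
qed

lemma presented_group_universal:
  assumes "group G" "\<phi> ` S \<subseteq> carrier G" "R \<subseteq> carrier (free_group S)"
    and "\<And>r. r \<in> R \<Longrightarrow> eval_word G \<phi> r = \<one>\<^bsub>G\<^esub>"
  obtains h where "h \<in> hom (presented_group S R) G"
    and "\<And>x. x \<in> S \<Longrightarrow>
      h (normal_closure (free_group S) R #>\<^bsub>free_group S\<^esub> free_gen x) = \<phi> x"
proof -
  interpret group_hom "free_group S" G "eval_word G \<phi>"
    by (intro group_hom.intro free_group_group assms(1) group_hom_axioms.intro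
        eval_word_hom assms(2))
  have "normal_closure (free_group S) R \<subseteq> kernel (free_group S) G (eval_word G \<phi>)"
    unfolding normal_closure_def using assms(3,4) normal_kernel
    by (intro Inter_lower) (auto simp: kernel_def)
  from FactGroup_universal_kernel[OF G.normal_closure_normal[OF assms(3)] this]
  obtain h where h: "h \<in> hom (free_group S Mod normal_closure (free_group S) R) G"
    "\<And>u. u \<in> carrier (free_group S) \<Longrightarrow>
      h (normal_closure (free_group S) R #>\<^bsub>free_group S\<^esub> u) = eval_word G \<phi> u"
    by blast
  have "eval_word G \<phi> (free_gen x) = \<phi> x" if "x \<in> S" for x
    using that assms(2) by (auto simp: eval_word_def eval_letter_def free_gen_def)
  with h show ?thesis
    by (intro that[of h]) (auto simp: presented_group_def free_gen_closed)
qed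

end

theory Submission
  imports Defs "HOL-Computational_Algebra.Formal_Power_Series" "HOL-Library.Function_Algebras"
begin

text \<open>
  Put \<open>x\<^sub>i = [t, f\<^sub>i]\<close>.  The group is the semidirect product of the normal subgroup generated by
  \<open>t, x\<^sub>1, \<dots>, x\<^sub>n\<close> and of \<open>\<langle>f\<^sub>1, \<dots>, f\<^sub>n\<rangle>\<close>, where \<open>f\<^sub>i\<close> fixes every \<open>x\<^sub>j\<close> and sends \<open>t\<close>
  to \<open>t x\<^sub>i\<close>.  The lower central series is compatible with this decomposition once \<open>x\<^sub>i\<close> is given
  weight 2, so each graded piece is spanned by the Lie monomials in \<open>t, x\<^sub>1, \<dots>, x\<^sub>n\<close> and those in
  \<open>f\<^sub>1, \<dots>, f\<^sub>n\<close>, two partially commutative alphabets.  Magnus expansions map the two parts to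
  partially commutative power series; since \<open>f\<^sub>i\<close> acts on the first part by a substitution of
  power series, both expansions extend to the whole group.  The leading coefficients live in a torsion-free
  group, so it remains to see that a Lie polynomial whose image in the partially commutative
  associative ring vanishes is trivial in the partially commutative Lie ring \<open>L\<close>.

  Let \<open>K\<close> be the kernel of \<open>L \<rightarrow> A\<close> in some degree \<open>m\<close>, where \<open>A\<close> is the associative ring.
  The Dynkin operator shows \<open>m K = 0\<close>.  For a prime \<open>q\<close>, every nonzero element of
  \<open>L/qL\<close> of degree \<open>m\<close> acts nontrivially in some representation, obtained by adjoining the
  Lie monomials of degree at most \<open>m\<close> one at a time, in order of decreasing degree, and
  coinducing; hence \<open>K \<subseteq> qL\<close>, and \<open>K = qK\<close> because \<open>A\<close> is torsion-free.  Therefore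
  \<open>K = mK = 0\<close>.
\<close>

section \<open>Free abelian groups and bilinear extension\<close>

text \<open>The usual basis argument for a Poincare-Birkhoff-Witt theorem starts from a Lie ring
  that is free as an abelian group, and this freeness is the very point at issue. Working modulo a
  prime \<open>q\<close> avoids the circle: an element either lies in the ideal already represented
  or is independent of it modulo \<open>q\<close>, so a representation can be extended one element
  at a time. That argument alone gives only divisibility of the kernel by \<open>q\<close>; the
  Dynkin operator supplies the fixed number that kills the kernel in a given degree, and together
  they leave nothing.

  The semidirect decomposition guides the proof but is never constructed. The graded pieces are
  shown to be spanned by two families of commutators, using the relations, and to be detected by two
  homomorphisms, using the universal property of the presentation. Both homomorphisms are defined on
  the whole group, so leading coefficients are compared directly with its own lower central series
  and not with a filtration of a subgroup.\<close>

definition zmul :: "int \<Rightarrow> 'b::ab_group_add \<Rightarrow> 'b" where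
  "zmul k a = (\<Sum>i<nat k. a) - (\<Sum>i<nat (- k). a)"

lemma zmul_0 [simp]: "zmul 0 a = 0" and zmul_1 [simp]: "zmul 1 a = a"
  by (simp_all add: zmul_def)

lemma zmul_succ: "zmul (k + 1) a = zmul k a + a"
proof (cases "k \<ge> 0")
  case True
  then show ?thesis by (simp add: zmul_def nat_add_distrib)
next
  case False
  then have "nat (- k) = Suc (nat (- (k + 1)))" by simp
  with False show ?thesis by (simp add: zmul_def)
qed

lemma zmul_add: "zmul (k + l) a = zmul k a + zmul l a"
proof (induction l rule: int_induct[where k = 0])
  case (step1 i)
  then show ?case using zmul_succ[of "k + i" a] zmul_succ[of i a] by (simp add: algebra_simps)
next
  case (step2 i)
  then show ?case using zmul_succ[of "k + i - 1" a] zmul_succ[of "i - 1" a] by (simp add: algebra_simps)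
qed simp

lemma zmul_minus: "zmul (- k) a = - zmul k a"
  using zmul_add[of k "- k" a] by (simp add: add_eq_0_iff)

lemma zmul_diff: "zmul (k - l) a = zmul k a - zmul l a"
  using zmul_add[of k "- l" a] by (simp add: zmul_minus)

lemma zmul_mult: "zmul (k * l) a = zmul k (zmul l a)"
  by (induction k rule: int_induct[where k = 0])
    (simp_all add: distrib_right left_diff_distrib zmul_add zmul_diff)

lemma zmul_frag: "zmul k (a :: 'k \<Rightarrow>\<^sub>0 int) = frag_cmul k a"
  by (induction k rule: int_induct[where k = 0])
    (simp_all add: zmul_add zmul_diff frag_cmul_distrib frag_cmul_diff_distrib)

lemma additive_zmul: "Modules.additive f \<Longrightarrow> f (zmul k a) = zmul k (f a)"
  by (induction k rule: int_induct[where k = 0])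
    (simp_all add: zmul_add zmul_diff additive.zero additive.add additive.diff)

lemma additive_zmul_right: "Modules.additive (zmul k)"
  by standard (induction k rule: int_induct[where k = 0];
    simp add: zmul_add zmul_diff algebra_simps)

lemmas zmul_right_0 = additive.zero[OF additive_zmul_right]
  and zmul_right_add = additive.add[OF additive_zmul_right]
  and zmul_right_minus = additive.minus[OF additive_zmul_right]
  and zmul_right_diff = additive.diff[OF additive_zmul_right]

lemma zmul_fun: "zmul k f = (\<lambda>x. zmul k (f x :: 'b::ab_group_add))"
  by (rule ext) (rule additive_zmul[of "\<lambda>f. f x" for x], standard, simp)

definition frag_ext :: "('k \<Rightarrow> 'b::ab_group_add) \<Rightarrow> ('k \<Rightarrow>\<^sub>0 int) \<Rightarrow> 'b" where
  "frag_ext f p = (\<Sum>k\<in>Poly_Mapping.keys p. zmul (Poly_Mapping.lookup p k) (f k))"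

lemma frag_ext_superset:
  assumes "finite A" "Poly_Mapping.keys p \<subseteq> A"
  shows "frag_ext f p = (\<Sum>k\<in>A. zmul (Poly_Mapping.lookup p k) (f k))"
  unfolding frag_ext_def using assms
  by (intro sum.mono_neutral_left) (auto simp: in_keys_iff)

lemma frag_ext_additive: "Modules.additive (frag_ext f)"
proof
  fix p q :: "'a \<Rightarrow>\<^sub>0 int"
  let ?A = "Poly_Mapping.keys p \<union> Poly_Mapping.keys q"
  have "Poly_Mapping.keys (p + q) \<subseteq> ?A" by (rule Poly_Mapping.keys_add)
  then show "frag_ext f (p + q) = frag_ext f p + frag_ext f q"
    by (simp add: frag_ext_superset[of ?A] lookup_add zmul_add sum.distrib)
qed

lemmas frag_ext_add [simp] = additive.add[OF frag_ext_additive]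
  and frag_ext_diff [simp] = additive.diff[OF frag_ext_additive]
  and frag_ext_minus [simp] = additive.minus[OF frag_ext_additive]
  and frag_ext_0 [simp] = additive.zero[OF frag_ext_additive]
  and frag_ext_zmul [simp] = additive_zmul[OF frag_ext_additive]

lemma frag_ext_of [simp]: "frag_ext f (frag_of k) = f k"
  by (simp add: frag_ext_def)

lemma frag_induct [case_names zero of diff]:
  assumes "P 0" "\<And>x. P (frag_of x)" "\<And>a b. P a \<Longrightarrow> P b \<Longrightarrow> P (a - b)"
  shows "P c"
  by (rule frag_induction[of c UNIV P]) (use assms in auto)

lemma additive_frag_eq:
  assumes "Modules.additive g" "Modules.additive h" "\<And>k. g (frag_of k) = h (frag_of k)"
  shows "g p = h p"
  by (induction p rule: frag_induct)
    (simp_all add: assms additive.zero[OF assms(1)] additive.zero[OF assms(2)]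
      additive.diff[OF assms(1)] additive.diff[OF assms(2)])

lemma frag_ext_fun_add: "frag_ext (\<lambda>k. f k + g k) p = frag_ext f p + frag_ext g p"
  by (induction p rule: frag_induct) (simp_all add: algebra_simps)

lemma frag_ext_fun_diff: "frag_ext (\<lambda>k. f k - g k) p = frag_ext f p - frag_ext g p"
  by (induction p rule: frag_induct) (simp_all add: algebra_simps)

lemma frag_ext_fun_0 [simp]: "frag_ext (\<lambda>k. 0) p = 0"
  by (induction p rule: frag_induct) simp_all

lemma additive_frag_ext:
  assumes "Modules.additive g"
  shows "g (frag_ext f p) = frag_ext (\<lambda>k. g (f k)) p"
  by (induction p rule: frag_induct) (simp_all add: additive.zero[OF assms] additive.diff[OF assms])

lemma additive_comp: "Modules.additive f \<Longrightarrow> Modules.additive g \<Longrightarrow> Modules.additive (\<lambda>x. f (g x))"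
  by (simp add: Modules.additive_def)

lemma additive_plus:
  "Modules.additive f \<Longrightarrow> Modules.additive g \<Longrightarrow> Modules.additive (\<lambda>x. f x + g x)"
  by (simp add: Modules.additive_def add_ac)

section \<open>Lie polynomials\<close>

datatype 'x tree = Leaf 'x | Node "'x tree" "'x tree"

type_synonym 'x lie_poly = "'x tree \<Rightarrow>\<^sub>0 int"

primrec leaves :: "'x tree \<Rightarrow> nat" where
  "leaves (Leaf x) = 1"
| "leaves (Node s t) = leaves s + leaves t"

lemma leaves_pos [simp]: "leaves t > 0"
  by (induction t) auto

definition br :: "'x lie_poly \<Rightarrow> 'x lie_poly \<Rightarrow> 'x lie_poly" where
  "br p q = frag_ext (\<lambda>s. frag_ext (\<lambda>t. frag_of (Node s t)) q) p"

lemma br_of [simp]: "br (frag_of s) (frag_of t) = frag_of (Node s t)"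
  by (simp add: br_def)

lemma br_additive_left: "Modules.additive (\<lambda>p. br p q)"
  by (simp add: br_def frag_ext_additive)

lemma br_additive_right: "Modules.additive (br p)"
  by standard (simp add: br_def frag_ext_fun_add)

lemmas br_add_left = additive.add[OF br_additive_left]
  and br_diff_left = additive.diff[OF br_additive_left]
  and br_0_left [simp] = additive.zero[OF br_additive_left]
  and br_zmul_left = additive_zmul[OF br_additive_left]
  and br_add_right = additive.add[OF br_additive_right]
  and br_diff_right = additive.diff[OF br_additive_right]
  and br_0_right [simp] = additive.zero[OF br_additive_right]
  and br_zmul_right = additive_zmul[OF br_additive_right]

text \<open>The Lie ring presented by the alphabet \<open>A\<close> and the commutation relations \<open>\<Theta>\<close> is the
  quotient of \<open>'x lie_poly\<close> by this subgroup.\<close>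

inductive_set lie_ideal :: "'x set \<Rightarrow> ('x \<times> 'x) set \<Rightarrow> 'x lie_poly set" for A \<Theta> where
  alternating: "frag_of (Node a a) \<in> lie_ideal A \<Theta>"
| antisymmetric: "frag_of (Node a b) + frag_of (Node b a) \<in> lie_ideal A \<Theta>"
| jacobi: "frag_of (Node (Node a b) c) + frag_of (Node (Node b c) a) + frag_of (Node (Node c a) b)
      \<in> lie_ideal A \<Theta>"
| outside: "y \<notin> A \<Longrightarrow> frag_of (Leaf y) \<in> lie_ideal A \<Theta>"
| commute: "(x, y) \<in> \<Theta> \<Longrightarrow> frag_of (Node (Leaf x) (Leaf y)) \<in> lie_ideal A \<Theta>"
| diff: "p \<in> lie_ideal A \<Theta> \<Longrightarrow> q \<in> lie_ideal A \<Theta> \<Longrightarrow> p - q \<in> lie_ideal A \<Theta>"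
| bracket: "p \<in> lie_ideal A \<Theta> \<Longrightarrow> br p (frag_of c) \<in> lie_ideal A \<Theta>"

section \<open>Additive subgroups and Lie ideals\<close>

locale additive_subgroup =
  fixes K :: "'m::ab_group_add set"
  assumes zero [simp, intro]: "0 \<in> K" and diff [intro]: "a \<in> K \<Longrightarrow> b \<in> K \<Longrightarrow> a - b \<in> K"
begin

lemma minus [intro]: "a \<in> K \<Longrightarrow> - a \<in> K"
  using diff[of 0 a] by simp

lemma add [intro]: "a \<in> K \<Longrightarrow> b \<in> K \<Longrightarrow> a + b \<in> K"
  using diff[of a "- b"] minus[of b] by simp

lemma zmul [intro]: "a \<in> K \<Longrightarrow> zmul k a \<in> K"
  by (induction k rule: int_induct[where k = 0]) (auto simp: zmul_add zmul_diff)

lemma minus_iff [simp]: "- a \<in> K \<longleftrightarrow> a \<in> K"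
  using minus[of a] minus[of "- a"] by auto

lemma additive_mem:
  assumes "Modules.additive f" "\<And>k. f (frag_of k) \<in> K"
  shows "f p \<in> K"
  by (induction p rule: frag_induct)
    (auto simp: assms additive.zero[OF assms(1)] additive.diff[OF assms(1)])

lemma frag_ext_mem: "(\<And>k. f k \<in> K) \<Longrightarrow> frag_ext f p \<in> K"
  by (rule additive_mem) (simp_all add: frag_ext_additive)

end

text \<open>The ideal is kept abstract because the calculus serves twice: for
  \<open>lie_ideal\<close>, and for a larger ideal that also contains all multiples of a prime and
  everything of high degree. Elements are compared modulo \<open>K\<close> without forming a
  quotient type.\<close>

locale lie_quotient = additive_subgroup K for K :: "'x lie_poly set" +
  assumes alt: "frag_of (Node a a) \<in> K"
    and anti: "frag_of (Node a b) + frag_of (Node b a) \<in> K"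
    and jac: "frag_of (Node (Node a b) c) + frag_of (Node (Node b c) a) + frag_of (Node (Node c a) b)
      \<in> K"
    and br_of_mem: "p \<in> K \<Longrightarrow> br p (frag_of c) \<in> K"
begin

lemma br_left: "p \<in> K \<Longrightarrow> br p q \<in> K"
  by (rule additive_mem[OF br_additive_right]) (rule br_of_mem)

lemma br_anti: "br p q + br q p \<in> K"
proof -
  have 1: "br (frag_of a) q + br q (frag_of a) \<in> K" for a
    by (rule additive_mem[of "\<lambda>q. br (frag_of a) q + br q (frag_of a)"])
      (intro additive_plus br_additive_left br_additive_right, simp add: anti)
  show ?thesis
    by (rule additive_mem[of "\<lambda>p. br p q + br q p"])
      (intro additive_plus br_additive_left br_additive_right, rule 1)
qed

lemma br_right: "q \<in> K \<Longrightarrow> br p q \<in> K"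
  using diff[OF br_anti[of p q] br_left[of q p]] by simp

lemma br_jacobi: "br (br p q) r + br (br q r) p + br (br r p) q \<in> K"
proof -
  note additive_intros = additive_plus br_additive_left br_additive_right
    additive_comp[OF br_additive_left br_additive_left]
    additive_comp[OF br_additive_left br_additive_right]
  have 1: "br (br (frag_of a) (frag_of b)) r + br (br (frag_of b) r) (frag_of a)
    + br (br r (frag_of a)) (frag_of b) \<in> K" for a b
    by (rule additive_mem[of "\<lambda>r. br (br (frag_of a) (frag_of b)) r + br (br (frag_of b) r) (frag_of a)
    + br (br r (frag_of a)) (frag_of b)"])
      (intro additive_intros, simp add: jac)
  have 2: "br (br (frag_of a) q) r + br (br q r) (frag_of a) + br (br r (frag_of a)) q \<in> K" for a
    by (rule additive_mem[of "\<lambda>q. br (br (frag_of a) q) r + br (br q r) (frag_of a) + br (br r (frag_of a)) q"])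
      (intro additive_intros, rule 1)
  show ?thesis
    by (rule additive_mem[of "\<lambda>p. br (br p q) r + br (br q r) p + br (br r p) q"])
      (intro additive_intros, rule 2)
qed

text \<open>The Jacobi identity in the shape used below: right bracketing with \<open>r\<close> is a
  derivation modulo \<open>K\<close>; equivalently, right bracketing with \<open>br q r\<close> is
  the commutator of the right bracketings with \<open>q\<close> and \<open>r\<close>.\<close>

lemma br_derivation: "br (br p q) r - br (br p r) q - br p (br q r) \<in> K"
proof -
  have "br (br p q) r + br (br q r) p + br (br r p) q
     - (br (br q r) p + br p (br q r)) - br (br r p + br p r) q \<in> K"
    by (intro diff br_jacobi br_anti br_left)
  then show ?thesis by (simp add: br_add_left algebra_simps)
qed

end

lemma lie_quotient_lie_ideal: "lie_quotient (lie_ideal A \<Theta>)"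
proof (intro lie_quotient.intro additive_subgroup.intro lie_quotient_axioms.intro)
  have "frag_of (Node a a) - frag_of (Node a a) \<in> lie_ideal A \<Theta>" for a
    by (intro lie_ideal.diff lie_ideal.alternating)
  then show "0 \<in> lie_ideal A \<Theta>" by simp
qed (fact lie_ideal.diff lie_ideal.alternating lie_ideal.antisymmetric lie_ideal.jacobi
    lie_ideal.bracket)+

section \<open>Evaluation of Lie polynomials on functions of words\<close>

text \<open>\<open>pair t \<phi>\<close> is the value at \<open>t\<close>, expanded as a combination of words in the free
  associative ring, of the linear extension of \<open>\<phi>\<close>.\<close>

primrec pair :: "'x tree \<Rightarrow> ('x list \<Rightarrow> 'b::ab_group_add) \<Rightarrow> 'b" where
  "pair (Leaf x) \<phi> = \<phi> [x]"
| "pair (Node s t) \<phi> = pair s (\<lambda>u. pair t (\<lambda>v. \<phi> (u @ v) - \<phi> (v @ u)))"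

definition pair_poly :: "'x lie_poly \<Rightarrow> ('x list \<Rightarrow> 'b::ab_group_add) \<Rightarrow> 'b" where
  "pair_poly p \<phi> = frag_ext (\<lambda>t. pair t \<phi>) p"

lemma pair_diff: "pair t (\<lambda>w. \<phi> w - \<psi> w) = pair t \<phi> - pair t \<psi>"
proof (induction t arbitrary: \<phi> \<psi>)
  case (Node s t)
  have "pair t (\<lambda>v. \<phi> (u @ v) - \<psi> (u @ v) - (\<phi> (v @ u) - \<psi> (v @ u))) =
      pair t (\<lambda>v. \<phi> (u @ v) - \<phi> (v @ u)) - pair t (\<lambda>v. \<psi> (u @ v) - \<psi> (v @ u))" for u
    by (subst Node.IH(2)[symmetric]) (simp add: algebra_simps)
  then show ?case by (simp add: Node.IH(1))
qed simp

lemma pair_0 [simp]: "pair t (\<lambda>w. 0) = 0"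
  using pair_diff[of t "\<lambda>w. 0" "\<lambda>w. 0"] by simp

lemma additive_pair: "Modules.additive f \<Longrightarrow> f (pair t \<phi>) = pair t (\<lambda>w. f (\<phi> w))"
  by (induction t arbitrary: \<phi>) (simp_all add: additive.diff)

lemma pair_swap: "pair s (\<lambda>u. pair t (\<psi> u)) = pair t (\<lambda>v. pair s (\<lambda>u. \<psi> u v))"
  by (induction s arbitrary: \<psi>) (simp_all add: pair_diff)

text \<open>The expansion of a tree involves only words with as many letters as the tree has leaves.
  In particular the value at \<open>[]\<close> never matters.\<close>

lemma pair_cong:
  "(\<And>w. length w = leaves t \<Longrightarrow> \<phi> w = \<psi> w) \<Longrightarrow> pair t \<phi> = pair t \<psi>"
proof (induction t arbitrary: \<phi> \<psi>)
  case (Leaf x)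
  then show ?case by simp
next
  case (Node s t)
  show ?case
    by (simp, rule Node.IH(1), rule Node.IH(2)) (simp add: Node.prems)
qed

lemma (in additive_subgroup) pair_mem: "(\<And>w. \<phi> w \<in> K) \<Longrightarrow> pair t \<phi> \<in> K"
proof (induction t arbitrary: \<phi>)
  case (Node s t)
  show ?case
    by (simp, rule Node.IH(1), rule Node.IH(2)) (simp add: Node.prems diff)
qed simp

lemma pair_Node: "pair (Node s t) \<phi> =
    pair s (\<lambda>u. pair t (\<lambda>v. \<phi> (u @ v))) - pair t (\<lambda>u. pair s (\<lambda>v. \<phi> (u @ v)))"
proof -
  have "pair s (\<lambda>u. pair t (\<lambda>v. \<phi> (v @ u))) = pair t (\<lambda>u. pair s (\<lambda>v. \<phi> (u @ v)))"
    by (rule pair_swap)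
  then show ?thesis by (simp add: pair_diff)
qed

declare pair.simps(2) [simp del]

lemma pair_poly_of [simp]: "pair_poly (frag_of t) \<phi> = pair t \<phi>"
  by (simp add: pair_poly_def)

lemma pair_poly_additive: "Modules.additive (\<lambda>p. pair_poly p \<phi>)"
  by (simp add: pair_poly_def frag_ext_additive)

lemmas pair_poly_add = additive.add[OF pair_poly_additive]
  and pair_poly_diff = additive.diff[OF pair_poly_additive]
  and pair_poly_0 [simp] = additive.zero[OF pair_poly_additive]
  and pair_poly_zmul = additive_zmul[OF pair_poly_additive]

lemma pair_poly_fun_diff: "pair_poly p (\<lambda>w. \<phi> w - \<psi> w) = pair_poly p \<phi> - pair_poly p \<psi>"
  by (simp add: pair_poly_def pair_diff frag_ext_fun_diff)

lemma additive_pair_poly: "Modules.additive f \<Longrightarrow> f (pair_poly p \<phi>) = pair_poly p (\<lambda>w. f (\<phi> w))"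
  by (simp add: pair_poly_def additive_frag_ext additive_pair)

lemma (in additive_subgroup) pair_poly_mem: "(\<And>w. \<phi> w \<in> K) \<Longrightarrow> pair_poly p \<phi> \<in> K"
  by (simp add: pair_poly_def frag_ext_mem pair_mem)

lemma pair_poly_br:
  "pair_poly (br p (frag_of t)) \<phi> = pair_poly p (\<lambda>u. pair t (\<lambda>v. \<phi> (u @ v) - \<phi> (v @ u)))"
  by (rule additive_frag_eq[of "\<lambda>p. pair_poly (br p (frag_of t)) \<phi>"])
    (rule additive_comp[OF pair_poly_additive br_additive_left], rule pair_poly_additive,
     simp add: pair.simps(2))

section \<open>Partially commutative words\<close>

inductive swap :: "('x \<times> 'x) set \<Rightarrow> 'x list \<Rightarrow> 'x list \<Rightarrow> bool" for \<Theta> where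
  swap: "(a, b) \<in> \<Theta> \<Longrightarrow> swap \<Theta> (u @ a # b # v) (u @ b # a # v)"

text \<open>The choice sees only the class of \<open>w\<close> under partial commutation, so
  equivalent words receive the same representative; the representatives index a basis of the
  partially commutative monoid ring.\<close>

definition normal_word :: "('x \<times> 'x) set \<Rightarrow> 'x list \<Rightarrow> 'x list" where
  "normal_word \<Theta> w = (SOME w'. equivclp (swap \<Theta>) w w')"

lemma normal_word_equiv: "equivclp (swap \<Theta>) w (normal_word \<Theta> w)"
  unfolding normal_word_def by (rule someI[of _ w]) simp

lemma normal_word_eq:
  assumes "equivclp (swap \<Theta>) w w'"
  shows "normal_word \<Theta> w = normal_word \<Theta> w'"
proof -
  have "equivclp (swap \<Theta>) w = equivclp (swap \<Theta>) w'"
    using assms by (intro ext) (meson equivclp_sym equivclp_trans)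
  then show ?thesis by (simp add: normal_word_def)
qed

lemma normal_word_swap: "(a, b) \<in> \<Theta> \<Longrightarrow>
    normal_word \<Theta> (u @ a # b # v) = normal_word \<Theta> (u @ b # a # v)"
  by (intro normal_word_eq r_into_equivclp swap)

lemma equivclp_invariant:
  assumes "equivclp r x y" "\<And>x y. r x y \<Longrightarrow> f x = f y"
  shows "f x = f y"
  using assms(1) by (induction rule: equivclp_induct) (auto dest: assms(2))

text \<open>These are the functions of words whose linear extension factors through the partially
  commutative ring on \<open>A\<close>, in which letters outside \<open>A\<close> are zero.\<close>

definition trace_fun :: "'x set \<Rightarrow> ('x \<times> 'x) set \<Rightarrow> ('x list \<Rightarrow> 'b::zero) \<Rightarrow> bool" where
  "trace_fun A \<Theta> \<phi> \<longleftrightarrow> (\<forall>u v a b. (a, b) \<in> \<Theta> \<longrightarrow> \<phi> (u @ a # b # v) = \<phi> (u @ b # a # v)) \<and>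
     (\<forall>w. \<not> set w \<subseteq> A \<longrightarrow> \<phi> w = 0)"

lemma trace_funI:
  assumes "\<And>u v a b. (a, b) \<in> \<Theta> \<Longrightarrow> \<phi> (u @ a # b # v) = \<phi> (u @ b # a # v)"
    and "\<And>w. \<not> set w \<subseteq> A \<Longrightarrow> \<phi> w = 0"
  shows "trace_fun A \<Theta> \<phi>"
  unfolding trace_fun_def using assms by blast

lemma trace_fun_swap: "trace_fun A \<Theta> \<phi> \<Longrightarrow> (a, b) \<in> \<Theta> \<Longrightarrow> \<phi> (u @ a # b # v) = \<phi> (u @ b # a # v)"
  and trace_fun_outside: "trace_fun A \<Theta> \<phi> \<Longrightarrow> \<not> set w \<subseteq> A \<Longrightarrow> \<phi> w = 0"
  unfolding trace_fun_def by blast+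

lemma trace_fun_normal_word:
  assumes "trace_fun A \<Theta> \<phi>"
  shows "\<phi> (normal_word \<Theta> w) = \<phi> w"
proof (rule sym, rule equivclp_invariant[OF normal_word_equiv])
  show "\<phi> x = \<phi> y" if "swap \<Theta> x y" for x y
    using that by cases (auto intro: trace_fun_swap[OF assms])
qed

text \<open>The image of a word in the partially commutative monoid ring.\<close>

definition trace_of :: "'x set \<Rightarrow> ('x \<times> 'x) set \<Rightarrow> 'x list \<Rightarrow> 'x list \<Rightarrow>\<^sub>0 int" where
  "trace_of A \<Theta> w = (if set w \<subseteq> A then frag_of (normal_word \<Theta> w) else 0)"

lemma trace_fun_trace_of: "trace_fun A \<Theta> (trace_of A \<Theta>)"
  by (rule trace_funI) (auto simp: trace_of_def, metis normal_word_swap)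

definition trace_zero :: "'x set \<Rightarrow> ('x \<times> 'x) set \<Rightarrow> 'x lie_poly \<Rightarrow> bool" where
  "trace_zero A \<Theta> p \<longleftrightarrow> pair_poly p (trace_of A \<Theta>) = 0"

text \<open>Every such function is \<open>trace_of\<close> followed by an additive map, so vanishing
  in this universal target forces vanishing everywhere.\<close>

lemma trace_zero_pair_poly:
  assumes "trace_zero A \<Theta> p" "trace_fun A \<Theta> \<phi>"
  shows "pair_poly p \<phi> = 0"
proof -
  have "\<phi> = (\<lambda>w. frag_ext \<phi> (trace_of A \<Theta> w))"
    using trace_fun_normal_word[OF assms(2)] trace_fun_outside[OF assms(2)]
    by (auto simp: trace_of_def)
  then have "pair_poly p \<phi> = pair_poly p (\<lambda>w. frag_ext \<phi> (trace_of A \<Theta> w))"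
    by metis
  also have "\<dots> = frag_ext \<phi> (pair_poly p (trace_of A \<Theta>))"
    by (rule additive_pair_poly[OF frag_ext_additive, symmetric])
  finally show ?thesis using assms(1) by (simp add: trace_zero_def)
qed

lemma trace_zero_diff: "trace_zero A \<Theta> p \<Longrightarrow> trace_zero A \<Theta> q \<Longrightarrow> trace_zero A \<Theta> (p - q)"
  by (simp add: trace_zero_def pair_poly_diff)

text \<open>The target of \<open>trace_of\<close> is a free abelian group and hence has no
  torsion.\<close>

lemma trace_zero_zmul: "k \<noteq> 0 \<Longrightarrow> trace_zero A \<Theta> (zmul k p) \<longleftrightarrow> trace_zero A \<Theta> p"
  by (simp only: trace_zero_def pair_poly_zmul) (simp add: zmul_frag)

lemma lie_ideal_pair_poly:
  "p \<in> lie_ideal A \<Theta> \<Longrightarrow> trace_fun A \<Theta> \<phi> \<Longrightarrow> pair_poly p \<phi> = 0"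
proof (induction arbitrary: \<phi> rule: lie_ideal.induct)
  case (alternating a)
  then show ?case by (simp add: pair_Node)
next
  case (antisymmetric a b)
  then show ?case by (simp add: pair_Node pair_poly_add)
next
  case (jacobi a b c)
  have *: "pair (Node (Node a b) c) \<phi> =
      pair a (\<lambda>u. pair b (\<lambda>v. pair c (\<lambda>w. \<phi> (u @ v @ w)))) - pair b (\<lambda>v. pair a (\<lambda>u. pair c (\<lambda>w. \<phi> (v @ u @ w))))
    - (pair c (\<lambda>w. pair a (\<lambda>u. pair b (\<lambda>v. \<phi> (w @ u @ v)))) - pair c (\<lambda>w. pair b (\<lambda>v. pair a (\<lambda>u. \<phi> (w @ v @ u)))))"
    for a b c by (simp add: pair_Node pair_diff)
  show ?case by (simp add: * pair_poly_add)
next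
  case (outside y)
  then show ?case using trace_fun_outside[of A \<Theta> \<phi> "[y]"] by simp
next
  case (commute x y)
  then show ?case using trace_fun_swap[of A \<Theta> \<phi> x y "[]" "[]"] by (simp add: pair_Node)
next
  case (diff p q)
  then show ?case by (simp add: pair_poly_diff)
next
  case (bracket p c)
  \<comment> \<open>The bracket with \<open>c\<close> is transposed onto the function; the induction
    is over all functions, and the transposed one still respects the commutations.\<close>
  have "trace_fun A \<Theta> (\<lambda>u. pair c (\<lambda>v. \<phi> (u @ v) - \<phi> (v @ u)))"
  proof (rule trace_funI)
    fix u v :: "'a list" and a b :: 'a assume ab: "(a, b) \<in> \<Theta>"
    show "pair c (\<lambda>w. \<phi> ((u @ a # b # v) @ w) - \<phi> (w @ u @ a # b # v)) =
        pair c (\<lambda>w. \<phi> ((u @ b # a # v) @ w) - \<phi> (w @ u @ b # a # v))"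
      using trace_fun_swap[OF bracket.prems ab, of u "v @ w" for w]
        trace_fun_swap[OF bracket.prems ab, of "w @ u" v for w]
      by simp
  qed (simp add: trace_fun_outside[OF bracket.prems])
  from bracket.IH[OF this] show ?case by (simp add: pair_poly_br)
qed

lemma lie_ideal_trace_zero: "p \<in> lie_ideal A \<Theta> \<Longrightarrow> trace_zero A \<Theta> p"
  by (simp add: trace_zero_def lie_ideal_pair_poly trace_fun_trace_of)

section \<open>The Dynkin operator\<close>

context lie_quotient
begin

abbreviation act :: "'x lie_poly \<Rightarrow> 'x list \<Rightarrow> 'x lie_poly" where
  "act \<equiv> foldl (\<lambda>a y. br a (frag_of (Leaf y)))"

lemma act_additive: "Modules.additive (\<lambda>a. act a w)"
proof (induction w rule: rev_induct)
  case (snoc y w)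
  then show ?case by (simp add: Modules.additive_def br_add_left)
qed (simp add: Modules.additive_def)

lemma act_mem: "a \<in> K \<Longrightarrow> act a w \<in> K"
  by (induction w arbitrary: a) (simp_all add: br_of_mem)

text \<open>Right bracketing is a representation of the Lie ring modulo \<open>K\<close>: letting
  the associative expansion of \<open>t\<close> act letter by letter amounts to a single bracket
  with \<open>t\<close>. The node case is \<open>br_derivation\<close>.\<close>

lemma pair_act: "pair t (act a) - br a (frag_of t) \<in> K"
proof (induction t arbitrary: a)
  case (Leaf x)
  then show ?case by simp
next
  case (Node s t)
  have *: "pair s (\<lambda>u. pair t (\<lambda>v. act a (u @ v))) - br (br a (frag_of s)) (frag_of t) \<in> K"
    if s: "\<And>a. pair s (act a) - br a (frag_of s) \<in> K"
      and t: "\<And>a. pair t (act a) - br a (frag_of t) \<in> K" for s t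
  proof -
    have "pair s (\<lambda>u. pair t (act (act a u)) - br (act a u) (frag_of t)) \<in> K"
      by (intro pair_mem t)
    then have 1: "pair s (\<lambda>u. pair t (act (act a u))) - br (pair s (act a)) (frag_of t) \<in> K"
      by (simp add: pair_diff additive_pair[OF br_additive_left])
    have 2: "br (pair s (act a) - br a (frag_of s)) (frag_of t) \<in> K"
      by (rule br_left[OF s])
    show ?thesis
      using add[OF 1 2] by (simp add: br_diff_left)
  qed
  have "(pair s (\<lambda>u. pair t (\<lambda>v. act a (u @ v))) - br (br a (frag_of s)) (frag_of t))
    - (pair t (\<lambda>u. pair s (\<lambda>v. act a (u @ v))) - br (br a (frag_of t)) (frag_of s))
    + (br (br a (frag_of s)) (frag_of t) - br (br a (frag_of t)) (frag_of s)
       - br a (br (frag_of s) (frag_of t))) \<in> K"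
    by (rule add[OF diff[OF *[OF Node.IH] *[OF Node.IH(2,1)]] br_derivation])
  then show ?case by (simp add: pair_Node)
qed

fun dynkin :: "'x list \<Rightarrow> 'x lie_poly" where
  "dynkin [] = 0"
| "dynkin (x # w) = act (frag_of (Leaf x)) w"

lemma dynkin_append: "u \<noteq> [] \<Longrightarrow> dynkin (u @ v) = act (dynkin u) v"
  by (cases u) auto

text \<open>The Dynkin-Specht-Wever identity. In a node, the words beginning in \<open>s\<close>
  contribute \<open>leaves s\<close> copies of the bracket by \<open>pair_act\<close>, the words
  beginning in \<open>t\<close> contribute \<open>leaves t\<close> copies of the opposite bracket
  with a minus sign, and antisymmetry adds them up.\<close>

lemma pair_dynkin: "pair t dynkin - zmul (int (leaves t)) (frag_of t) \<in> K"
proof (induction t)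
  case (Leaf x)
  then show ?case by simp
next
  case (Node s t)
  have *: "pair s (\<lambda>u. pair t (\<lambda>v. dynkin (u @ v))) - zmul (int (leaves s)) (frag_of (Node s t)) \<in> K"
    if s: "pair s dynkin - zmul (int (leaves s)) (frag_of s) \<in> K" for s t
  proof -
    have "pair s (\<lambda>u. pair t (act (dynkin u)) - br (dynkin u) (frag_of t)) \<in> K"
      by (intro pair_mem pair_act)
    then have 1: "pair s (\<lambda>u. pair t (act (dynkin u))) - br (pair s dynkin) (frag_of t) \<in> K"
      by (simp add: pair_diff additive_pair[OF br_additive_left])
    have 2: "br (pair s dynkin - zmul (int (leaves s)) (frag_of s)) (frag_of t) \<in> K"
      by (rule br_left[OF s])
    \<comment> \<open>The rule \<open>dynkin_append\<close> fails for an empty first word, where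
      \<open>dynkin\<close> has its default value 0; words in the expansion of a tree are
      nonempty.\<close>
    have 3: "pair s (\<lambda>u. pair t (act (dynkin u))) = pair s (\<lambda>u. pair t (\<lambda>v. dynkin (u @ v)))"
    proof (rule pair_cong)
      fix u :: "'x list" assume "length u = leaves s"
      then have "u \<noteq> []" by (metis leaves_pos length_0_conv less_irrefl)
      then show "pair t (act (dynkin u)) = pair t (\<lambda>v. dynkin (u @ v))"
        by (simp add: dynkin_append)
    qed
    show ?thesis
      using add[OF 1 2] by (simp add: br_diff_left br_zmul_left 3)
  qed
  have "(pair s (\<lambda>u. pair t (\<lambda>v. dynkin (u @ v))) - zmul (int (leaves s)) (frag_of (Node s t)))
    - (pair t (\<lambda>u. pair s (\<lambda>v. dynkin (u @ v))) - zmul (int (leaves t)) (frag_of (Node t s)))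
    - zmul (int (leaves t)) (frag_of (Node s t) + frag_of (Node t s)) \<in> K"
    by (rule diff[OF diff[OF *[OF Node.IH(1)] *[OF Node.IH(2)]] zmul[OF anti]])
  then show ?case
    by (simp add: pair_Node zmul_add zmul_right_add algebra_simps)
qed

end

text \<open>Left-normed bracketing is constant modulo the ideal on partial commutation classes, so
  it factors through the partially commutative ring. There \<open>p\<close> vanishes, whereas the
  Dynkin identity sends \<open>p\<close> to \<open>m\<close> times itself.\<close>

lemma dynkin_trace_zero:
  assumes p: "trace_zero A \<Theta> p" "Poly_Mapping.keys p \<subseteq> {t. leaves t = m}"
  shows "zmul (int m) p \<in> lie_ideal A \<Theta>"
proof -
  interpret lie_quotient "lie_ideal A \<Theta>" by (rule lie_quotient_lie_ideal)
  let ?K = "lie_ideal A \<Theta>"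
  have out: "dynkin w \<in> ?K" if "\<not> set w \<subseteq> A" for w
  proof -
    obtain u y v where w: "w = u @ y # v" "y \<notin> A" using \<open>\<not> set w \<subseteq> A\<close>
      by (metis split_list subsetI)
    have 1: "br a (frag_of (Leaf y)) \<in> ?K" for a
      by (intro br_right lie_ideal.outside w)
    have 2: "frag_of (Leaf y) \<in> ?K" by (intro lie_ideal.outside w)
    show ?thesis
      using act_mem[OF 1[of "dynkin u"], of v] act_mem[OF 2, of v]
      by (cases "u = []") (simp_all add: w dynkin_append)
  qed
  have sw: "dynkin (u @ a # b # v) - dynkin (u @ b # a # v) \<in> ?K" if ab: "(a, b) \<in> \<Theta>" for a b u v
  proof -
    have c: "br (frag_of (Leaf a)) (frag_of (Leaf b)) \<in> ?K" by (simp add: lie_ideal.commute ab)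
    have "dynkin (u @ [a, b]) - dynkin (u @ [b, a]) \<in> ?K"
    proof (cases "u = []")
      case True
      then show ?thesis
        using diff[OF c diff[OF br_anti[of "frag_of (Leaf a)" "frag_of (Leaf b)"] c]] by simp
    next
      case False
      show ?thesis
        using add[OF br_derivation[of "dynkin u" "frag_of (Leaf a)" "frag_of (Leaf b)"]
            br_right[OF c, of "dynkin u"]] False
        by (simp add: dynkin_append)
    qed
    then have "act (dynkin (u @ [a, b]) - dynkin (u @ [b, a])) v \<in> ?K" by (rule act_mem)
    then show ?thesis
      using dynkin_append[of "u @ [a, b]" v] dynkin_append[of "u @ [b, a]" v]
      by (simp add: additive.diff[OF act_additive])
  qed
  have nf: "dynkin w - dynkin (normal_word \<Theta> w) \<in> ?K" for w
    using normal_word_equiv[of \<Theta> w]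
  proof (induction rule: equivclp_induct)
    case base
    then show ?case by simp
  next
    case (step y z)
    have "dynkin y - dynkin z \<in> ?K"
      using step.hyps(2)
    proof
      assume "swap \<Theta> y z"
      then show ?thesis by cases (simp add: sw)
    next
      assume "swap \<Theta> z y"
      then show ?thesis by cases (metis sw minus_diff_eq minus_iff)
    qed
    from add[OF step.IH this] show ?case by simp
  qed
  \<comment> \<open>\<open>dynkin\<close> is constant on classes only modulo the ideal;
    \<open>?g\<close> is an exactly constant replacement that differs from it by elements of the
    ideal.\<close>
  let ?g = "\<lambda>w. if set w \<subseteq> A then dynkin (normal_word \<Theta> w) else 0"
  have "pair_poly p ?g = 0"
    by (intro trace_zero_pair_poly[OF p(1)] trace_funI) (auto, metis normal_word_swap)
  moreover have "pair_poly p (\<lambda>w. dynkin w - ?g w) \<in> ?K"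
    by (intro pair_poly_mem) (simp add: nf out)
  ultimately have 1: "pair_poly p dynkin \<in> ?K" by (simp add: pair_poly_fun_diff)
  have "pair_poly p dynkin - zmul (int m) p \<in> ?K"
    using p(2)
  proof (induction p rule: frag_induction)
    case (one t)
    then show ?case using pair_dynkin[of t] by simp
  next
    case (diff a b)
    from additive_subgroup.diff[OF additive_subgroup_axioms diff] show ?case
      by (simp add: pair_poly_diff zmul_right_diff algebra_simps)
  qed (simp add: zmul_right_0)
  from diff[OF 1 this] show ?thesis by simp
qed

section \<open>Representations over a prime field\<close>

\<comment> \<open>The group Q/Z. It has elements of every order, so one coefficient type serves all
  primes, whereas a type of integers modulo \<open>q\<close> would depend on
  \<open>q\<close>.\<close>
quotient_type circle = rat / "\<lambda>x y. x - y \<in> \<int>"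
proof (rule equivpI)
  show "reflp (\<lambda>x y :: rat. x - y \<in> \<int>)" by (simp add: reflp_def)
  show "symp (\<lambda>x y :: rat. x - y \<in> \<int>)"
    by (metis (mono_tags, lifting) Ints_minus minus_diff_eq sympI)
  show "transp (\<lambda>x y :: rat. x - y \<in> \<int>)"
  proof (rule transpI)
    fix x y z :: rat assume "x - y \<in> \<int>" "y - z \<in> \<int>"
    from Ints_add[OF this] show "x - z \<in> \<int>" by simp
  qed
qed

instantiation circle :: ab_group_add
begin

lift_definition zero_circle :: circle is 0 .

lift_definition plus_circle :: "circle \<Rightarrow> circle \<Rightarrow> circle" is "(+)"
  by (metis Ints_add add_diff_add)

lift_definition uminus_circle :: "circle \<Rightarrow> circle" is uminus
  by (metis Ints_minus minus_diff_minus)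

lift_definition minus_circle :: "circle \<Rightarrow> circle \<Rightarrow> circle" is "(-)"
  by (metis Ints_diff diff_diff_eq2 diff_add_eq add_diff_eq diff_diff_eq add.commute)

instance
  by standard (transfer; simp)+

end

lemma circle_torsion:
  assumes "q > 1"
  obtains c :: circle where "c \<noteq> 0" "zmul q c = 0"
proof
  let ?c = "abs_circle (1 / of_int q)"
  have "(1 / of_int q :: rat) \<notin> \<int>"
  proof
    assume "(1 / of_int q :: rat) \<in> \<int>"
    then obtain k where "1 / of_int q = (of_int k :: rat)" by (elim Ints_cases)
    with assms have "of_int (k * q) = (of_int 1 :: rat)" by (simp add: field_simps)
    then have "k * q = 1" by (simp only: of_int_eq_iff)
    then have "q dvd 1" by (metis dvd_triv_right)
    with assms show False by simp
  qed
  then show "?c \<noteq> 0" by (simp add: zero_circle_def circle.abs_eq_iff)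
  have "zmul k (abs_circle r) = abs_circle (of_int k * r)" for k r
    by (induction k rule: int_induct[where k = 0])
      (simp_all add: zmul_add zmul_diff zero_circle_def plus_circle.abs_eq minus_circle.abs_eq algebra_simps)
  then show "zmul q ?c = 0" using assms by (simp add: zero_circle_def circle.abs_eq_iff)
qed

text \<open>A representation, on the \<open>q\<close>-torsion of an abelian group, of the ideal \<open>I\<close> modulo \<open>K\<close>.\<close>

locale lie_rep = lie_quotient K for K :: "'x lie_poly set" +
  fixes q :: int and I :: "'x lie_poly set" and \<rho> :: "'x lie_poly \<Rightarrow> 'v::ab_group_add \<Rightarrow> 'v"
  assumes sub: "additive_subgroup I"
    and K_I: "a \<in> K \<Longrightarrow> a \<in> I"
    and ideal: "a \<in> I \<Longrightarrow> br a b \<in> I"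
    and tors: "a \<in> I \<Longrightarrow> zmul q f = 0 \<Longrightarrow> zmul q (\<rho> a f) = 0"
    and rep_diff: "a \<in> I \<Longrightarrow> zmul q f = 0 \<Longrightarrow> zmul q g = 0 \<Longrightarrow> \<rho> a (f - g) = \<rho> a f - \<rho> a g"
    and diff_rep: "a \<in> I \<Longrightarrow> b \<in> I \<Longrightarrow> zmul q f = 0 \<Longrightarrow> \<rho> (a - b) f = \<rho> a f - \<rho> b f"
    and rep_K: "a \<in> K \<Longrightarrow> zmul q f = 0 \<Longrightarrow> \<rho> a f = 0"
    and rep_br: "a \<in> I \<Longrightarrow> b \<in> I \<Longrightarrow> zmul q f = 0 \<Longrightarrow> \<rho> (br a b) f = \<rho> a (\<rho> b f) - \<rho> b (\<rho> a f)"
begin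

sublocale I: additive_subgroup I by (rule sub)

lemma ideal': "a \<in> I \<Longrightarrow> br b a \<in> I"
  using I.diff[OF K_I[OF br_anti[of b a]] ideal[of a b]] by simp

lemma zero_rep: "zmul q f = 0 \<Longrightarrow> \<rho> 0 f = 0"
  using diff_rep[of 0 0 f] by simp

end

text \<open>In a product of two transported operators only the inner composite
  \<open>c (d g)\<close> occurs. The other composite may lose information, as it does in the coding
  of sequences by functions on lists, where the value at \<open>[]\<close> is discarded.\<close>

lemma (in lie_rep) lie_rep_transport:
  fixes c :: "'u::ab_group_add \<Rightarrow> 'v" and d :: "'v \<Rightarrow> 'u"
  assumes c: "Modules.additive c" and d: "Modules.additive d" and cd: "\<And>g. c (d g) = g"
  shows "lie_rep K q I (\<lambda>a f. d (\<rho> a (c f)))"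
proof -
  have zc: "zmul q (c f) = 0" if "zmul q f = 0" for f
    using additive_zmul[OF c, of q f] that by (simp add: additive.zero[OF c])
  show ?thesis
    by unfold_locales
      (simp_all add: K_I ideal zc tors rep_diff diff_rep rep_K rep_br cd additive.diff[OF c]
        additive.diff[OF d] additive.zero[OF d] additive_zmul[OF d, symmetric])
qed

subsection \<open>Extending a representation by one element\<close>

text \<open>The coinduced module consists of the sequences in \<open>'v\<close>.  Reading a sequence as the Taylor
  coefficients of a function of \<open>s\<close>, the element \<open>x\<close> acts as \<open>d/ds\<close> and
  \<open>a \<in> I\<close> as \<open>\<rho> (exp (s ad x) a)\<close>.\<close>

context lie_rep
begin

context
  fixes x :: "'x lie_poly"
  assumes x_ideal: "\<And>b. br x b \<in> I" and x_alt: "br x x \<in> K"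
    and q: "Factorial_Ring.prime q" and qK: "\<And>a. zmul q a \<in> K"
begin

primrec coind :: "nat \<Rightarrow> 'x lie_poly \<Rightarrow> (nat \<Rightarrow> 'v) \<Rightarrow> 'v" where
  "coind 0 a f = \<rho> a (f 0)"
| "coind (Suc k) a f = coind k a (\<lambda>i. f (Suc i)) + coind k (br x a) f"

lemma coind_tors:
  "a \<in> I \<Longrightarrow> zmul q f = 0 \<Longrightarrow> zmul q (coind k a f) = 0"
  by (induction k arbitrary: a f)
    (simp_all add: zmul_fun zero_fun_def fun_eq_iff tors x_ideal zmul_right_add)

lemma coind_diff: "a \<in> I \<Longrightarrow> zmul q f = 0 \<Longrightarrow> zmul q g = 0 \<Longrightarrow>
    coind k a (f - g) = coind k a f - coind k a g"
proof (induction k arbitrary: a f g)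
  case (Suc k)
  then have "zmul q (\<lambda>i. f (Suc i)) = 0" "zmul q (\<lambda>i. g (Suc i)) = 0"
    by (simp_all add: zmul_fun zero_fun_def fun_eq_iff)
  from Suc.IH[OF Suc.prems(1) this] Suc.IH[OF x_ideal Suc.prems(2,3)]
  show ?case by (simp add: fun_diff_def)
qed (simp add: zmul_fun zero_fun_def fun_eq_iff rep_diff)

lemma diff_coind: "a \<in> I \<Longrightarrow> b \<in> I \<Longrightarrow> zmul q f = 0 \<Longrightarrow> coind k (a - b) f = coind k a f - coind k b f"
proof (induction k arbitrary: a b f)
  case (Suc k)
  then have "zmul q (\<lambda>i. f (Suc i)) = 0" by (simp add: zmul_fun zero_fun_def fun_eq_iff)
  from Suc.IH[OF Suc.prems(1,2) this] Suc.IH[OF x_ideal x_ideal Suc.prems(3)]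
  show ?case by (simp add: br_diff_right)
qed (simp add: zmul_fun zero_fun_def fun_eq_iff diff_rep)

lemma coind_K: "a \<in> K \<Longrightarrow> zmul q f = 0 \<Longrightarrow> coind k a f = 0"
  by (induction k arbitrary: a f)
    (simp_all add: zmul_fun zero_fun_def fun_eq_iff rep_K br_right)

lemma coind_cong_K:
  assumes "a \<in> I" "b \<in> I" "a - b \<in> K" "zmul q f = 0"
  shows "coind k a f = coind k b f"
  using diff_coind[OF assms(1,2,4)] coind_K[OF assms(3,4)] by simp

lemma coind_minus: "a \<in> I \<Longrightarrow> zmul q f = 0 \<Longrightarrow> coind k (- a) f = - coind k a f"
  using diff_coind[of 0 a f k] coind_K[of 0 f k] by simp

lemma coind_add: "a \<in> I \<Longrightarrow> b \<in> I \<Longrightarrow> zmul q f = 0 \<Longrightarrow> coind k (a + b) f = coind k a f + coind k b f"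
  using diff_coind[of a "- b" f k] coind_minus[of b f k] by simp

lemma coind_zmul: "a \<in> I \<Longrightarrow> zmul q f = 0 \<Longrightarrow> coind k (zmul j a) f = zmul j (coind k a f)"
  by (induction j rule: int_induct[where k = 0])
    (simp_all add: coind_K zmul_add zmul_diff coind_add diff_coind I.zmul)

text \<open>Since \<open>ad x\<close> is a derivation, \<open>exp (s ad x)\<close> preserves
  brackets. In coefficients this is an induction on \<open>k\<close>: both sides obey the product
  rule, and the term with \<open>br x (br a b)\<close> splits by Jacobi. The entries of a sequence
  are derivatives at 0, not divided by factorials, so the recursion makes sense modulo
  \<open>q\<close>.\<close>

lemma coind_br: "a \<in> I \<Longrightarrow> b \<in> I \<Longrightarrow> zmul q f = 0 \<Longrightarrow>
   coind k (br a b) f = coind k a (\<lambda>i. coind i b f) - coind k b (\<lambda>i. coind i a f)"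
proof (induction k arbitrary: a b f)
  case 0
  then show ?case by (simp add: zmul_fun zero_fun_def fun_eq_iff rep_br)
next
  case (Suc k)
  note ab = Suc.prems(1,2)
  let ?S = "\<lambda>i. f (Suc i)"
  have S: "zmul q ?S = 0" using Suc.prems by (simp add: zmul_fun zero_fun_def fun_eq_iff)
  have t: "zmul q (\<lambda>i. coind i c g) = 0" if "c \<in> I" "zmul q g = 0" for c g
    using coind_tors[OF that] by (simp add: zmul_fun zero_fun_def)
  have add: "coind k c (\<lambda>i. g i + h i) = coind k c g + coind k c h"
    if "c \<in> I" "zmul q g = 0" "zmul q h = 0" for c g h
  proof -
    have "zmul q (- h) = 0" "zmul q (g + h) = 0" using that
      by (simp_all add: zmul_right_minus zmul_right_add)
    from coind_diff[OF that(1) this(2) that(3), of k]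
    have "coind k c (g + h) = coind k c g + coind k c h" by simp
    then show ?thesis by (simp add: plus_fun_def)
  qed
  have 1: "br x (br a b) - (br a (br x b) + br (br x a) b) \<in> K"
    using diff[OF minus[OF br_derivation[of x a b]] br_anti[of "br x b" a]]
    by (simp add: algebra_simps)
  have "coind k (br x (br a b)) f = coind k (br a (br x b) + br (br x a) b) f"
    by (intro coind_cong_K x_ideal I.add ideal ideal' ab 1 Suc.prems)
  also have "\<dots> = coind k (br a (br x b)) f + coind k (br (br x a) b) f"
    by (intro coind_add x_ideal ideal ideal' ab Suc.prems)
  finally have 2: "coind k (br x (br a b)) f = coind k (br a (br x b)) f + coind k (br (br x a) b) f" .
  have 3: "coind k c (\<lambda>i. coind i d ?S + coind i (br x d) f) =
      coind k c (\<lambda>i. coind i d ?S) + coind k c (\<lambda>i. coind i (br x d) f)"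
    if "c \<in> I" "d \<in> I" for c d
    by (rule add[OF that(1) t[OF that(2) S] t[OF x_ideal Suc.prems(3)]])
  show ?case
    using Suc.IH[OF ab S] Suc.IH[OF ab(1) x_ideal Suc.prems(3), of b]
      Suc.IH[OF x_ideal ab(2) Suc.prems(3), of a]
    by (simp add: 2 3 ab)
qed

definition ext_ideal :: "'x lie_poly set" where
  "ext_ideal = {a + zmul j x |a j. a \<in> I}"

text \<open>The decomposition of \<open>c\<close> is not unique, as \<open>zmul q x\<close> lies in
  \<open>I\<close>; one is chosen, and \<open>ext_rep\<close> below shows that every other gives the
  same operator on \<open>q\<close>-torsion.\<close>

definition ext_rep :: "'x lie_poly \<Rightarrow> (nat \<Rightarrow> 'v) \<Rightarrow> nat \<Rightarrow> 'v" where
  "ext_rep c f = (case SOME (a, j). a \<in> I \<and> c = a + zmul j x of (a, j) \<Rightarrow>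
     (\<lambda>k. coind k a f + zmul j (f (Suc k))))"

text \<open>Primality enters here. If the coefficients of \<open>x\<close> in two decompositions
  differed by a number prime to \<open>q\<close>, Bezout would put \<open>x\<close> into
  \<open>I\<close>. So they differ by a multiple of \<open>q\<close>, which is invisible on
  \<open>q\<close>-torsion, and the parts in \<open>I\<close> agree modulo \<open>K\<close>.\<close>

lemma ext_rep:
  assumes x: "x \<notin> I" and a: "a \<in> I" and f: "zmul q f = 0"
  shows "ext_rep (a + zmul j x) f = (\<lambda>k. coind k a f + zmul j (f (Suc k)))"
proof -
  define p where "p = (SOME (b, i). b \<in> I \<and> a + zmul j x = b + zmul i x)"
  have "case p of (b, i) \<Rightarrow> b \<in> I \<and> a + zmul j x = b + zmul i x"
    unfolding p_def by (rule someI[of _ "(a, j)"]) (simp add: a)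
  then obtain b i where p: "p = (b, i)" "b \<in> I" and eq: "a + zmul j x = b + zmul i x"
    by (cases p) auto
  have ji: "zmul (j - i) x = b - a" using eq by (simp add: zmul_diff algebra_simps)
  have "q dvd j - i"
  proof (rule ccontr)
    assume "\<not> q dvd j - i"
    then have "coprime q (j - i)" using q by (simp add: prime_imp_coprime)
    then obtain u v where uv: "u * q + v * (j - i) = 1"
      by (metis bezout_int coprime_iff_gcd_eq_1)
    have "zmul u (zmul q x) + zmul v (zmul (j - i) x) \<in> I"
      unfolding ji by (intro I.add I.zmul I.diff K_I zmul qK p a)
    then show False using x uv by (simp add: zmul_mult[symmetric] zmul_add[symmetric])
  qed
  then obtain m where m: "j - i = q * m" by (elim dvdE)
  have "b - a \<in> K" unfolding ji[symmetric] m zmul_mult by (rule qK)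
  then have 1: "coind k b f = coind k a f" for k by (intro coind_cong_K p a f)
  have "zmul j g = zmul i g" if "zmul q g = 0" for g :: 'v
    using arg_cong[OF m, of "\<lambda>k. zmul k g"] that
    by (simp add: zmul_diff mult.commute[of q] zmul_mult zmul_right_0)
  then have 2: "zmul j (f k) = zmul i (f k)" for k
    using f by (simp add: zmul_fun zero_fun_def fun_eq_iff)
  show ?thesis
    unfolding ext_rep_def p_def[symmetric] by (simp add: p 1 2)
qed

lemma lie_rep_extend:
  assumes x: "x \<notin> I"
  shows "lie_rep K q ext_ideal ext_rep"
proof
  note tl = zmul_fun zero_fun_def fun_eq_iff
  show "0 \<in> ext_ideal"
    unfolding ext_ideal_def by (auto intro!: exI[of _ 0])
  show I': "a - b \<in> ext_ideal" if ab: "a \<in> ext_ideal" "b \<in> ext_ideal" for a b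
  proof -
    from ab obtain a' j b' i where "a = a' + zmul j x" "b = b' + zmul i x" "a' \<in> I" "b' \<in> I"
      by (auto simp: ext_ideal_def)
    then have "a - b = (a' - b') + zmul (j - i) x" "a' - b' \<in> I"
      by (auto simp: zmul_diff)
    then show ?thesis by (auto simp: ext_ideal_def)
  qed
  have I_ext: "a \<in> ext_ideal" if "a \<in> I" for a
    using that unfolding ext_ideal_def by (intro CollectI exI[of _ a] exI[of _ 0]) simp
  have brI: "br (a + zmul j x) b \<in> I" if "a \<in> I" for a j b
    by (simp only: br_add_left br_zmul_left) (intro I.add I.zmul ideal x_ideal that)
  have extI: "ext_rep a f = (\<lambda>k. coind k a f)" if "a \<in> I" "zmul q f = 0" for a f
    using ext_rep[OF x that, of 0] by simp
  show "a \<in> ext_ideal" if "a \<in> K" for a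
    using that by (intro I_ext K_I)
  show "br a b \<in> ext_ideal" if "a \<in> ext_ideal" for a b
  proof -
    from that obtain c j where "a = c + zmul j x" "c \<in> I" by (auto simp: ext_ideal_def)
    then show ?thesis by (simp add: I_ext brI)
  qed
  show "zmul q (ext_rep a f) = 0" if "a \<in> ext_ideal" "zmul q f = 0" for a f
  proof -
    from that(1) obtain b j where a: "a = b + zmul j x" "b \<in> I" by (auto simp: ext_ideal_def)
    have "zmul q (zmul j (f (Suc k))) = 0" for k
      using that(2) zmul_mult[of j q "f (Suc k)"]
      by (simp add: zmul_mult[symmetric] mult.commute[of q]) (simp add: zmul_mult tl zmul_right_0)
    then show ?thesis
      using that(2) coind_tors[OF a(2) that(2)]
      by (simp add: a ext_rep[OF x] zmul_fun zmul_right_add zero_fun_def)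
  qed
  show "ext_rep a (f - g) = ext_rep a f - ext_rep a g"
    if "a \<in> ext_ideal" "zmul q f = 0" "zmul q g = 0" for a f g
  proof -
    from that(1) obtain b j where a: "a = b + zmul j x" "b \<in> I" by (auto simp: ext_ideal_def)
    have "zmul q (f - g) = 0" using that by (simp add: zmul_right_diff)
    then show ?thesis using that(2,3) a(2)
      by (simp add: a ext_rep[OF x] coind_diff fun_eq_iff zmul_right_diff)
  qed
  show "ext_rep (a - b) f = ext_rep a f - ext_rep b f"
    if ab: "a \<in> ext_ideal" "b \<in> ext_ideal" and f: "zmul q f = 0" for a b f
  proof -
    from ab obtain a' j b' i where a: "a = a' + zmul j x" "b = b' + zmul i x" "a' \<in> I" "b' \<in> I"
      by (auto simp: ext_ideal_def)
    then have "a - b = (a' - b') + zmul (j - i) x" by (simp add: zmul_diff)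
    then have "ext_rep (a - b) f = (\<lambda>k. coind k (a' - b') f + zmul (j - i) (f (Suc k)))"
      using ext_rep[OF x I.diff[OF a(3,4)] f] by simp
    then show ?thesis using a(3,4) f
      by (simp add: a(1,2) ext_rep[OF x] diff_coind fun_eq_iff zmul_diff)
  qed
  show "ext_rep a f = 0" if "a \<in> K" "zmul q f = 0" for a f
    using that by (simp add: extI K_I coind_K zero_fun_def)
  show "ext_rep (br a b) f = ext_rep a (ext_rep b f) - ext_rep b (ext_rep a f)"
    if ab: "a \<in> ext_ideal" "b \<in> ext_ideal" and f: "zmul q f = 0" for a b f
  proof -
    from ab obtain a' j b' i where a: "a = a' + zmul j x" "b = b' + zmul i x" "a' \<in> I" "b' \<in> I"
      by (auto simp: ext_ideal_def)
    let ?S = "\<lambda>i. f (Suc i)"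
    have S: "zmul q ?S = 0" using f by (simp add: tl)
    have t: "zmul q (\<lambda>k. coind k c g) = 0" if "c \<in> I" "zmul q g = 0" for c g
      using coind_tors[OF that] by (simp add: zmul_fun zero_fun_def)
    have tz: "zmul q (zmul l g) = 0" if "zmul q g = 0" for l and g :: "nat \<Rightarrow> 'v"
      by (metis zmul_right_0 mult.commute that zmul_mult)
    have tp: "zmul q (g + h) = 0" if "zmul q g = 0" "zmul q h = 0" for g h :: "nat \<Rightarrow> 'v"
      using that by (simp add: zmul_right_add)
    have cadd: "coind k c (g + h) = coind k c g + coind k c h"
      if "c \<in> I" "zmul q g = 0" "zmul q h = 0" for c g h k
      using coind_diff[OF that(1) tp[OF that(2,3)] that(3), of k] by simp
    have czmul: "coind k c (zmul l g) = zmul l (coind k c g)"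
      if "c \<in> I" "zmul q g = 0" for c g k l
    proof (induction l rule: int_induct[where k = 0])
      case base
      then show ?case using coind_diff[OF that(1,2,2), of k] by (simp add: zero_fun_def)
    next
      case (step1 l)
      then show ?case
        using cadd[OF that(1) tz[OF that(2)] that(2)] by (simp only: zmul_add zmul_1)
    next
      case (step2 l)
      then show ?case
        using coind_diff[OF that(1) tz[OF that(2)] that(2)] by (simp only: zmul_diff zmul_1)
    qed
    have ER: "ext_rep (c + zmul l x) g = (\<lambda>k. coind k c g) + zmul l (\<lambda>k. g (Suc k))"
      if "c \<in> I" "zmul q g = 0" for c l g
      using ext_rep[OF x that] by (simp add: plus_fun_def zmul_fun)
    \<comment> \<open>The bracket has no component along \<open>x\<close>: the term with
      \<open>br x x\<close> is in \<open>K\<close> and everything else lies in \<open>I\<close>, so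
      only \<open>coind\<close> appears.\<close>
    have E: "ext_rep (br a b) f k = coind k a' (\<lambda>k. coind k b' f) - coind k b' (\<lambda>k. coind k a' f)
       + zmul j (coind k (br x b') f) - zmul i (coind k (br x a') f)" for k
    proof -
      have "br a b = br a' b' + zmul i (br a' x) + zmul j (br x b') + zmul j (zmul i (br x x))"
        by (simp add: a br_add_left br_add_right br_zmul_left br_zmul_right
            zmul_right_add add_ac zmul_mult[symmetric] mult.commute[of i])
      also have "br a' x = (br a' x + br x a') - br x a'" by simp
      finally have eq: "br a b = br a' b' - zmul i (br x a') + zmul j (br x b') +
          (zmul i (br a' x + br x a') + zmul j (zmul i (br x x)))"
        by (simp add: zmul_right_diff zmul_right_add)
      have "br a b \<in> I" unfolding a by (intro brI a)
      then have "ext_rep (br a b) f k = coind k (br a b) f"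
        using f by (simp add: extI)
      also have "\<dots> = coind k (br a' b' - zmul i (br x a') + zmul j (br x b')) f"
        by (intro coind_cong_K \<open>br a b \<in> I\<close> I.add I.diff I.zmul ideal x_ideal a f)
          (simp only: eq add_diff_cancel_left', intro add zmul br_anti x_alt)
      also have "\<dots> = coind k (br a' b') f - zmul i (coind k (br x a') f)
          + zmul j (coind k (br x b') f)"
        by (simp add: coind_add diff_coind coind_zmul I.diff I.zmul ideal x_ideal a f)
      finally show ?thesis by (simp add: coind_br a f)
    qed
    \<comment> \<open>The shift applied after \<open>b'\<close> yields
      \<open>coind (Suc k) b' f\<close>, whose recursion produces the summand with
      \<open>br x b'\<close>. The remaining mixed terms and the double shift are symmetric and
      cancel in the commutator.\<close>
    have "ext_rep a (ext_rep b f) k = coind k a' (\<lambda>k. coind k b' f) + zmul i (coind k a' ?S)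
        + zmul j (coind (Suc k) b' f) + zmul j (zmul i (f (Suc (Suc k))))"
      if a: "a = a' + zmul j x" "b = b' + zmul i x" "a' \<in> I" "b' \<in> I" for a b a' b' i j k
      by (simp add: a ER f t tp tz S cadd czmul) (simp add: zmul_fun plus_fun_def zmul_right_add)
    from this[OF a] this[OF a(2,1,4,3)]
    show ?thesis
      by (intro ext) (simp add: E zmul_right_add zmul_mult[symmetric] mult.commute)
  qed
qed

end

end

definition (in lie_rep) nontrivial_at :: "'x lie_poly \<Rightarrow> bool" where
  "nontrivial_at e \<longleftrightarrow> (\<exists>f. zmul q f = 0 \<and> \<rho> e f \<noteq> 0)"

type_synonym 'x circle_rep = "'x lie_poly \<Rightarrow> (nat list \<Rightarrow> circle) \<Rightarrow> nat list \<Rightarrow> circle"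

text \<open>Coding sequences of functions on \<open>nat list\<close> as functions on \<open>nat list\<close> keeps the
  coinduced module inside one type.\<close>

lemma lie_rep_extension:
  fixes \<rho> :: "'x circle_rep"
  assumes rep: "lie_rep K q I \<rho>" and q: "Factorial_Ring.prime q" and qK: "\<And>a. zmul q a \<in> K"
    and x: "\<And>b. br x b \<in> I" "br x x \<in> K"
  obtains I' and \<rho>' :: "'x circle_rep"
  where "lie_rep K q I' \<rho>'" "I \<subseteq> I'" "x \<in> I'"
    "\<And>e. e \<in> I \<Longrightarrow> lie_rep.nontrivial_at q \<rho> e \<Longrightarrow> lie_rep.nontrivial_at q \<rho>' e"
    "x \<notin> I \<Longrightarrow> lie_rep.nontrivial_at q \<rho>' x"
proof (cases "x \<in> I")
  case True
  then show ?thesis using that[of I \<rho>] rep by blast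
next
  case False
  interpret lie_rep K q I \<rho> by fact
  let ?c = "\<lambda>f :: nat list \<Rightarrow> circle. (\<lambda>i l. f (i # l))"
  let ?d = "\<lambda>g :: nat \<Rightarrow> nat list \<Rightarrow> circle. (\<lambda>l. case l of [] \<Rightarrow> 0 | i # m \<Rightarrow> g i m)"
  let ?I = "ext_ideal x" and ?r = "\<lambda>a f. ?d (ext_rep x a (?c f))"
  interpret E: lie_rep K q ?I "ext_rep x" by (rule lie_rep_extend[OF x q qK False])
  have "Modules.additive ?c" by standard (simp add: fun_eq_iff)
  moreover have "Modules.additive ?d"
    by standard (auto simp: fun_eq_iff split: list.split)
  ultimately have 1: "lie_rep K q ?I ?r" by (rule E.lie_rep_transport) simp
  then interpret R: lie_rep K q ?I ?r .
  have nt: "R.nontrivial_at e"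
    if "zmul q g = 0" "ext_rep x e g \<noteq> 0" for e g
    unfolding R.nontrivial_at_def
  proof (intro exI conjI notI)
    show "zmul q (?d g) = 0"
      using that(1) by (auto simp: zmul_fun fun_eq_iff zmul_right_0 split: list.split)
    assume "?r e (?d g) = 0"
    then have "ext_rep x e g i m = 0" for i m
      by (auto simp: fun_eq_iff dest: spec[of _ "i # m"])
    with that(2) show False by (simp add: fun_eq_iff)
  qed
  have I_ext: "e = e + zmul 0 x" for e by simp
  show ?thesis
  proof (rule that[OF 1])
    show "I \<subseteq> ?I"
      unfolding ext_ideal_def[OF x q qK] using I_ext by blast
    have "x = 0 + zmul 1 x" by simp
    then show "x \<in> ?I" unfolding ext_ideal_def[OF x q qK] using I.zero by blast
    show "R.nontrivial_at e" if e: "e \<in> I" "nontrivial_at e" for e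
    proof -
      from e(2) obtain f where f: "zmul q f = 0" "\<rho> e f \<noteq> 0" by (auto simp: nontrivial_at_def)
      \<comment> \<open>A sequence supported at 0: its image has \<open>\<rho> e f\<close> as entry
        0, so nontriviality survives the extension.\<close>
      let ?g = "\<lambda>i :: nat. if i = 0 then f else 0"
      have g: "zmul q ?g = 0"
        using f(1) by (auto simp: zmul_fun[of q ?g] fun_eq_iff zmul_right_0)
      have "ext_rep x e ?g = (\<lambda>k. coind x k e ?g)"
        using ext_rep[OF x q qK False e(1) g, of 0] by simp
      then have "ext_rep x e ?g 0 = \<rho> e f" by (simp add: coind.simps[OF x q qK])
      with f(2) have "ext_rep x e ?g \<noteq> 0" by (metis zero_fun_apply)
      with g show ?thesis by (rule nt)
    qed
    \<comment> \<open>A constant sequence is fixed by the shift, hence by \<open>x\<close>. So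
      \<open>x\<close> acts nontrivially even if the given representation is zero.\<close>
    obtain c :: circle where c: "c \<noteq> 0" "zmul q c = 0"
      using circle_torsion prime_gt_1_int[OF q] by blast
    let ?g = "\<lambda>(i :: nat) (l :: nat list). c"
    have g: "zmul q ?g = 0" using c by (simp add: zmul_fun fun_eq_iff)
    have "ext_rep x (0 + zmul 1 x) ?g = (\<lambda>k. coind x k 0 ?g + zmul 1 (?g (Suc k)))"
      by (rule ext_rep[OF x q qK False I.zero g])
    then have "ext_rep x x ?g = ?g"
      using coind_K[OF x q qK zero g] by (simp add: fun_eq_iff)
    then have "ext_rep x x ?g \<noteq> 0" using c by (simp add: fun_eq_iff)
    with g show "R.nontrivial_at x" by (rule nt)
  qed
qed

lemma (in additive_subgroup) additive_on_pair:
  assumes "\<And>f g. f \<in> K \<Longrightarrow> g \<in> K \<Longrightarrow> h (f - g) = h f - h g" "\<And>w. \<phi> w \<in> K"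
  shows "h (pair t \<phi>) = pair t (\<lambda>w. h (\<phi> w))"
  using assms(2)
proof (induction t arbitrary: \<phi>)
  case (Node s t)
  have "h (pair t (\<lambda>v. \<phi> (u @ v) - \<phi> (v @ u))) = pair t (\<lambda>v. h (\<phi> (u @ v)) - h (\<phi> (v @ u)))" for u
    by (subst Node.IH(2)) (simp_all add: diff Node.prems assms(1))
  then show ?case
    by (simp add: pair.simps(2) Node.IH(1) pair_mem diff Node.prems)
qed simp

section \<open>From Lie representations to actions of words\<close>

context lie_rep
begin

definition word_act :: "'x list \<Rightarrow> 'v \<Rightarrow> 'v" where
  "word_act w = foldr (\<lambda>y. \<rho> (frag_of (Leaf y))) w"

context
  assumes full: "\<And>a. a \<in> I"
begin

lemma word_act_tors: "zmul q f = 0 \<Longrightarrow> zmul q (word_act w f) = 0"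
  by (induction w) (simp_all add: word_act_def full tors)

lemma word_act_diff: "zmul q f = 0 \<Longrightarrow> zmul q g = 0 \<Longrightarrow>
    word_act w (f - g) = word_act w f - word_act w g"
proof (induction w)
  case (Cons y w)
  then show ?case
    using word_act_tors[of f w] word_act_tors[of g w] by (simp add: word_act_def full rep_diff)
qed (simp add: word_act_def)

lemma word_act_append: "word_act (u @ v) f = word_act u (word_act v f)"
  by (simp add: word_act_def)

text \<open>A representation of the whole Lie ring extends to words by composing the operators of
  the letters. These are additive only on the \<open>q\<close>-torsion, so moving them through
  \<open>pair\<close> is done inside that subgroup.\<close>

lemma rep_tree:
  "zmul q f = 0 \<Longrightarrow> \<rho> (frag_of t) f = pair t (\<lambda>w. word_act w f)"
proof (induction t arbitrary: f)
  case (Leaf x)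
  then show ?case by (simp add: word_act_def)
next
  case (Node s t)
  interpret V: additive_subgroup "{f :: 'v. zmul q f = 0}"
    by standard (simp_all add: zmul_right_0 zmul_right_diff)
  have *: "pair s (\<lambda>u. word_act u (pair t (\<lambda>v. word_act v f))) = pair s (\<lambda>u. pair t (\<lambda>v. word_act (u @ v) f))"
    for s t
  proof -
    have "word_act u (pair t (\<lambda>v. word_act v f)) = pair t (\<lambda>v. word_act (u @ v) f)" for u
      by (subst V.additive_on_pair[of "word_act u"])
        (simp_all add: word_act_diff word_act_tors word_act_append Node.prems)
    then show ?thesis by simp
  qed
  have "\<rho> (frag_of (Node s t)) f = \<rho> (frag_of s) (\<rho> (frag_of t) f) - \<rho> (frag_of t) (\<rho> (frag_of s) f)"
    using rep_br[OF full full Node.prems, of "frag_of s" "frag_of t"] by simp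
  also have "\<dots> = pair s (\<lambda>u. word_act u (\<rho> (frag_of t) f)) - pair t (\<lambda>u. word_act u (\<rho> (frag_of s) f))"
    by (simp add: Node.IH(1)[OF tors[OF full Node.prems]] Node.IH(2)[OF tors[OF full Node.prems]])
  also have "\<dots> = pair (Node s t) (\<lambda>w. word_act w f)"
    by (simp add: Node.IH Node.prems * pair_Node)
  finally show ?case .
qed

lemma rep_pair_poly: "zmul q f = 0 \<Longrightarrow> \<rho> p f = pair_poly p (\<lambda>w. word_act w f)"
  by (induction p rule: frag_induct)
    (simp_all add: zero_rep rep_tree diff_rep full pair_poly_diff)

end

end

section \<open>Injectivity of the map to the partially commutative ring\<close>

definition size_part :: "nat \<Rightarrow> 'x lie_poly \<Rightarrow> 'x lie_poly" where
  "size_part m = frag_ext (\<lambda>t. if leaves t = m then frag_of t else 0)"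

lemma size_part_additive: "Modules.additive (size_part m)"
  by (simp add: size_part_def frag_ext_additive)

lemmas size_part_add = additive.add[OF size_part_additive]
  and size_part_diff = additive.diff[OF size_part_additive]
  and size_part_0 [simp] = additive.zero[OF size_part_additive]
  and size_part_zmul = additive_zmul[OF size_part_additive]

lemma size_part_of [simp]: "size_part m (frag_of t) = (if leaves t = m then frag_of t else 0)"
  by (simp add: size_part_def)

lemma size_part_id: "Poly_Mapping.keys p \<subseteq> {t. leaves t = m} \<Longrightarrow> size_part m p = p"
  by (induction p rule: frag_induction) (simp_all add: size_part_diff)

lemma size_part_zero: "Poly_Mapping.keys p \<subseteq> {t. leaves t \<noteq> m} \<Longrightarrow> size_part m p = 0"
  by (induction p rule: frag_induction) (simp_all add: size_part_diff)

lemma keys_diff_subset: "Poly_Mapping.keys p \<subseteq> S \<Longrightarrow> Poly_Mapping.keys q \<subseteq> S \<Longrightarrow>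
    Poly_Mapping.keys (p - q :: 'k \<Rightarrow>\<^sub>0 int) \<subseteq> S"
  using keys_diff[of p q] by blast

lemma keys_size_part: "Poly_Mapping.keys (size_part m p) \<subseteq> {t. leaves t = m}"
  by (induction p rule: frag_induct) (simp_all add: size_part_diff keys_diff_subset)

lemma size_part_br: "size_part m (br p (frag_of c)) =
    (if leaves c \<le> m then br (size_part (m - leaves c) p) (frag_of c) else 0)"
  by (induction p rule: frag_induct)
    (auto simp: br_diff_left size_part_diff)

lemma lie_ideal_0: "0 \<in> lie_ideal A \<Theta>"
  by (rule additive_subgroup.zero[OF lie_quotient.axioms(1)[OF lie_quotient_lie_ideal]])

text \<open>All relations are homogeneous in the number of leaves.\<close>

lemma size_part_lie_ideal: "p \<in> lie_ideal A \<Theta> \<Longrightarrow> size_part m p \<in> lie_ideal A \<Theta>"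
proof (induction arbitrary: m rule: lie_ideal.induct)
  case (bracket p c)
  then show ?case by (simp add: size_part_br lie_ideal.bracket lie_ideal_0)
next
  case (antisymmetric a b)
  then show ?case
    using lie_ideal.antisymmetric[of a b A \<Theta>] by (simp add: size_part_add lie_ideal_0 add.commute)
next
  case (jacobi a b c)
  have "leaves b + leaves c + leaves a = leaves a + leaves b + leaves c"
    "leaves c + leaves a + leaves b = leaves a + leaves b + leaves c" by simp_all
  then show ?case
    using lie_ideal.jacobi[of a b c A \<Theta>] by (simp add: size_part_add lie_ideal_0)
qed (simp_all add: size_part_diff lie_ideal_0 lie_ideal.intros)

lemma finite_trees: "finite A \<Longrightarrow> finite {t. set_tree t \<subseteq> A \<and> leaves t = m}"
proof (induction m rule: less_induct)
  case (less m)
  let ?N = "\<lambda>k. {t. set_tree t \<subseteq> A \<and> leaves t = k}"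
  have "?N m \<subseteq> Leaf ` A \<union> (\<Union>k\<in>{..<m}. \<Union>l\<in>{..<m}. (\<lambda>(s, t). Node s t) ` (?N k \<times> ?N l))"
  proof
    fix t assume t: "t \<in> ?N m"
    show "t \<in> Leaf ` A \<union> (\<Union>k\<in>{..<m}. \<Union>l\<in>{..<m}. (\<lambda>(s, t). Node s t) ` (?N k \<times> ?N l))"
    proof (cases t)
      case (Node r s)
      then have "leaves r < m" "leaves s < m" using t by auto
      with t Node show ?thesis by force
    qed (use t in auto)
  qed
  moreover have "finite \<dots>" using less by (intro finite_UnI finite_imageI finite_UN_I) auto
  ultimately show ?case by (rule finite_subset)
qed

lemma lie_ideal_outside: "\<not> set_tree t \<subseteq> A \<Longrightarrow> frag_of t \<in> lie_ideal A \<Theta>"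
proof (induction t)
  case (Node s t)
  interpret lie_quotient "lie_ideal A \<Theta>" by (rule lie_quotient_lie_ideal)
  from Node show ?case
    using br_left[of "frag_of s" "frag_of t"] br_right[of "frag_of t" "frag_of s"] by auto
qed (auto intro: lie_ideal.outside)

text \<open>If \<open>p\<close> were nonzero modulo \<open>K\<close>, it would act nontrivially in a
  representation of the entire quotient. But the letters satisfy the commutation relations there, so
  the action of \<open>p\<close> is computed from its image in the partially commutative ring, which
  is zero. Killing degrees above \<open>m\<close> leaves finitely many trees over \<open>A\<close>
  to adjoin.\<close>

lemma trace_zero_mod_prime:
  assumes "finite A" "Factorial_Ring.prime (q :: int)" and p: "trace_zero A \<Theta> p"
    and m: "Poly_Mapping.keys p \<subseteq> {t. leaves t = m}"
  obtains k r where "k \<in> lie_ideal A \<Theta>" "p = k + zmul q r" "Poly_Mapping.keys r \<subseteq> {t. leaves t = m}"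
proof -
  interpret L: lie_quotient "lie_ideal A \<Theta>" by (rule lie_quotient_lie_ideal)
  define K where "K = {k + zmul q r + s |k r s. k \<in> lie_ideal A \<Theta> \<and> (\<forall>i\<le>m. size_part i s = 0)}"
  have KI: "k + zmul q r + s \<in> K" if "k \<in> lie_ideal A \<Theta>" "\<forall>i\<le>m. size_part i s = 0" for k r s
    using that by (auto simp: K_def)
  have L_K: "k \<in> K" if "k \<in> lie_ideal A \<Theta>" for k
    using KI[OF that, of 0 0] by (simp add: zmul_right_0)
  have qK: "zmul q a \<in> K" for a
    using KI[OF lie_ideal_0, of 0 a] by simp
  have sK: "a \<in> K" if "\<forall>i\<le>m. size_part i a = 0" for a
    using KI[OF lie_ideal_0 that, of 0] by (simp add: zmul_right_0)
  interpret K: lie_quotient K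
  proof
    show "a - b \<in> K" if "a \<in> K" "b \<in> K" for a b
    proof -
      from that obtain k r s k' r' s' where *: "a = k + zmul q r + s" "b = k' + zmul q r' + s'"
        "k \<in> lie_ideal A \<Theta>" "k' \<in> lie_ideal A \<Theta>" "\<forall>i\<le>m. size_part i s = 0" "\<forall>i\<le>m. size_part i s' = 0"
        by (auto simp: K_def)
      have "a - b = (k - k') + zmul q (r - r') + (s - s')"
        by (simp add: * zmul_right_diff)
      also have "\<dots> \<in> K" by (rule KI) (simp_all add: * L.diff size_part_diff)
      finally show ?thesis .
    qed
    show "br a (frag_of c) \<in> K" if "a \<in> K" for a c
    proof -
      from that obtain k r s where *: "a = k + zmul q r + s"
        "k \<in> lie_ideal A \<Theta>" "\<forall>i\<le>m. size_part i s = 0"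
        by (auto simp: K_def)
      have "br a (frag_of c) = br k (frag_of c) + zmul q (br r (frag_of c)) + br s (frag_of c)"
        by (simp add: * br_add_left br_zmul_left)
      also have "\<dots> \<in> K" by (rule KI) (simp_all add: * lie_ideal.bracket size_part_br)
      finally show ?thesis .
    qed
  qed (simp_all add: L_K lie_ideal_0 lie_ideal.intros)
  have big: "frag_of t \<in> K" if "leaves t > m" for t
    using that by (intro sK) auto
  have "p \<in> K"
  proof (rule ccontr)
    assume pK: "p \<notin> K"
    \<comment> \<open>Brackets with \<open>p\<close> have degree above \<open>m\<close>, so
      \<open>p\<close> is central modulo \<open>K\<close>. It can be adjoined first, to the zero
      representation of \<open>K\<close>, and already acts nontrivially after that step.\<close>
    have p_br: "br p b \<in> K" for b
    proof (rule K.additive_mem[OF br_additive_right])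
      fix t :: "'a tree"
      have "size_part (i - leaves t) p = 0" if "leaves t \<le> i" "i \<le> m" for i
      proof (rule size_part_zero)
        have "i - leaves t < m" using leaves_pos[of t] that by linarith
        with m show "Poly_Mapping.keys p \<subseteq> {s. leaves s \<noteq> i - leaves t}" by auto
      qed
      then show "br p (frag_of t) \<in> K" by (intro sK) (simp add: size_part_br)
    qed
    \<comment> \<open>Downward induction on \<open>j\<close> from \<open>m\<close> to 0, keeping
      \<open>p\<close> nontrivial while the represented ideal absorbs ever lower degrees.\<close>
    define Q where "Q j \<longleftrightarrow> (\<exists>I (\<rho> :: 'a circle_rep).
      lie_rep K q I \<rho> \<and> p \<in> I \<and> lie_rep.nontrivial_at q \<rho> p \<and> (\<forall>t. leaves t > j \<longrightarrow> frag_of t \<in> I))" for j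
    have "Q m"
    proof -
      have "lie_rep K q K (\<lambda>a f. 0 :: nat list \<Rightarrow> circle)"
        by standard (simp_all add: K.diff K.br_left zmul_right_0)
      then obtain I' and \<rho>' :: "'a circle_rep"
        where E: "lie_rep K q I' \<rho>'" "K \<subseteq> I'" "p \<in> I'" "lie_rep.nontrivial_at q \<rho>' p"
        by (rule lie_rep_extension[OF _ assms(2) qK p_br p_br]) (rule that, assumption+, simp add: pK)
      with big show ?thesis unfolding Q_def by blast
    qed
    moreover have "Q j" if "Q (Suc j)" for j
    proof -
      have "\<exists>I (\<rho> :: 'a circle_rep).
        lie_rep K q I \<rho> \<and> p \<in> I \<and> lie_rep.nontrivial_at q \<rho> p \<and>
        (\<forall>t. leaves t > Suc j \<or> t \<in> S \<longrightarrow> frag_of t \<in> I)"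
        if "finite S" "\<And>t. t \<in> S \<Longrightarrow> leaves t = Suc j" for S
        using that
      proof (induction S rule: finite_induct)
        case empty
        then show ?case using \<open>Q (Suc j)\<close> by (simp add: Q_def)
      next
        case (insert t S)
        then obtain I and \<rho> :: "'a circle_rep"
          where IH: "lie_rep K q I \<rho>" "p \<in> I" "lie_rep.nontrivial_at q \<rho> p"
            "\<And>t. leaves t > Suc j \<or> t \<in> S \<Longrightarrow> frag_of t \<in> I" by auto
        interpret lie_rep K q I \<rho> by fact
        \<comment> \<open>Brackets with \<open>t\<close> have more leaves than \<open>t\<close> and
          were absorbed before; this is why the degrees decrease.\<close>
        have br_t: "br (frag_of t) b \<in> I" for b
        proof (rule I.additive_mem[OF br_additive_right])
          fix s
          have "leaves (Node t s) > Suc j" using insert.prems by simp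
          then show "br (frag_of t) (frag_of s) \<in> I" using IH(4) by simp
        qed
        have alt: "br (frag_of t) (frag_of t) \<in> K" by (simp add: K.alt)
        obtain I' and \<rho>' :: "'a circle_rep"
          where E: "lie_rep K q I' \<rho>'" "I \<subseteq> I'" "frag_of t \<in> I'"
            "\<And>e. e \<in> I \<Longrightarrow> lie_rep.nontrivial_at q \<rho> e \<Longrightarrow> lie_rep.nontrivial_at q \<rho>' e"
          by (rule lie_rep_extension[OF IH(1) assms(2) qK br_t alt]) (rule that)
        have "frag_of s \<in> I'" if "leaves s > Suc j \<or> s \<in> insert t S" for s
          using that IH(4)[of s] E(2,3) by auto
        with E(1) E(4)[OF IH(2,3)] IH(2) E(2) show ?case by blast
      qed
      from this[OF finite_trees[OF assms(1)], of "Suc j"]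
      obtain I and \<rho> :: "'a circle_rep"
        where I: "lie_rep K q I \<rho>" "p \<in> I" "lie_rep.nontrivial_at q \<rho> p"
          "\<And>t. leaves t > Suc j \<or> set_tree t \<subseteq> A \<and> leaves t = Suc j \<Longrightarrow> frag_of t \<in> I"
        by auto
      have "frag_of t \<in> I" if "leaves t > j" for t
      proof (cases "set_tree t \<subseteq> A")
        case True
        then show ?thesis using I(4)[of t] that by linarith
      next
        case False
        then show ?thesis by (intro lie_rep.K_I[OF I(1)] L_K lie_ideal_outside)
      qed
      with I show ?thesis unfolding Q_def by blast
    qed
    ultimately have "Q 0"
      by (metis dec_induct inc_induct le0)
    then obtain I and \<rho> :: "'a circle_rep"
      where I: "lie_rep K q I \<rho>" "lie_rep.nontrivial_at q \<rho> p" "\<And>t. frag_of t \<in> I"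
      by (auto simp: Q_def)
    interpret lie_rep K q I \<rho> by fact
    have full: "a \<in> I" for a
      by (induction a rule: frag_induct) (auto simp: I)
    from I(2) obtain f where f: "zmul q f = 0" "\<rho> p f \<noteq> 0" by (auto simp: nontrivial_at_def)
    \<comment> \<open>The action of a word on the fixed vector \<open>f\<close> is a function on
      traces, so \<open>p\<close> has to annihilate \<open>f\<close>.\<close>
    have "trace_fun A \<Theta> (\<lambda>w. word_act w f)"
    proof (rule trace_funI)
      fix u v a b assume ab: "(a, b) \<in> \<Theta>"
      let ?g = "word_act v f"
      have g: "zmul q ?g = 0" by (rule word_act_tors[OF full f(1)])
      have "frag_of (Node (Leaf a) (Leaf b)) \<in> K" by (intro L_K lie_ideal.commute ab)
      then have "\<rho> (frag_of (Leaf a)) (\<rho> (frag_of (Leaf b)) ?g) = \<rho> (frag_of (Leaf b)) (\<rho> (frag_of (Leaf a)) ?g)"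
        using rep_br[OF full full g, of "frag_of (Leaf a)" "frag_of (Leaf b)"] rep_K[OF _ g]
        by simp
      then show "word_act (u @ a # b # v) f = word_act (u @ b # a # v) f"
        by (simp add: word_act_def)
    next
      fix w assume "\<not> set w \<subseteq> A"
      then obtain u y v where w: "w = u @ y # v" "y \<notin> A" by (metis split_list subsetI)
      have "\<rho> (frag_of (Leaf y)) (word_act v f) = 0"
        by (intro rep_K L_K lie_ideal.outside w word_act_tors full f)
      moreover have "word_act u 0 = 0"
        using word_act_diff[OF full f(1) f(1), of u] by simp
      ultimately show "word_act w f = 0" by (simp add: w word_act_def)
    qed
    from trace_zero_pair_poly[OF p this] f(2) show False
      by (simp add: rep_pair_poly[OF full f(1)])
  qed
  then obtain k r s where *: "p = k + zmul q r + s" "k \<in> lie_ideal A \<Theta>" "\<forall>i\<le>m. size_part i s = 0"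
    by (auto simp: K_def)
  have "p = size_part m p" by (simp add: size_part_id[OF m])
  also have "\<dots> = size_part m k + zmul q (size_part m r)"
    using * by (simp add: size_part_add size_part_zmul)
  finally show ?thesis
    by (rule that[OF size_part_lie_ideal[OF *(2)] _ keys_size_part])
qed

theorem trace_zero_imp_lie_ideal:
  assumes "finite A" and p: "trace_zero A \<Theta> p"
  shows "p \<in> lie_ideal A \<Theta>"
proof -
  interpret lie_quotient "lie_ideal A \<Theta>" by (rule lie_quotient_lie_ideal)
  \<comment> \<open>One prime factor of \<open>n\<close> at a time: the quotient \<open>r\<close>
    again vanishes in the torsion-free ring, so the division can be repeated.\<close>
  have div: "\<exists>k r. k \<in> lie_ideal A \<Theta> \<and> p = k + zmul (int n) r \<and> Poly_Mapping.keys r \<subseteq> {t. leaves t = m}"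
    if "n > 0" "trace_zero A \<Theta> p" "Poly_Mapping.keys p \<subseteq> {t. leaves t = m}" for n m p
    using that
  proof (induction n arbitrary: p rule: prime_divisors_induct)
    case zero
    then show ?case by simp
  next
    case (unit x)
    then show ?case using lie_ideal_0 by (intro exI[of _ 0] exI[of _ p]) simp
  next
    case (factor q n)
    have q: "Factorial_Ring.prime (int q)" using factor.hyps by simp
    obtain k r where k: "k \<in> lie_ideal A \<Theta>" "p = k + zmul (int q) r" "Poly_Mapping.keys r \<subseteq> {t. leaves t = m}"
      using trace_zero_mod_prime[OF assms(1) q factor.prems(2,3)] by blast
    have "trace_zero A \<Theta> (zmul (int q) r)"
      using trace_zero_diff[OF factor.prems(2) lie_ideal_trace_zero[OF k(1)]] k(2) by simp
    then have "trace_zero A \<Theta> r" using q by (simp add: trace_zero_zmul)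
    with factor.IH[of r] factor.prems k(3) obtain k' r' where k': "k' \<in> lie_ideal A \<Theta>"
      "r = k' + zmul (int n) r'" "Poly_Mapping.keys r' \<subseteq> {t. leaves t = m}" by auto
    have "p = (k + zmul (int q) k') + zmul (int (q * n)) r'"
      by (simp add: k k' zmul_right_add zmul_mult add.assoc)
    moreover have "k + zmul (int q) k' \<in> lie_ideal A \<Theta>" using k k' by (intro add zmul)
    ultimately show ?case using k' by blast
  qed
  have hom: "p \<in> lie_ideal A \<Theta>"
    if p: "trace_zero A \<Theta> p" "Poly_Mapping.keys p \<subseteq> {t. leaves t = m}" and m: "m > 0" for p m
  proof -
    \<comment> \<open>The divisor is the degree \<open>m\<close> itself, because \<open>m\<close>
      times the quotient \<open>r\<close> lies in the ideal by the Dynkin argument.\<close>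
    obtain k r where k: "k \<in> lie_ideal A \<Theta>" "p = k + zmul (int m) r" "Poly_Mapping.keys r \<subseteq> {t. leaves t = m}"
      using div[OF m p] by blast
    have "trace_zero A \<Theta> (zmul (int m) r)"
      using trace_zero_diff[OF p(1) lie_ideal_trace_zero[OF k(1)]] k(2) by simp
    then have "trace_zero A \<Theta> r" using m by (simp add: trace_zero_zmul)
    then have "zmul (int m) r \<in> lie_ideal A \<Theta>" by (rule dynkin_trace_zero) fact
    with k show ?thesis by (simp add: add)
  qed
  have part: "size_part m p \<in> lie_ideal A \<Theta>" for m
  proof (cases "m = 0")
    case True
    have "Poly_Mapping.keys p \<subseteq> {t. leaves t \<noteq> m}" by (auto simp: True)
    then show ?thesis by (simp add: size_part_zero lie_ideal_0)
  next
    case False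
    \<comment> \<open>Partial commutation preserves the length of a word, so vanishing passes to the
      homogeneous components.\<close>
    let ?\<phi> = "\<lambda>w. if length w = m then trace_of A \<Theta> w else 0"
    have *: "pair t ?\<phi> = pair_poly (size_part m (frag_of t)) (trace_of A \<Theta>)" for t
      using pair_cong[of t ?\<phi> "trace_of A \<Theta>"] pair_cong[of t ?\<phi> "\<lambda>w. 0"] by auto
    have "pair_poly p ?\<phi> = pair_poly (size_part m p) (trace_of A \<Theta>)"
      by (induction p rule: frag_induct) (simp_all add: * pair_poly_diff size_part_diff)
    moreover have "trace_fun A \<Theta> ?\<phi>"
    proof (rule trace_funI)
      fix u v :: "'a list" and a b :: 'a assume "(a, b) \<in> \<Theta>"
      then have "trace_of A \<Theta> (u @ a # b # v) = trace_of A \<Theta> (u @ b # a # v)"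
        by (rule trace_fun_swap[OF trace_fun_trace_of])
      then show "?\<phi> (u @ a # b # v) = ?\<phi> (u @ b # a # v)" by simp
    qed (simp add: trace_fun_outside[OF trace_fun_trace_of])
    ultimately have "trace_zero A \<Theta> (size_part m p)"
      using trace_zero_pair_poly[OF p, of ?\<phi>] by (simp add: trace_zero_def)
    then show ?thesis using False by (intro hom[OF _ keys_size_part]) simp_all
  qed
  obtain N where N: "\<And>t. t \<in> Poly_Mapping.keys p \<Longrightarrow> leaves t < N"
    using finite_nat_set_iff_bounded[of "leaves ` Poly_Mapping.keys p"] by auto
  then have "Poly_Mapping.keys p \<subseteq> {t. leaves t < N}" by auto
  then have "p = (\<Sum>m<N. size_part m p)"
  proof (induction p rule: frag_induction)
    case (diff a b)
    then show ?case by (simp add: size_part_diff sum_subtractf)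
  qed (simp_all add: sum.delta)
  also have "\<dots> \<in> lie_ideal A \<Theta>"
    by (induction N) (simp_all add: lie_ideal_0 add part)
  finally show ?thesis .
qed

section \<open>Commutator calculus in the lower central series\<close>

context group
begin

lemma inv_mult_cancel [simp]:
  "x \<in> carrier G \<Longrightarrow> y \<in> carrier G \<Longrightarrow> inv x \<otimes> (x \<otimes> y) = y"
  "x \<in> carrier G \<Longrightarrow> y \<in> carrier G \<Longrightarrow> x \<otimes> (inv x \<otimes> y) = y"
  by (simp_all add: m_assoc[symmetric])

lemma commut_inv: "x \<in> carrier G \<Longrightarrow> y \<in> carrier G \<Longrightarrow> inv (commut G x y) = commut G y x"
  by (simp add: commut_def inv_mult_group m_assoc)

lemma commut_self: "x \<in> carrier G \<Longrightarrow> commut G x x = \<one>"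
  by (simp add: commut_def m_assoc)

lemma commut_one: "x \<in> carrier G \<Longrightarrow> commut G x \<one> = \<one>" "x \<in> carrier G \<Longrightarrow> commut G \<one> x = \<one>"
  by (simp_all add: commut_def)

lemma commut_mult_left: "x \<in> carrier G \<Longrightarrow> y \<in> carrier G \<Longrightarrow> z \<in> carrier G \<Longrightarrow>
    commut G (x \<otimes> y) z = inv y \<otimes> commut G x z \<otimes> y \<otimes> commut G y z"
  by (simp add: commut_def inv_mult_group m_assoc)

lemma commut_mult_right: "x \<in> carrier G \<Longrightarrow> y \<in> carrier G \<Longrightarrow> z \<in> carrier G \<Longrightarrow>
    commut G x (y \<otimes> z) = commut G x z \<otimes> (inv z \<otimes> commut G x y \<otimes> z)"
  by (simp add: commut_def inv_mult_group m_assoc)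

lemma hall_witt:
  assumes "x \<in> carrier G" "y \<in> carrier G" "z \<in> carrier G"
  shows "(inv y \<otimes> commut G (commut G x (inv y)) z \<otimes> y) \<otimes>
    (inv z \<otimes> commut G (commut G y (inv z)) x \<otimes> z) \<otimes>
    (inv x \<otimes> commut G (commut G z (inv x)) y \<otimes> x) = \<one>"
  using assms by (simp add: commut_def inv_mult_group m_assoc)

lemma conj_commut: "x \<in> carrier G \<Longrightarrow> y \<in> carrier G \<Longrightarrow> g \<in> carrier G \<Longrightarrow>
    g \<otimes> commut G x y \<otimes> inv g = commut G (g \<otimes> x \<otimes> inv g) (g \<otimes> y \<otimes> inv g)"
  by (simp add: commut_def inv_mult_group m_assoc)

abbreviation \<gamma> :: "nat \<Rightarrow> 'a set" where
  "\<gamma> \<equiv> lower_central G"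

lemma \<gamma>_normal: "\<gamma> d \<lhd> G"
proof (induction d rule: induct_nat_012)
  case (ge2 c)
  then interpret N: normal "\<gamma> (Suc c)" G by simp
  have "g \<otimes> commut G x y \<otimes> inv g \<in> {commut G x y |x y. x \<in> \<gamma> (Suc c) \<and> y \<in> carrier G}"
    if "x \<in> \<gamma> (Suc c)" "y \<in> carrier G" "g \<in> carrier G" for x y g
    using that N.inv_op_closed2[of g x] N.mem_carrier[of x]
    by (auto simp: conj_commut simp del: lower_central.simps)
  then show ?case
    unfolding lower_central.simps
    by (intro normal_generateI) (auto simp: commut_closed N.mem_carrier simp del: lower_central.simps)
qed (simp_all add: normal_inv_iff subgroup_self)

lemmas \<gamma>_subgroup = normal_imp_subgroup[OF \<gamma>_normal]

lemma \<gamma>_carrier: "x \<in> \<gamma> d \<Longrightarrow> x \<in> carrier G"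
  by (rule subgroup.mem_carrier[OF \<gamma>_subgroup])

lemma \<gamma>_conj: "x \<in> \<gamma> d \<Longrightarrow> g \<in> carrier G \<Longrightarrow> inv g \<otimes> x \<otimes> g \<in> \<gamma> d"
  by (rule normal.inv_op_closed1[OF \<gamma>_normal])

lemmas \<gamma>_one = subgroup.one_closed[OF \<gamma>_subgroup]
  and \<gamma>_mult = subgroup.m_closed[OF \<gamma>_subgroup]
  and \<gamma>_inv = subgroup.m_inv_closed[OF \<gamma>_subgroup]

lemma commut_\<gamma>_carrier: "d \<ge> 1 \<Longrightarrow> x \<in> \<gamma> d \<Longrightarrow> g \<in> carrier G \<Longrightarrow> commut G x g \<in> \<gamma> (Suc d)"
  by (cases d) (auto intro: generate.incl)

lemma \<gamma>_Suc_subset: "\<gamma> (Suc d) \<subseteq> \<gamma> d"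
proof (cases d)
  case (Suc c)
  have "commut G x y \<in> \<gamma> d" if "x \<in> \<gamma> d" "y \<in> carrier G" for x y
    using \<gamma>_mult[OF \<gamma>_inv[OF that(1)] \<gamma>_conj[OF that]] that \<gamma>_carrier[OF that(1)]
    by (simp add: commut_def m_assoc)
  then show ?thesis
    unfolding Suc lower_central.simps
    by (intro generate_subgroup_incl \<gamma>_subgroup) (auto simp: Suc simp del: lower_central.simps)
qed (simp)

lemma middle_factor:
  assumes "a \<in> carrier G" "m \<in> carrier G" "b \<in> carrier G" "a \<otimes> m \<otimes> b = \<one>"
  shows "m = inv a \<otimes> inv b"
proof -
  have "m = inv a \<otimes> (a \<otimes> m \<otimes> b) \<otimes> inv b" using assms(1-3) by (simp add: m_assoc)
  with assms show ?thesis by simp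
qed

text \<open>The preimage of a centraliser in the quotient by \<open>N\<close>. Statements about
  commutators with a generated subgroup thereby reduce to its generators.\<close>

lemma centralising_subgroup:
  assumes N: "N \<lhd> G" and S: "S \<subseteq> carrier G"
  shows "subgroup {w \<in> carrier G. \<forall>x\<in>S. commut G x w \<in> N} G"
proof -
  interpret N: normal N G by fact
  show ?thesis
  proof (unfold_locales, goal_cases)
    case (2 v w)
    have "commut G x (v \<otimes> w) \<in> N" if "x \<in> S" for x
      using 2 that S N.inv_op_closed1 by (auto simp: commut_mult_right subset_iff)
    with 2 show ?case by auto
  next
    case 3
    then show ?case using S by (auto simp: commut_one subset_iff)
  next
    case (4 w)
    have "commut G x (inv w) \<in> N" if "x \<in> S" for x
    proof -
      have "w \<otimes> inv (commut G x w) \<otimes> inv w \<in> N"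
        using 4 that by (intro N.inv_op_closed2) auto
      moreover have "w \<otimes> inv (commut G x w) \<otimes> inv w = commut G x (inv w)"
        using 4 that S by (auto simp: commut_def inv_mult_group m_assoc subset_iff)
      ultimately show ?thesis by simp
    qed
    with 4 show ?case by auto
  qed auto
qed

text \<open>A three subgroups argument, by induction on \<open>j\<close> for all \<open>i\<close>
  together: for a generator \<open>[y, g]\<close> of the next term, the Hall-Witt identity expresses
  its commutator with \<open>x\<close> by two factors that the induction hypothesis places deep
  enough.\<close>

lemma commut_\<gamma>: "i \<ge> 1 \<Longrightarrow> j \<ge> 1 \<Longrightarrow> x \<in> \<gamma> i \<Longrightarrow> y \<in> \<gamma> j \<Longrightarrow> commut G x y \<in> \<gamma> (i + j)"
proof (induction j arbitrary: i x y)
  case (Suc j)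
  show ?case
  proof (cases "j = 0")
    case True
    then show ?thesis using Suc.prems commut_\<gamma>_carrier[of i x y] by simp
  next
    case False
    then obtain c where c: "j = Suc c" by (cases j) auto
    interpret N: normal "\<gamma> (i + Suc j)" G by (rule \<gamma>_normal)
    have *: "commut G x (commut G y g) \<in> \<gamma> (i + Suc j)"
      if x: "x \<in> \<gamma> i" and y: "y \<in> \<gamma> j" and g: "g \<in> carrier G" for x y g
    proof -
      have xc: "x \<in> carrier G" and yc: "y \<in> carrier G" using x y \<gamma>_carrier by auto
      have 1: "commut G x (inv y) \<in> \<gamma> (i + j)"
        by (rule Suc.IH) (use Suc.prems False x y \<gamma>_inv in auto)
      have "commut G (commut G x (inv y)) (inv g) \<in> \<gamma> (i + Suc j)"
        using commut_\<gamma>_carrier[OF _ 1, of "inv g"] Suc.prems g by simp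
      then have a: "inv y \<otimes> commut G (commut G x (inv y)) (inv g) \<otimes> y \<in> \<gamma> (i + Suc j)"
        by (rule \<gamma>_conj) fact
      have "commut G (inv x) (inv g) \<in> \<gamma> (Suc i)"
        by (rule commut_\<gamma>_carrier) (use Suc.prems x g \<gamma>_inv in auto)
      then have "commut G (inv g) (inv x) \<in> \<gamma> (Suc i)"
        using \<gamma>_inv[of "commut G (inv x) (inv g)" "Suc i"] xc g by (simp add: commut_inv del: lower_central.simps)
      then have "commut G (commut G (inv g) (inv x)) y \<in> \<gamma> (Suc i + j)"
        by (intro Suc.IH) (use False y in auto)
      then have b: "inv x \<otimes> commut G (commut G (inv g) (inv x)) y \<otimes> x \<in> \<gamma> (i + Suc j)"
        using \<gamma>_conj[OF _ xc] by simp
      let ?A = "inv y \<otimes> commut G (commut G x (inv y)) (inv g) \<otimes> y"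
      let ?B = "inv x \<otimes> commut G (commut G (inv g) (inv x)) y \<otimes> x"
      let ?M = "commut G (commut G y g) x"
      \<comment> \<open>Hall-Witt is applied to the inverse of \<open>g\<close>, so that its middle
        factor contains \<open>[y, g]\<close> itself.\<close>
      have "?A \<otimes> (g \<otimes> ?M \<otimes> inv g) \<otimes> ?B = \<one>"
        using hall_witt[OF xc yc inv_closed[OF g]] g by simp
      then have "g \<otimes> ?M \<otimes> inv g = inv ?A \<otimes> inv ?B"
        using xc yc g by (intro middle_factor m_closed commut_closed inv_closed)
      also have "\<dots> \<in> \<gamma> (i + Suc j)" by (rule \<gamma>_mult[OF \<gamma>_inv[OF a] \<gamma>_inv[OF b]])
      finally have "inv g \<otimes> (g \<otimes> ?M \<otimes> inv g) \<otimes> g \<in> \<gamma> (i + Suc j)" by (rule \<gamma>_conj) fact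
      then have "?M \<in> \<gamma> (i + Suc j)" using xc yc g by (simp add: m_assoc commut_closed)
      from \<gamma>_inv[OF this] show ?thesis using xc yc g by (simp add: commut_inv commut_closed)
    qed
    let ?C = "{w \<in> carrier G. \<forall>x\<in>\<gamma> i. commut G x w \<in> \<gamma> (i + Suc j)}"
    have "subgroup ?C G"
      by (rule centralising_subgroup[OF \<gamma>_normal]) (auto intro: \<gamma>_carrier)
    then have "\<gamma> (Suc j) \<subseteq> ?C"
      unfolding c lower_central.simps
      by (rule generate_subgroup_incl[rotated]) (use * in \<open>auto simp: c commut_closed \<gamma>_carrier simp del: lower_central.simps\<close>)
    then show ?thesis using Suc.prems by blast
  qed
qed simp

subsection \<open>The graded pieces\<close>

lemma \<gamma>_normal_restrict: "\<gamma> (Suc d) \<lhd> G\<lparr>carrier := \<gamma> d\<rparr>"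
  by (rule normal_restrict_supergroup[OF \<gamma>_subgroup \<gamma>_normal \<gamma>_Suc_subset])

definition cls :: "nat \<Rightarrow> 'a \<Rightarrow> 'a set" where
  "cls d g = \<gamma> (Suc d) #> g"

lemma gr_group: "group (gr G d)"
  unfolding gr_def by (rule normal.factorgroup_is_group[OF \<gamma>_normal_restrict])

lemma carrier_gr: "carrier (gr G d) = cls d ` \<gamma> d"
  by (auto simp: gr_def carrier_FactGroup r_coset_def cls_def)

lemma cls_closed [simp, intro]: "g \<in> \<gamma> d \<Longrightarrow> cls d g \<in> carrier (gr G d)"
  by (simp add: carrier_gr)

lemma one_gr: "\<one>\<^bsub>gr G d\<^esub> = \<gamma> (Suc d)"
  by (simp add: gr_def)

lemma cls_mult: "g \<in> \<gamma> d \<Longrightarrow> h \<in> \<gamma> d \<Longrightarrow> cls d (g \<otimes> h) = cls d g \<otimes>\<^bsub>gr G d\<^esub> cls d h"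
  using normal.rcos_sum[OF \<gamma>_normal_restrict, of g d h]
  by (simp add: gr_def cls_def)

lemma cls_one_iff: "g \<in> \<gamma> d \<Longrightarrow> cls d g = \<one>\<^bsub>gr G d\<^esub> \<longleftrightarrow> g \<in> \<gamma> (Suc d)"
  unfolding cls_def one_gr
  using coset_join1[of "\<gamma> (Suc d)" g] coset_join2[of g "\<gamma> (Suc d)"] \<gamma>_subgroup \<gamma>_carrier
  by (metis subgroup.subset)

lemma cls_one [simp]: "cls d \<one> = \<one>\<^bsub>gr G d\<^esub>"
  by (simp add: cls_one_iff \<gamma>_one)

lemma cls_inv: "g \<in> \<gamma> d \<Longrightarrow> cls d (inv g) = inv\<^bsub>gr G d\<^esub> cls d g"
proof -
  interpret Q: group "gr G d" by (rule gr_group)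
  assume g: "g \<in> \<gamma> d"
  then have "cls d (inv g) \<otimes>\<^bsub>gr G d\<^esub> cls d g = \<one>\<^bsub>gr G d\<^esub>"
    by (simp add: cls_mult[symmetric] \<gamma>_inv \<gamma>_carrier)
  then show ?thesis
    using g by (intro Q.inv_equality[symmetric]) (auto simp: \<gamma>_inv)
qed

lemma cls_eq_iff: "g \<in> \<gamma> d \<Longrightarrow> h \<in> \<gamma> d \<Longrightarrow> cls d g = cls d h \<longleftrightarrow> g \<otimes> inv h \<in> \<gamma> (Suc d)"
proof -
  interpret Q: group "gr G d" by (rule gr_group)
  assume gh: "g \<in> \<gamma> d" "h \<in> \<gamma> d"
  have "g \<otimes> inv h \<in> \<gamma> (Suc d) \<longleftrightarrow> cls d g \<otimes>\<^bsub>gr G d\<^esub> inv\<^bsub>gr G d\<^esub> cls d h = \<one>\<^bsub>gr G d\<^esub>"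
    using gh by (simp add: cls_one_iff[symmetric] cls_mult cls_inv \<gamma>_mult \<gamma>_inv)
  also have "\<dots> \<longleftrightarrow> cls d g = cls d h"
    using gh by (metis Q.inv_equality Q.inv_inv Q.r_inv cls_closed Q.inv_closed)
  finally show ?thesis by simp
qed

text \<open>Conjugation changes an element of \<open>\<gamma> d\<close> by a commutator, which lies
  one term deeper. Conjugating factors in commutator identities therefore disappear in the graded
  pieces.\<close>

lemma cls_conj:
  assumes "d \<ge> 1" "g \<in> \<gamma> d" "x \<in> carrier G"
  shows "cls d (inv x \<otimes> g \<otimes> x) = cls d g"
proof -
  have "commut G x (inv g) \<in> \<gamma> (Suc d)"
    using \<gamma>_inv[OF commut_\<gamma>_carrier[OF assms(1) \<gamma>_inv[OF assms(2)] assms(3)]] assms \<gamma>_carrier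
    by (simp add: commut_inv del: lower_central.simps)
  moreover have "commut G x (inv g) = inv x \<otimes> g \<otimes> x \<otimes> inv g"
    using assms \<gamma>_carrier by (simp add: commut_def)
  ultimately show ?thesis using assms by (simp add: cls_eq_iff \<gamma>_conj del: lower_central.simps)
qed

lemma gr_comm_group:
  assumes "d \<ge> 1"
  shows "comm_group (gr G d)"
proof -
  interpret Q: group "gr G d" by (rule gr_group)
  have "cls d g \<otimes>\<^bsub>gr G d\<^esub> cls d h = cls d h \<otimes>\<^bsub>gr G d\<^esub> cls d g" if "g \<in> \<gamma> d" "h \<in> \<gamma> d" for g h
  proof -
    have c: "g \<in> carrier G" "h \<in> carrier G" using that \<gamma>_carrier by auto
    have "g \<otimes> h = h \<otimes> (inv h \<otimes> g \<otimes> h)" using c by (simp add: m_assoc)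
    then have "cls d (g \<otimes> h) = cls d h \<otimes>\<^bsub>gr G d\<^esub> cls d g"
      using that c assms by (simp add: cls_mult \<gamma>_conj cls_conj)
    then show ?thesis using that by (simp add: cls_mult)
  qed
  then show ?thesis by (intro Q.group_comm_groupI) (auto simp: carrier_gr)
qed

end

section \<open>The graded Lie bracket induced by commutators\<close>

context group
begin

lemma cls_commut_mult_left:
  assumes "i \<ge> 1" "j \<ge> 1" "g \<in> \<gamma> i" "g' \<in> \<gamma> i" "h \<in> \<gamma> j"
  shows "cls (i + j) (commut G (g \<otimes> g') h) = cls (i + j) (commut G g h) \<otimes>\<^bsub>gr G (i + j)\<^esub> cls (i + j) (commut G g' h)"
proof -
  have c: "g \<in> carrier G" "g' \<in> carrier G" "h \<in> carrier G" using assms \<gamma>_carrier by auto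
  have m: "commut G g h \<in> \<gamma> (i + j)" "commut G g' h \<in> \<gamma> (i + j)" using assms by (simp_all add: commut_\<gamma>)
  show ?thesis
    using assms(1) m c by (simp add: commut_mult_left cls_mult \<gamma>_conj cls_conj)
qed

lemma cls_commut_anti:
  assumes "i \<ge> 1" "j \<ge> 1" "g \<in> \<gamma> i" "h \<in> \<gamma> j"
  shows "cls (i + j) (commut G h g) = inv\<^bsub>gr G (i + j)\<^esub> cls (i + j) (commut G g h)"
  using assms commut_\<gamma>[OF assms] \<gamma>_carrier by (simp add: cls_inv[symmetric] commut_inv)

lemma cls_commut_inv_left:
  assumes "i \<ge> 1" "j \<ge> 1" "g \<in> \<gamma> i" "h \<in> \<gamma> j"
  shows "cls (i + j) (commut G (inv g) h) = inv\<^bsub>gr G (i + j)\<^esub> cls (i + j) (commut G g h)"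
proof -
  interpret Q: group "gr G (i + j)" by (rule gr_group)
  have "cls (i + j) (commut G (inv g) h) \<otimes>\<^bsub>gr G (i + j)\<^esub> cls (i + j) (commut G g h) = \<one>\<^bsub>gr G (i + j)\<^esub>"
    using assms \<gamma>_carrier by (simp add: cls_commut_mult_left[symmetric] \<gamma>_inv commut_one)
  then show ?thesis
    using assms by (intro Q.inv_equality[symmetric]) (auto intro!: commut_\<gamma> \<gamma>_inv)
qed

lemma cls_commut_cong_left:
  assumes "i \<ge> 1" "j \<ge> 1" "g \<in> \<gamma> i" "g' \<in> \<gamma> i" "h \<in> \<gamma> j" and eq: "cls i g = cls i g'"
  shows "cls (i + j) (commut G g h) = cls (i + j) (commut G g' h)"
proof -
  interpret Q: group "gr G (i + j)" by (rule gr_group)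
  have m: "g \<otimes> inv g' \<in> \<gamma> (Suc i)" using eq assms by (simp add: cls_eq_iff)
  then have "commut G (g \<otimes> inv g') h \<in> \<gamma> (Suc (i + j))"
    using commut_\<gamma>[OF _ assms(2) m assms(5)] by simp
  then have "cls (i + j) (commut G (g \<otimes> inv g') h) = \<one>\<^bsub>gr G (i + j)\<^esub>"
    using \<gamma>_Suc_subset[of "i + j"] by (subst cls_one_iff) auto
  moreover have "g = (g \<otimes> inv g') \<otimes> g'" using assms \<gamma>_carrier by (simp add: m_assoc)
  ultimately show ?thesis
    using cls_commut_mult_left[OF assms(1,2) \<gamma>_mult[OF assms(3) \<gamma>_inv[OF assms(4)]] assms(4,5)] assms
    by (simp add: commut_\<gamma>)
qed

lemma cls_commut_inv_right:
  assumes "i \<ge> 1" "j \<ge> 1" "g \<in> \<gamma> i" "h \<in> \<gamma> j"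
  shows "cls (i + j) (commut G g (inv h)) = inv\<^bsub>gr G (i + j)\<^esub> cls (i + j) (commut G g h)"
  using cls_commut_inv_left[of j i h g] cls_commut_anti[of j i h g]
    cls_commut_anti[OF assms(2,1) \<gamma>_inv[OF assms(4)] assms(3)] assms
  by (simp add: add.commute)

text \<open>Hall-Witt modulo \<open>\<gamma> (Suc n)\<close>: the conjugations vanish and each inner
  inverse becomes a sign, so what remains is the inverse of the Jacobi sum.\<close>

lemma cls_jacobi:
  assumes "i \<ge> 1" "j \<ge> 1" "k \<ge> 1" "x \<in> \<gamma> i" "y \<in> \<gamma> j" "z \<in> \<gamma> k"
  defines "n \<equiv> i + j + k"
  shows "cls n (commut G (commut G x y) z) \<otimes>\<^bsub>gr G n\<^esub> cls n (commut G (commut G y z) x) \<otimes>\<^bsub>gr G n\<^esub>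
    cls n (commut G (commut G z x) y) = \<one>\<^bsub>gr G n\<^esub>"
proof -
  have n1: "n \<ge> 1" using assms by simp
  interpret Q: comm_group "gr G n" by (rule gr_comm_group[OF n1])
  have *: "inv b \<otimes> commut G (commut G a (inv b)) c \<otimes> b \<in> \<gamma> n \<and>
      cls n (inv b \<otimes> commut G (commut G a (inv b)) c \<otimes> b) = inv\<^bsub>gr G n\<^esub> cls n (commut G (commut G a b) c)"
    if "i \<ge> 1" "j \<ge> 1" "k \<ge> 1" "a \<in> \<gamma> i" "b \<in> \<gamma> j" "c \<in> \<gamma> k" "n = i + j + k" for i j k a b c
  proof -
    have m: "commut G a b \<in> \<gamma> (i + j)" "commut G a (inv b) \<in> \<gamma> (i + j)"
      using that by (simp_all add: commut_\<gamma> \<gamma>_inv)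
    have m2: "commut G (commut G a (inv b)) c \<in> \<gamma> n"
      using commut_\<gamma>[OF _ that(3) m(2) that(6)] that by simp
    have b: "b \<in> carrier G" using that \<gamma>_carrier by auto
    have "cls (i + j) (commut G a (inv b)) = cls (i + j) (inv (commut G a b))"
      using that m by (simp add: cls_commut_inv_right cls_inv)
    then have "cls n (commut G (commut G a (inv b)) c) = cls n (commut G (inv (commut G a b)) c)"
      using that m unfolding that(7) by (intro cls_commut_cong_left) (auto intro: \<gamma>_inv)
    also have "\<dots> = inv\<^bsub>gr G n\<^esub> cls n (commut G (commut G a b) c)"
      using that m unfolding that(7) by (intro cls_commut_inv_left) auto
    finally show ?thesis using m2 b n1 by (simp add: cls_conj \<gamma>_conj)
  qed
  have n': "n = i + j + k" "n = j + k + i" "n = k + i + j" by (simp_all add: n_def)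
  note h = *[OF assms(1-6) n'(1)] *[OF assms(2,3,1,5,6,4) n'(2)] *[OF assms(3,1,2,6,4,5) n'(3)]
  have A: "commut G (commut G x y) z \<in> \<gamma> n"
    unfolding n_def by (rule commut_\<gamma>[OF _ assms(3) commut_\<gamma>[OF assms(1,2,4,5)] assms(6)]) (use assms in simp)
  have B: "commut G (commut G y z) x \<in> \<gamma> n"
    unfolding n'(2) by (rule commut_\<gamma>[OF _ assms(1) commut_\<gamma>[OF assms(2,3,5,6)] assms(4)]) (use assms in simp)
  have C: "commut G (commut G z x) y \<in> \<gamma> n"
    unfolding n'(3) by (rule commut_\<gamma>[OF _ assms(2) commut_\<gamma>[OF assms(3,1,6,4)] assms(5)]) (use assms in simp)
  have "cls n \<one> = inv\<^bsub>gr G n\<^esub> cls n (commut G (commut G x y) z) \<otimes>\<^bsub>gr G n\<^esub>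
     inv\<^bsub>gr G n\<^esub> cls n (commut G (commut G y z) x) \<otimes>\<^bsub>gr G n\<^esub> inv\<^bsub>gr G n\<^esub> cls n (commut G (commut G z x) y)"
    using h arg_cong[OF hall_witt[of x y z, symmetric], of "cls n"] \<gamma>_carrier[OF assms(4)]
      \<gamma>_carrier[OF assms(5)] \<gamma>_carrier[OF assms(6)]
    by (simp add: cls_mult \<gamma>_mult del: cls_one)
  also have "\<dots> = inv\<^bsub>gr G n\<^esub> (cls n (commut G (commut G x y) z) \<otimes>\<^bsub>gr G n\<^esub> cls n (commut G (commut G y z) x)
     \<otimes>\<^bsub>gr G n\<^esub> cls n (commut G (commut G z x) y))"
    using A B C by (simp add: Q.inv_mult)
  finally have "inv\<^bsub>gr G n\<^esub> (cls n (commut G (commut G x y) z) \<otimes>\<^bsub>gr G n\<^esub> cls n (commut G (commut G y z) x)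
     \<otimes>\<^bsub>gr G n\<^esub> cls n (commut G (commut G z x) y)) = \<one>\<^bsub>gr G n\<^esub>" by simp
  then show ?thesis
    using A B C by (simp add: Q.inv_eq_1_iff)
qed

end

subsection \<open>Evaluation of Lie polynomials\<close>

text \<open>A letter may sit deeper than in the first term; this lets the commutators
  \<open>[t, f\<^sub>i]\<close>, of weight two, be letters beside \<open>t\<close>. Letters outside
  \<open>A\<close> evaluate to the identity, so that all trees over the type can be
  evaluated.\<close>

locale weighted_letters = group G for G (structure) +
  fixes A :: "'x set" and \<Theta> :: "('x \<times> 'x) set" and e :: "'x \<Rightarrow> 'a" and wt :: "'x \<Rightarrow> nat"
  assumes wt_pos: "wt x \<ge> 1" and e_\<gamma>: "e x \<in> \<gamma> (wt x)"
    and e_outside: "x \<notin> A \<Longrightarrow> e x = \<one>"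
    and e_commute: "(x, y) \<in> \<Theta> \<Longrightarrow> commut G (e x) (e y) = \<one>"
begin

primrec ev :: "'x tree \<Rightarrow> 'a" where
  "ev (Leaf x) = e x"
| "ev (Node s t) = commut G (ev s) (ev t)"

primrec weight :: "'x tree \<Rightarrow> nat" where
  "weight (Leaf x) = wt x"
| "weight (Node s t) = weight s + weight t"

lemma weight_pos: "weight t \<ge> 1"
  using wt_pos by (induction t) (auto intro: order_trans)

lemma weight_not_0 [simp]: "weight t \<noteq> 0"
  using weight_pos[of t] by simp

lemma ev_\<gamma>: "ev t \<in> \<gamma> (weight t)"
proof (induction t)
  case (Node s t)
  then show ?case using commut_\<gamma>[OF weight_pos weight_pos] by simp
qed (simp add: e_\<gamma>)

lemma ev_carrier [simp]: "ev t \<in> carrier G"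
  using ev_\<gamma> \<gamma>_carrier by blast

text \<open>Trees of a different weight go to the identity, which makes \<open>ev_gr d\<close> the
  degree \<open>d\<close> part of a single map into the associated graded Lie ring.\<close>

definition tree_cls :: "nat \<Rightarrow> 'x tree \<Rightarrow> 'a set" where
  "tree_cls d t = (if weight t = d then cls d (ev t) else \<one>\<^bsub>gr G d\<^esub>)"

definition ev_gr :: "nat \<Rightarrow> 'x lie_poly \<Rightarrow> 'a set" where
  "ev_gr d = (SOME h. h \<in> hom (free_Abelian_group UNIV) (gr G d) \<and> (\<forall>t. h (frag_of t) = tree_cls d t))"

lemma ev_gr:
  assumes "d \<ge> 1"
  shows "ev_gr d \<in> hom (free_Abelian_group UNIV) (gr G d) \<and> (\<forall>t. ev_gr d (frag_of t) = tree_cls d t)"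
proof -
  interpret Q: comm_group "gr G d" by (rule gr_comm_group[OF assms])
  have "tree_cls d ` UNIV \<subseteq> carrier (gr G d)"
    by (auto simp: tree_cls_def ev_\<gamma>)
  then obtain h where "h \<in> hom (free_Abelian_group UNIV) (gr G d)" "\<And>t. h (frag_of t) = tree_cls d t"
    by (rule Q.free_Abelian_group_universal) (rule that, auto)
  then show ?thesis
    unfolding ev_gr_def
    by (intro someI[of "\<lambda>h. h \<in> hom (free_Abelian_group UNIV) (gr G d) \<and> (\<forall>t. h (frag_of t) = tree_cls d t)"])
      auto
qed

context
  fixes d :: nat
  assumes d: "d \<ge> 1"
begin

interpretation Q: comm_group "gr G d" by (rule gr_comm_group[OF d])

interpretation h: group_hom "free_Abelian_group (UNIV :: 'x tree set)" "gr G d" "ev_gr d"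
  using ev_gr[OF d] by (intro group_hom.intro group_hom_axioms.intro gr_group) simp_all

lemma ev_gr_closed [simp, intro]: "ev_gr d p \<in> carrier (gr G d)"
  using h.hom_closed[of p] by simp

lemma ev_gr_of: "ev_gr d (frag_of t) = tree_cls d t"
  using ev_gr[OF d] by simp

lemma ev_gr_add: "ev_gr d (p + q) = ev_gr d p \<otimes>\<^bsub>gr G d\<^esub> ev_gr d q"
  using h.hom_mult[of p q] by simp

lemma ev_gr_0: "ev_gr d 0 = \<one>\<^bsub>gr G d\<^esub>"
  using h.hom_one by simp

lemma ev_gr_minus: "ev_gr d (- p) = inv\<^bsub>gr G d\<^esub> ev_gr d p"
  using h.hom_inv[of p] by simp

lemma ev_gr_diff: "ev_gr d (p - q) = ev_gr d p \<otimes>\<^bsub>gr G d\<^esub> inv\<^bsub>gr G d\<^esub> ev_gr d q"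
  using ev_gr_add[of p "- q"] by (simp add: ev_gr_minus)

lemma ev_gr_zmul: "ev_gr d (zmul (int n) p) = ev_gr d p [^]\<^bsub>gr G d\<^esub> n"
proof (induction n)
  case (Suc n)
  have "zmul (int (Suc n)) p = zmul (int n) p + p"
    using zmul_succ[of "int n" p] by (simp add: add.commute)
  then show ?case by (simp add: ev_gr_add Suc)
qed (simp add: ev_gr_0)

end

text \<open>Commutators are additive only up to classes. The induction on \<open>p\<close> therefore
  produces some representative, which is exchanged for the given \<open>g\<close> at the
  end.\<close>

lemma ev_gr_bracket:
  assumes i: "i \<ge> 1" and g: "g \<in> \<gamma> i" "ev_gr i p = cls i g"
  shows "ev_gr (i + weight c) (br p (frag_of c)) = cls (i + weight c) (commut G g (ev c))"
proof -
  define d where "d = i + weight c"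
  have d: "d \<ge> 1" using i by (simp add: d_def)
  interpret Q: comm_group "gr G d" by (rule gr_comm_group[OF d])
  note E = ev_gr_0[OF d] ev_gr_of[OF d] ev_gr_diff[OF d] ev_gr_0[OF i] ev_gr_of[OF i] ev_gr_diff[OF i]
  have "\<exists>g\<in>\<gamma> i. ev_gr i p = cls i g \<and> ev_gr d (br p (frag_of c)) = cls d (commut G g (ev c))" for p
  proof (induction p rule: frag_induct)
    case zero
    show ?case
      by (rule bexI[of _ \<one>]) (simp_all add: E commut_one \<gamma>_one)
  next
    case (of s)
    have w: "weight s + weight c = d \<longleftrightarrow> weight s = i" unfolding d_def by auto
    show ?case
    proof (cases "weight s = i")
      case True
      then show ?thesis
        using ev_\<gamma>[of s] by (intro bexI[of _ "ev s"]) (simp_all add: E tree_cls_def d_def[symmetric])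
    next
      case False
      then show ?thesis
        by (intro bexI[of _ \<one>]) (simp_all add: E tree_cls_def commut_one \<gamma>_one w)
    qed
  next
    case (diff p q)
    then obtain g h where g: "g \<in> \<gamma> i" "h \<in> \<gamma> i"
      "ev_gr i p = cls i g" "ev_gr i q = cls i h"
      "ev_gr d (br p (frag_of c)) = cls d (commut G g (ev c))"
      "ev_gr d (br q (frag_of c)) = cls d (commut G h (ev c))" by blast
    have "cls d (commut G (g \<otimes> inv h) (ev c)) = cls d (commut G g (ev c)) \<otimes>\<^bsub>gr G d\<^esub> inv\<^bsub>gr G d\<^esub> cls d (commut G h (ev c))"
      unfolding d_def using g i ev_\<gamma>[of c] weight_pos[of c]
      by (simp add: cls_commut_mult_left cls_commut_inv_left \<gamma>_inv)
    then show ?case using g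
      by (intro bexI[of _ "g \<otimes> inv h"])
        (simp_all add: E br_diff_left cls_mult cls_inv \<gamma>_mult \<gamma>_inv)
  qed
  then obtain h where h: "h \<in> \<gamma> i" "ev_gr i p = cls i h"
    "ev_gr d (br p (frag_of c)) = cls d (commut G h (ev c))" by blast
  have "cls d (commut G h (ev c)) = cls d (commut G g (ev c))"
  unfolding d_def by (rule cls_commut_cong_left) (use i g h weight_pos ev_\<gamma> in auto)
  with h show ?thesis by (simp add: d_def)
qed

lemma ev_gr_lie_ideal: "p \<in> lie_ideal A \<Theta> \<Longrightarrow> d \<ge> 1 \<Longrightarrow> ev_gr d p = \<one>\<^bsub>gr G d\<^esub>"
proof (induction arbitrary: d rule: lie_ideal.induct)
  case (alternating a)
  then show ?case by (simp add: ev_gr_of tree_cls_def commut_self)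
next
  case (antisymmetric a b)
  interpret Q: comm_group "gr G d" by (rule gr_comm_group[OF antisymmetric])
  show ?case
    using commut_\<gamma>[OF weight_pos weight_pos ev_\<gamma> ev_\<gamma>, of a b]
      cls_commut_anti[OF weight_pos weight_pos ev_\<gamma> ev_\<gamma>, of a b] antisymmetric
    by (cases "d = weight a + weight b")
      (simp_all add: ev_gr_add ev_gr_of tree_cls_def add.commute group.r_inv[OF gr_group])
next
  case (jacobi a b c)
  interpret Q: comm_group "gr G d" by (rule gr_comm_group[OF jacobi])
  show ?case
  proof (cases "d = weight a + weight b + weight c")
    case True
    then have w: "weight a + weight b + weight c = d" "weight b + weight c + weight a = d"
      "weight c + weight a + weight b = d" by simp_all
    show ?thesis
      using cls_jacobi[OF weight_pos weight_pos weight_pos ev_\<gamma> ev_\<gamma> ev_\<gamma>, of a b c] jacobi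
      by (simp add: ev_gr_add ev_gr_of tree_cls_def w)
  next
    case False
    then have w: "weight a + weight b + weight c \<noteq> d" "weight b + weight c + weight a \<noteq> d"
      "weight c + weight a + weight b \<noteq> d" by simp_all
    then show ?thesis using jacobi by (simp add: ev_gr_add ev_gr_of tree_cls_def)
  qed
next
  case (outside y)
  then show ?case by (simp add: ev_gr_of tree_cls_def e_outside)
next
  case (commute x y)
  then show ?case by (simp add: ev_gr_of tree_cls_def e_commute)
next
  case (diff p q)
  interpret Q: comm_group "gr G d" by (rule gr_comm_group) fact
  show ?case using diff by (simp add: ev_gr_diff)
next
  case (bracket p c)
  interpret Q: comm_group "gr G d" by (rule gr_comm_group) fact
  note E = ev_gr_0[OF bracket.prems] ev_gr_of[OF bracket.prems] ev_gr_diff[OF bracket.prems]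
  show ?case
  proof (cases "weight c < d")
    case False
    \<comment> \<open>Every bracket with \<open>c\<close> now has weight above \<open>d\<close>,
      where \<open>tree_cls\<close> is trivial.\<close>
    have *: "weight s + weight c \<noteq> d" for s using False weight_pos[of s] by linarith
    show ?thesis
      by (induction p rule: frag_induct)
        (simp_all add: E tree_cls_def * br_diff_left)
  next
    case True
    define i where "i = d - weight c"
    have i: "i \<ge> 1" "d = i + weight c" using True by (simp_all add: i_def)
    have "ev_gr i p \<in> carrier (gr G i)" using i(1) by (rule ev_gr_closed)
    then obtain g where g: "g \<in> \<gamma> i" "ev_gr i p = cls i g" by (auto simp: carrier_gr)
    have "cls i g = \<one>\<^bsub>gr G i\<^esub>" using bracket.IH[OF i(1)] g(2) by simp
    then have "g \<in> \<gamma> (Suc i)" using cls_one_iff[OF g(1)] by blast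
    then have "commut G g (ev c) \<in> \<gamma> (Suc d)"
      using commut_\<gamma>[OF _ weight_pos _ ev_\<gamma>, of "Suc i" g c] i by simp
    then show ?thesis
      using ev_gr_bracket[OF i(1) g, of c] \<gamma>_Suc_subset[of d] cls_one_iff[of "commut G g (ev c)" d]
      by (auto simp: i(2)[symmetric])
  qed
qed

end

section \<open>Power series units and their leading coefficients\<close>

definition fps_units :: "'r::ring_1 fps monoid" where
  "fps_units = \<lparr>carrier = {u. fps_nth u 0 = 1}, monoid.mult = (*), one = 1\<rparr>"

lemma fps_units_simps [simp]:
  "carrier fps_units = {u. fps_nth u 0 = 1}" "x \<otimes>\<^bsub>fps_units\<^esub> y = x * y" "\<one>\<^bsub>fps_units\<^esub> = 1"
  by (simp_all add: fps_units_def)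

lemma fps_units_group: "group (fps_units :: 'r::ring_1 fps monoid)"
proof (rule groupI)
  fix u :: "'r fps" assume "u \<in> carrier fps_units"
  then have u: "fps_nth u 0 = 1" by simp
  let ?v = "fps_left_inverse u 1"
  have "?v * u = 1" using u by (intro fps_left_inverse) simp
  moreover have "fps_nth ?v 0 = 1" by (simp add: fps_lr_inverse_nth_0)
  ultimately show "\<exists>v\<in>carrier fps_units. v \<otimes>\<^bsub>fps_units\<^esub> u = \<one>\<^bsub>fps_units\<^esub>"
    by (intro bexI[of _ ?v]) simp_all
qed (simp_all add: mult.assoc)

interpretation U: group "fps_units :: 'r::ring_1 fps monoid"
  by (rule fps_units_group)

text \<open>That is, \<open>u\<close> equals 1 plus \<open>c\<close> times the \<open>d\<close>-th
  power of \<open>fps_X\<close>, up to higher terms. The coefficient \<open>c\<close> may be zero,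
  so the condition also expresses membership in a filtration.\<close>

definition leading :: "nat \<Rightarrow> 'r::ring_1 \<Rightarrow> 'r fps \<Rightarrow> bool" where
  "leading d c u \<longleftrightarrow> (\<exists>a. u = 1 + fps_X ^ d * a \<and> fps_nth a 0 = c)"

lemma leading_carrier: "d \<ge> 1 \<Longrightarrow> leading d c u \<Longrightarrow> u \<in> carrier fps_units"
  by (auto simp: leading_def fps_X_power_mult_nth)

lemma leading_unique: "d \<ge> 1 \<Longrightarrow> leading d c u \<Longrightarrow> leading d c' u \<Longrightarrow> c = c'"
  by (auto simp: leading_def fps_eq_iff fps_X_power_mult_nth) (metis diff_self_eq_0 less_irrefl)

lemma leading_1: "leading d 0 1"
  by (auto simp: leading_def intro!: exI[of _ 0])

lemma leading_Suc: "leading (Suc d) c u \<Longrightarrow> leading d 0 u"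
proof -
  assume "leading (Suc d) c u"
  then obtain a where "u = 1 + fps_X ^ Suc d * a" by (auto simp: leading_def)
  then have "u = 1 + fps_X ^ d * (fps_X * a)" by (simp only: power_Suc2 mult.assoc)
  then show ?thesis unfolding leading_def by (intro exI[of _ "fps_X * a"]) simp
qed

lemma leading_one_series:
  assumes "fps_nth u 0 = 1"
  shows "leading 1 (fps_nth u 1) u"
proof -
  have "u = 1 + fps_X ^ 1 * fps_shift 1 u"
    by (rule fps_ext) (simp add: assms)
  then show ?thesis unfolding leading_def by (metis fps_shift_nth add_0)
qed

lemma leading_mult:
  assumes "d \<ge> 1" "leading d c u" "leading d c' v"
  shows "leading d (c + c') (u * v)"
proof -
  obtain a b where a: "u = 1 + fps_X ^ d * a" "fps_nth a 0 = c" and b: "v = 1 + fps_X ^ d * b" "fps_nth b 0 = c'"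
    using assms by (auto simp: leading_def)
  have "u * v = 1 + fps_X ^ d * (a + b + a * (fps_X ^ d * b))"
    by (simp add: a b algebra_simps)
  moreover have "fps_nth (a + b + a * (fps_X ^ d * b)) 0 = c + c'"
    using assms(1) by (simp add: a b fps_X_power_mult_nth)
  ultimately show ?thesis unfolding leading_def by blast
qed

lemma leading_inv:
  assumes "d \<ge> 1" "leading d c u"
  shows "leading d (- c) (inv\<^bsub>fps_units\<^esub> u)"
proof -
  obtain a where a: "u = 1 + fps_X ^ d * a" "fps_nth a 0 = c" using assms by (auto simp: leading_def)
  have u: "u \<in> carrier fps_units" by (rule leading_carrier[OF assms])
  define v where "v = inv\<^bsub>fps_units\<^esub> u"
  have v: "v * u = 1" "fps_nth v 0 = 1"
    using U.l_inv[OF u] U.inv_closed[OF u] by (simp_all add: v_def)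
  then have "v + v * (fps_X ^ d * a) = 1" by (simp add: a(1) algebra_simps)
  then have "v = 1 + fps_X ^ d * (- (v * a))"
    by (simp add: eq_diff_eq[symmetric] mult.assoc[symmetric] fps_mult_fps_X_power_commute[of d v])
  moreover have "fps_nth (- (v * a)) 0 = - c" by (simp add: v a)
  ultimately show ?thesis unfolding leading_def v_def by blast
qed

text \<open>The lowest term of \<open>u * v - v * u\<close> is the ring commutator of the leading
  coefficients, because \<open>fps_X\<close> is central. Multiplying by the inverse of
  \<open>v * u\<close>, with constant term 1, leaves it unchanged.\<close>

lemma leading_commut:
  assumes "i \<ge> 1" "j \<ge> 1" "leading i c u" "leading j c' v"
  shows "leading (i + j) (c * c' - c' * c) (commut fps_units u v)"
proof -
  obtain a b where a: "u = 1 + fps_X ^ i * a" "fps_nth a 0 = c" and b: "v = 1 + fps_X ^ j * b" "fps_nth b 0 = c'"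
    using assms by (auto simp: leading_def)
  have uv: "u \<in> carrier fps_units" "v \<in> carrier fps_units"
    using assms leading_carrier by blast+
  define w where "w = inv\<^bsub>fps_units\<^esub> u * inv\<^bsub>fps_units\<^esub> v"
  have w: "w * (v * u) = 1" "fps_nth w 0 = 1"
  proof -
    have "inv\<^bsub>fps_units\<^esub> u \<otimes>\<^bsub>fps_units\<^esub> inv\<^bsub>fps_units\<^esub> v \<otimes>\<^bsub>fps_units\<^esub> (v \<otimes>\<^bsub>fps_units\<^esub> u) = \<one>\<^bsub>fps_units\<^esub>"
      using uv by (simp only: U.m_assoc U.inv_closed U.m_closed U.inv_mult_cancel U.l_inv)
    then show "w * (v * u) = 1" by (simp add: w_def)
    show "fps_nth w 0 = 1" using U.inv_closed[OF uv(1)] U.inv_closed[OF uv(2)] by (simp add: w_def)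
  qed
  have X: "f * (fps_X ^ k * g) = fps_X ^ k * (f * g)" for k and f g :: "'a fps"
    by (metis mult.assoc fps_mult_fps_X_power_commute)
  have 1: "fps_X ^ i * a * (fps_X ^ j * b) = fps_X ^ (i + j) * (a * b)"
    by (simp only: power_add mult.assoc X[of a])
  have 2: "fps_X ^ j * b * (fps_X ^ i * a) = fps_X ^ (i + j) * (b * a)"
    by (simp only: power_add mult.assoc X[of b] add.commute[of i])
  have "u * v - v * u = fps_X ^ i * a * (fps_X ^ j * b) - fps_X ^ j * b * (fps_X ^ i * a)"
    by (simp add: a b algebra_simps)
  then have "u * v - v * u = fps_X ^ (i + j) * (a * b - b * a)"
    by (simp only: 1 2 right_diff_distrib)
  then have "u * v = v * u + fps_X ^ (i + j) * (a * b - b * a)"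
    by (metis add.commute diff_add_cancel)
  then have "w * (u * v) = 1 + w * (fps_X ^ (i + j) * (a * b - b * a))"
    by (simp add: distrib_left w)
  then have "commut fps_units u v = 1 + fps_X ^ (i + j) * (w * (a * b - b * a))"
    by (simp only: commut_def w_def X fps_units_simps mult.assoc)
  moreover have "fps_nth (w * (a * b - b * a)) 0 = c * c' - c' * c"
    by (simp add: w a b)
  ultimately show ?thesis unfolding leading_def by blast
qed

text \<open>Units congruent to 1 modulo powers of \<open>fps_X\<close> form a filtration in which a
  commutator with any unit gains a degree, so the filtration contains the image of the lower central
  series.\<close>

lemma (in group) leading_lower_central:
  assumes "M \<in> hom G fps_units" "d \<ge> 1" "g \<in> \<gamma> d"
  shows "\<exists>c. leading d c (M g)"
  using assms(2,3)
proof (induction d arbitrary: g)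
  case (Suc d)
  interpret M: group_hom G fps_units M
    by (intro group_hom.intro group_hom_axioms.intro is_group fps_units_group assms)
  show ?case
  proof (cases d)
    case 0
    then have "fps_nth (M g) 0 = 1" using M.hom_closed[of g] Suc.prems by simp
    from leading_one_series[OF this] show ?thesis using 0 by auto
  next
    case (Suc c)
    let ?S = "{commut G x y |x y. x \<in> \<gamma> (Suc c) \<and> y \<in> carrier G}"
    have S: "\<exists>c. leading (Suc d) c (M s)" if "s \<in> ?S" for s
    proof -
      from that obtain x y where xy: "s = commut G x y" "x \<in> \<gamma> d" "y \<in> carrier G" using Suc by auto
      then obtain c' where 1: "leading d c' (M x)" using Suc.IH[of x] Suc by auto
      have 2: "leading 1 (fps_nth (M y) 1) (M y)"
        using M.hom_closed[OF xy(3)] by (intro leading_one_series) simp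
      have "M s = commut fps_units (M x) (M y)"
        using xy \<gamma>_carrier by (simp add: commut_def)
      with leading_commut[OF _ _ 1 2] Suc show ?thesis by auto
    qed
    have "g \<in> generate G ?S" using Suc.prems Suc by simp
    then have "g \<in> carrier G \<and> (\<exists>c. leading (Suc d) c (M g))"
    proof (induction rule: generate.induct)
      case one
      then show ?case using leading_1 by auto
    next
      case (incl h)
      then have "h \<in> carrier G" using \<gamma>_carrier commut_closed by blast
      with S[OF incl] show ?case by blast
    next
      case (inv h)
      then have h: "h \<in> carrier G" using \<gamma>_carrier commut_closed by blast
      from S[OF inv] obtain c where "leading (Suc d) c (M h)" by blast
      from leading_inv[OF _ this] show ?case using h by auto
    next
      case (eng g h)
      then obtain c c' where "g \<in> carrier G" "h \<in> carrier G" "leading (Suc d) c (M g)" "leading (Suc d) c' (M h)"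
        by blast
      with leading_mult[of "Suc d" c "M g" c' "M h"] show ?case by auto
    qed
    then show ?thesis by blast
  qed
qed simp

section \<open>Operators on functions of words\<close>

text \<open>An operator ring is used in place of the monoid ring because it contains both the
  letters and the substitutions, so both parts of the group can act by units of one power series
  ring.\<close>

typedef 'x op = "{f :: ('x list \<Rightarrow> int) \<Rightarrow> 'x list \<Rightarrow> int. Modules.additive f}"
  morphisms app Abs_op
  by (rule exI[of _ "\<lambda>f. f"]) (simp add: Modules.additive_def)

setup_lifting type_definition_op

lemma op_eqI: "(\<And>\<phi>. app a \<phi> = app b \<phi>) \<Longrightarrow> a = b"
  by (metis app_inject ext)

text \<open>Multiplication is composition in diagrammatic order, so that a product of left shifts
  along \<open>w\<close> evaluates a function at \<open>w\<close>.\<close>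

instantiation op :: (type) ring_1
begin

lift_definition zero_op :: "'a op" is "\<lambda>\<phi>. 0" by (simp add: Modules.additive_def)
lift_definition one_op :: "'a op" is "\<lambda>\<phi>. \<phi>" by (simp add: Modules.additive_def)
lift_definition plus_op :: "'a op \<Rightarrow> 'a op \<Rightarrow> 'a op" is "\<lambda>f g \<phi>. f \<phi> + g \<phi>"
  by (rule additive_plus)
lift_definition minus_op :: "'a op \<Rightarrow> 'a op \<Rightarrow> 'a op" is "\<lambda>f g \<phi>. f \<phi> - g \<phi>"
  by (simp add: Modules.additive_def add_diff_add)
lift_definition uminus_op :: "'a op \<Rightarrow> 'a op" is "\<lambda>f \<phi>. - f \<phi>"
  by (simp add: Modules.additive_def)
lift_definition times_op :: "'a op \<Rightarrow> 'a op \<Rightarrow> 'a op" is "\<lambda>f g \<phi>. g (f \<phi>)"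
  by (simp add: Modules.additive_def)

instance
proof
  fix a b c :: "'a op"
  show "(0 :: 'a op) \<noteq> 1"
    by transfer (auto simp: fun_eq_iff intro!: exI[of _ "\<lambda>w. 1"])
qed (transfer; auto simp: fun_eq_iff Modules.additive_def)+

end

lemmas app_simps [simp] = zero_op.rep_eq one_op.rep_eq plus_op.rep_eq minus_op.rep_eq
  uminus_op.rep_eq times_op.rep_eq

lift_definition shift :: "'x \<Rightarrow> 'x op" is "\<lambda>y \<phi> w. \<phi> (y # w)"
  by (simp add: Modules.additive_def fun_eq_iff)

text \<open>An idempotent whose values are functions constant on traces.\<close>

lift_definition project :: "('x \<times> 'x) set \<Rightarrow> 'x op" is "\<lambda>\<Theta> \<phi> w. \<phi> (normal_word \<Theta> w)"
  by (simp add: Modules.additive_def fun_eq_iff)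

lemma normal_word_Cons: "normal_word \<Theta> (y # normal_word \<Theta> w) = normal_word \<Theta> (y # w)"
proof (rule normal_word_eq)
  have "equivclp (swap \<Theta>) (y # w) (y # v)" if "equivclp (swap \<Theta>) w v" for v
    using that
  proof (induction rule: equivclp_induct)
    case (step u v)
    have "swap \<Theta> (y # u) (y # v)" if "swap \<Theta> u v" for u v
      using that by cases (metis append_Cons swap)
    then show ?case using step
      by (metis (full_types) equivclp_into_equivclp)
  qed simp
  from this[OF normal_word_equiv] show "equivclp (swap \<Theta>) (y # normal_word \<Theta> w) (y # w)"
    by (rule equivclp_sym)
qed

lemma normal_word_idem: "normal_word \<Theta> (normal_word \<Theta> w) = normal_word \<Theta> w"
  by (rule normal_word_eq[symmetric, OF normal_word_equiv])

lemma project_idem: "project \<Theta> * project \<Theta> = project \<Theta>"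
  by (rule op_eqI) (simp add: project.rep_eq normal_word_idem)

lemma project_shift: "project \<Theta> * shift y * project \<Theta> = project \<Theta> * shift y"
  by (rule op_eqI) (simp add: project.rep_eq shift.rep_eq normal_word_Cons)

definition letter_op :: "'x set \<Rightarrow> ('x \<times> 'x) set \<Rightarrow> 'x \<Rightarrow> 'x op" where
  "letter_op A \<Theta> y = (if y \<in> A then project \<Theta> * shift y else 0)"

lemma letter_op_commute:
  assumes "(x, y) \<in> \<Theta>"
  shows "letter_op A \<Theta> x * letter_op A \<Theta> y = letter_op A \<Theta> y * letter_op A \<Theta> x"
  using normal_word_swap[OF assms, of "[]"]
  by (auto simp: letter_op_def project.rep_eq shift.rep_eq normal_word_Cons intro!: op_eqI)

text \<open>Each letter normalises before it shifts, and normal forms are compatible with prefixing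
  a letter. The empty word is excluded because the empty product is the identity, which does not
  normalise.\<close>

lemma app_word:
  "w \<noteq> [] \<Longrightarrow> app (prod_list (map (letter_op A \<Theta>) w)) \<phi> v =
     (if set w \<subseteq> A then \<phi> (normal_word \<Theta> (w @ v)) else 0)"
proof (induction w arbitrary: \<phi>)
  case (Cons y w)
  show ?case
  proof (cases "w = []")
    case True
    then show ?thesis by (simp add: letter_op_def project.rep_eq shift.rep_eq)
  next
    case False
    then show ?thesis using Cons.IH[OF False]
      by (auto simp: letter_op_def project.rep_eq shift.rep_eq normal_word_Cons)
  qed
qed simp

primrec ring_ev :: "('x \<Rightarrow> 'r::ring_1) \<Rightarrow> 'x tree \<Rightarrow> 'r" where
  "ring_ev a (Leaf x) = a x"
| "ring_ev a (Node s t) = ring_ev a s * ring_ev a t - ring_ev a t * ring_ev a s"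

lemma ring_ev_pair: "ring_ev a t = pair t (\<lambda>w. prod_list (map a w))"
proof (induction t)
  case (Node s t)
  let ?P = "\<lambda>w. prod_list (map a w)"
  have *: "pair s (\<lambda>u. pair t (\<lambda>v. ?P (u @ v))) = pair s ?P * pair t ?P" for s t
  proof -
    have "pair t (\<lambda>v. ?P u * ?P v) = ?P u * pair t ?P" for u
      by (rule additive_pair[symmetric, of "\<lambda>r. ?P u * r"]) (simp add: Modules.additive_def distrib_left)
    moreover have "pair s (\<lambda>u. ?P u * r) = pair s ?P * r" for r
      by (rule additive_pair[symmetric, of "\<lambda>q. q * r"]) (simp add: Modules.additive_def distrib_right)
    ultimately show ?thesis by simp
  qed
  show ?case by (simp only: ring_ev.simps Node pair_Node *)
qed simp

text \<open>Faithfulness of the operators: the coefficient of a trace \<open>k\<close> is recovered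
  by applying an operator to the indicator function of \<open>k\<close> and evaluating at
  \<open>[]\<close>.\<close>

lemma trace_zero_ring:
  assumes "frag_ext (ring_ev (letter_op A \<Theta>)) p = 0"
  shows "trace_zero A \<Theta> p"
  unfolding trace_zero_def
proof (rule poly_mapping_eqI)
  fix k :: "'a list"
  let ?\<phi> = "\<lambda>w. if w = k then 1 else (0::int)"
  let ?P = "\<lambda>w. prod_list (map (letter_op A \<Theta>) w)"
  have "Poly_Mapping.lookup (pair_poly p (trace_of A \<Theta>)) k =
      pair_poly p (\<lambda>w. Poly_Mapping.lookup (trace_of A \<Theta> w) k)"
    by (rule additive_pair_poly) (simp add: Modules.additive_def lookup_add)
  also have "\<dots> = frag_ext (\<lambda>t. app (pair t ?P) ?\<phi> []) p"
    unfolding pair_poly_def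
  proof (intro arg_cong[of _ _ "\<lambda>f. frag_ext f p"] ext)
    fix t
    have "app (pair t ?P) ?\<phi> [] = pair t (\<lambda>w. app (?P w) ?\<phi> [])"
      by (rule additive_pair) (simp add: Modules.additive_def)
    also have "\<dots> = pair t (\<lambda>w. Poly_Mapping.lookup (trace_of A \<Theta> w) k)"
    proof (rule pair_cong)
      fix w :: "'a list" assume "length w = leaves t"
      then have "w \<noteq> []" by (metis leaves_pos length_0_conv less_irrefl)
      then show "app (?P w) ?\<phi> [] = Poly_Mapping.lookup (trace_of A \<Theta> w) k"
        by (simp add: app_word trace_of_def)
    qed
    finally show "pair t (\<lambda>w. Poly_Mapping.lookup (trace_of A \<Theta> w) k) = app (pair t ?P) ?\<phi> []" ..
  qed
  also have "\<dots> = app (frag_ext (ring_ev (letter_op A \<Theta>)) p) ?\<phi> []"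
    unfolding ring_ev_pair
    by (rule additive_frag_ext[of "\<lambda>a. app a ?\<phi> []", symmetric]) (simp add: Modules.additive_def)
  finally show "Poly_Mapping.lookup (pair_poly p (trace_of A \<Theta>)) k = Poly_Mapping.lookup 0 k"
    using assms by simp
qed

section \<open>Graded pieces detected by power series\<close>

text \<open>\<open>M\<close> is a homomorphism on all of \<open>G\<close>, not just on the subgroup
  generated by the letters, so that it can be confronted with the lower central series of
  \<open>G\<close>.\<close>

locale magnus = weighted_letters G A \<Theta> e wt
  for G (structure) and A :: "'x set" and \<Theta> :: "('x \<times> 'x) set" and e :: "'x \<Rightarrow> 'a" and wt +
  fixes M :: "'a \<Rightarrow> 'x op fps"
  assumes finite_A: "finite A" and M: "M \<in> hom G fps_units"
    and leading_letter: "leading (wt x) (letter_op A \<Theta> x) (M (e x))"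
begin

sublocale M: group_hom G fps_units M
  by (intro group_hom.intro group_hom_axioms.intro is_group fps_units_group M)

abbreviation rep :: "'x tree \<Rightarrow> 'x op" where
  "rep \<equiv> ring_ev (letter_op A \<Theta>)"

lemma leading_tree: "leading (weight t) (rep t) (M (ev t))"
proof (induction t)
  case (Node s t)
  then show ?case
    using leading_commut[OF weight_pos weight_pos Node] by (simp add: commut_def)
qed (simp add: leading_letter)

definition weight_part :: "nat \<Rightarrow> 'x lie_poly \<Rightarrow> 'x lie_poly" where
  "weight_part d = frag_ext (\<lambda>t. if weight t = d then frag_of t else 0)"

lemma weight_part_of: "weight_part d (frag_of t) = (if weight t = d then frag_of t else 0)"
  and weight_part_0: "weight_part d 0 = 0"
  and weight_part_diff: "weight_part d (p - q) = weight_part d p - weight_part d q"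
  and weight_part_zmul: "weight_part d (zmul k p) = zmul k (weight_part d p)"
  by (simp_all add: weight_part_def)

lemma ev_gr_weight_part:
  assumes d: "d \<ge> 1"
  shows "ev_gr d (weight_part d p) = ev_gr d p"
  by (induction p rule: frag_induct)
    (simp_all add: weight_part_0 weight_part_of weight_part_diff ev_gr_diff[OF d] ev_gr_of[OF d]
      ev_gr_0[OF d] tree_cls_def)

lemma ev_gr_leading:
  assumes d: "d \<ge> 1"
  shows "\<exists>g\<in>\<gamma> d. ev_gr d p = cls d g \<and> leading d (frag_ext rep (weight_part d p)) (M g)"
proof (induction p rule: frag_induct)
  case zero
  show ?case
    using leading_1[of d] by (intro bexI[of _ \<one>]) (simp_all add: ev_gr_0[OF d] weight_part_0 \<gamma>_one)
next
  case (of t)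
  show ?case
  proof (cases "weight t = d")
    case True
    then show ?thesis using leading_tree[of t] ev_\<gamma>[of t]
      by (intro bexI[of _ "ev t"]) (simp_all add: ev_gr_of[OF d] weight_part_of tree_cls_def)
  next
    case False
    then show ?thesis
      using leading_1[of d] by (intro bexI[of _ \<one>]) (simp_all add: ev_gr_of[OF d] weight_part_of tree_cls_def \<gamma>_one)
  qed
next
  case (diff p q)
  then obtain g h where g: "g \<in> \<gamma> d" "h \<in> \<gamma> d" "ev_gr d p = cls d g" "ev_gr d q = cls d h"
    "leading d (frag_ext rep (weight_part d p)) (M g)" "leading d (frag_ext rep (weight_part d q)) (M h)" by blast
  have "leading d (frag_ext rep (weight_part d (p - q))) (M (g \<otimes> inv h))"
    using leading_mult[OF d g(5) leading_inv[OF d g(6)]] g(1,2) \<gamma>_carrier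
    by (simp add: weight_part_diff)
  then show ?case using g
    by (intro bexI[of _ "g \<otimes> inv h"]) (simp_all add: ev_gr_diff[OF d] cls_mult cls_inv \<gamma>_mult \<gamma>_inv)
qed

text \<open>A representative of a trivial class lies one term deeper, so its coefficient in degree
  \<open>d\<close> vanishes; that coefficient is the value of the weight component in the operator
  ring.\<close>

lemma ev_gr_zero_imp_trace_zero:
  assumes d: "d \<ge> 1" and p: "ev_gr d p = \<one>\<^bsub>gr G d\<^esub>"
  shows "trace_zero A \<Theta> (weight_part d p)"
proof -
  obtain g where g: "g \<in> \<gamma> d" "ev_gr d p = cls d g" "leading d (frag_ext rep (weight_part d p)) (M g)"
    using ev_gr_leading[OF d] by blast
  then have "g \<in> \<gamma> (Suc d)" using cls_one_iff[OF g(1)] p by simp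
  then obtain c where "leading (Suc d) c (M g)"
    using leading_lower_central[OF M, of "Suc d"] by auto
  then have "frag_ext rep (weight_part d p) = 0"
    by (intro leading_unique[OF d g(3)] leading_Suc)
  then show ?thesis by (rule trace_zero_ring)
qed

lemma ev_gr_one_if_ring:
  assumes d: "d \<ge> 1" and p: "frag_ext rep (weight_part d p) = 0"
  shows "ev_gr d p = \<one>\<^bsub>gr G d\<^esub>"
  using trace_zero_imp_lie_ideal[OF finite_A trace_zero_ring[OF p]] ev_gr_lie_ideal[OF _ d]
    ev_gr_weight_part[OF d] by metis

text \<open>The factor \<open>n\<close> is cancelled in the torsion-free ring, and injectivity of
  the Lie ring into it carries the conclusion back to the group.\<close>

theorem ev_gr_torsion_free:
  assumes d: "d \<ge> 1" and n: "n > 0" and p: "ev_gr d p [^]\<^bsub>gr G d\<^esub> (n :: nat) = \<one>\<^bsub>gr G d\<^esub>"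
  shows "ev_gr d p = \<one>\<^bsub>gr G d\<^esub>"
proof -
  have "ev_gr d (zmul (int n) p) = \<one>\<^bsub>gr G d\<^esub>" using p by (simp add: ev_gr_zmul[OF d])
  from ev_gr_zero_imp_trace_zero[OF d this] have "trace_zero A \<Theta> (weight_part d p)"
    using n by (simp add: weight_part_zmul trace_zero_zmul)
  then have "weight_part d p \<in> lie_ideal A \<Theta>" by (rule trace_zero_imp_lie_ideal[OF finite_A])
  then show ?thesis using ev_gr_lie_ideal[OF _ d] ev_gr_weight_part[OF d] by metis
qed

end

lemma (in group) commut_eq_one_iff:
  assumes "x \<in> carrier G" "y \<in> carrier G"
  shows "commut G x y = \<one> \<longleftrightarrow> x \<otimes> y = y \<otimes> x"
proof -
  have "y \<otimes> x \<otimes> commut G x y = x \<otimes> y" using assms by (simp add: commut_def m_assoc)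
  then show ?thesis using assms
    by (metis commut_closed l_cancel_one' m_closed r_cancel_one')
qed

lemma (in group_hom) hom_commut:
  "x \<in> carrier G \<Longrightarrow> y \<in> carrier G \<Longrightarrow> h (commut G x y) = commut H (h x) (h y)"
  by (simp add: commut_def)

section \<open>The Formanek--Procesi group\<close>

locale formanek_procesi =
  fixes n :: nat and \<theta> :: "(nat \<times> nat) set"
  assumes pc: "partial_commutation n \<theta>"
begin

abbreviation S :: "fp_gen set" where "S \<equiv> fp_gens n"
abbreviation R :: "fp_gen word set" where "R \<equiv> fp_relators n \<theta>"
abbreviation Fr :: "fp_gen word monoid" where "Fr \<equiv> free_group S"
abbreviation N :: "fp_gen word set" where "N \<equiv> normal_closure Fr R"
abbreviation P :: "fp_gen word set monoid" where "P \<equiv> FP n \<theta>"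

sublocale Fr: group Fr by (rule free_group_group)
sublocale P: group P by (rule FP_group[OF pc])

lemma R_closed: "R \<subseteq> carrier Fr"
  by (rule fp_relators_closed[OF pc])

sublocale N: normal N Fr
  by (rule Fr.normal_closure_normal[OF R_closed])

definition gen :: "fp_gen \<Rightarrow> fp_gen word set" where
  "gen s = N #>\<^bsub>Fr\<^esub> free_gen s"

abbreviation \<pi> :: "fp_gen word \<Rightarrow> fp_gen word set" where
  "\<pi> \<equiv> (\<lambda>w. N #>\<^bsub>Fr\<^esub> w)"

sublocale \<pi>: group_hom Fr P \<pi>
  unfolding group_hom_def group_hom_axioms_def
  using N.r_coset_hom_Mod by (simp add: FP_def presented_group_def Fr.group_axioms P.group_axioms[unfolded FP_def presented_group_def])

lemma \<pi>_relator: "r \<in> R \<Longrightarrow> \<pi> r = \<one>\<^bsub>P\<^esub>"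
proof -
  assume "r \<in> R"
  then have "r \<in> N" by (auto simp: normal_closure_def)
  then have "\<pi> r = N" using N.mem_carrier by (intro Fr.coset_join2 N.subgroup_axioms) auto
  then show ?thesis by (simp add: FP_def presented_group_def)
qed

lemma theta_range: "(a, b) \<in> \<theta> \<Longrightarrow> a \<in> {1..n} \<and> b \<in> {1..n} \<and> a \<noteq> b"
  and theta_sym: "(a, b) \<in> \<theta> \<Longrightarrow> (b, a) \<in> \<theta>"
  using pc unfolding partial_commutation_def by blast+

definition t :: "fp_gen word set" where "t = gen T"
definition f :: "nat \<Rightarrow> fp_gen word set" where "f i = gen (F i)"
definition x :: "nat \<Rightarrow> fp_gen word set" where "x i = commut P t (f i)"

lemma T_S [simp]: "T \<in> S" and F_S [simp]: "F i \<in> S \<longleftrightarrow> i \<in> {1..n}"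
  by (auto simp: fp_gens_def)

lemma free_gen_Fr [simp]: "s \<in> S \<Longrightarrow> free_gen s \<in> carrier Fr"
  by (rule free_gen_closed)

lemma t_closed [simp]: "t \<in> carrier P"
  and f_closed [simp]: "i \<in> {1..n} \<Longrightarrow> f i \<in> carrier P"
  unfolding t_def f_def gen_def by (intro \<pi>.hom_closed; simp)+

lemma x_closed [simp]: "i \<in> {1..n} \<Longrightarrow> x i \<in> carrier P"
  by (simp add: x_def P.commut_closed)

lemma \<pi>_free_gen: "\<pi> (free_gen T) = t" "\<pi> (free_gen (F i)) = f i"
  by (simp_all add: t_def f_def gen_def)

lemma relations_less:
  shows "(a, b) \<in> \<theta> \<Longrightarrow> a > b \<Longrightarrow> commut P (f a) (f b) = \<one>\<^bsub>P\<^esub>"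
    and "i \<in> {1..n} \<Longrightarrow> j \<in> {1..n} \<Longrightarrow> commut P (x i) (f j) = \<one>\<^bsub>P\<^esub>"
    and "(a, b) \<in> \<theta> \<Longrightarrow> a > b \<Longrightarrow> commut P (x a) (x b) = \<one>\<^bsub>P\<^esub>"
proof -
  let ?c = "commut Fr"
  show "commut P (f a) (f b) = \<one>\<^bsub>P\<^esub>" if ab: "(a, b) \<in> \<theta>" "a > b"
  proof -
    have "?c (free_gen (F a)) (free_gen (F b)) \<in> R"
      using ab unfolding fp_relators_def Let_def by blast
    from \<pi>_relator[OF this] show ?thesis
      using theta_range[OF ab(1)] by (simp add: \<pi>.hom_commut \<pi>_free_gen)
  qed
  show "commut P (x i) (f j) = \<one>\<^bsub>P\<^esub>" if ij: "i \<in> {1..n}" "j \<in> {1..n}"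
  proof -
    have "?c (?c (free_gen T) (free_gen (F i))) (free_gen (F j)) \<in> R"
      using ij unfolding fp_relators_def Let_def by blast
    from \<pi>_relator[OF this] show ?thesis
      using ij by (simp add: \<pi>.hom_commut \<pi>_free_gen Fr.commut_closed x_def)
  qed
  show "commut P (x a) (x b) = \<one>\<^bsub>P\<^esub>" if ab: "(a, b) \<in> \<theta>" "a > b"
  proof -
    have "?c (?c (free_gen T) (free_gen (F a))) (?c (free_gen T) (free_gen (F b))) \<in> R"
      using ab unfolding fp_relators_def Let_def by blast
    from \<pi>_relator[OF this] show ?thesis
      using theta_range[OF ab(1)] by (simp add: \<pi>.hom_commut \<pi>_free_gen Fr.commut_closed x_def)
  qed
qed

lemma commut_f_f: "(a, b) \<in> \<theta> \<Longrightarrow> commut P (f a) (f b) = \<one>\<^bsub>P\<^esub>"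
  and commut_x_x: "(a, b) \<in> \<theta> \<Longrightarrow> commut P (x a) (x b) = \<one>\<^bsub>P\<^esub>"
  using relations_less(1,3)[of a b] relations_less(1,3)[of b a] theta_range[of a b] theta_sym[of a b]
    P.commut_inv[of "f b" "f a"] P.commut_inv[of "x b" "x a"]
  by (metis P.inv_one f_closed x_closed linorder_neqE_nat)+

lemmas commut_x_f = relations_less(2)

lemma generated: "carrier P = generate P (insert t (f ` {1..n}))"
proof
  let ?Y = "insert t (f ` {1..n})"
  have Y: "?Y \<subseteq> carrier P" by auto
  have letter: "\<pi> [l] \<in> generate P ?Y" if l: "l \<in> S \<times> UNIV" for l
  proof (cases l)
    case (Pair s b)
    then have s: "s \<in> S" using l by simp
    have sY: "\<pi> (free_gen s) \<in> ?Y"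
      using s by (cases s) (simp_all add: \<pi>_free_gen)
    show ?thesis
    proof (cases b)
      case True
      then show ?thesis using sY Pair by (intro generate.incl) (simp add: free_gen_def)
    next
      case False
      have "[(s, False)] \<otimes>\<^bsub>Fr\<^esub> free_gen s = \<one>\<^bsub>Fr\<^esub>"
        by (simp add: free_group_def free_gen_def flip_def)
      moreover have "[(s, False)] \<in> carrier Fr" using s by (simp add: free_group_def)
      ultimately have "[l] = inv\<^bsub>Fr\<^esub> free_gen s"
        using s Pair False by (intro Fr.inv_equality[symmetric]) auto
      then have "\<pi> [l] = inv\<^bsub>P\<^esub> \<pi> (free_gen s)" using s by simp
      then show ?thesis using sY by (simp add: generate.inv)
    qed
  qed
  have word: "\<pi> w \<in> generate P ?Y" if "w \<in> carrier Fr" for w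
    using that
  proof (induction w)
    case Nil
    have "\<pi> [] = \<one>\<^bsub>P\<^esub>" using \<pi>.hom_one by (simp add: free_group_def)
    then show ?case using generate.one by metis
  next
    case (Cons l w)
    then have w: "w \<in> carrier Fr" and l: "l \<in> S \<times> UNIV" "[l] \<in> carrier Fr"
      by (auto simp: free_group_def dest: reduced_tl)
    have "push l w = l # w"
      using Cons.prems by (cases w) (auto simp: free_group_def)
    then have "l # w = [l] \<otimes>\<^bsub>Fr\<^esub> w" by (simp add: free_group_def)
    then have "\<pi> (l # w) = \<pi> [l] \<otimes>\<^bsub>P\<^esub> \<pi> w" using w l by simp
    then show ?case using letter[OF l(1)] Cons.IH[OF w] by (simp add: generate.eng)
  qed
  show "carrier P \<subseteq> generate P ?Y"
    unfolding FP_def presented_group_def carrier_FactGroup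
    using word by (auto simp: FP_def presented_group_def)
  show "generate P ?Y \<subseteq> carrier P"
    by (rule P.generate_incl[OF Y])
qed

lemma universal:
  assumes "group H" "\<tau> \<in> carrier H" "\<And>i. i \<in> {1..n} \<Longrightarrow> \<phi> i \<in> carrier H"
    and ff: "\<And>a b. (a, b) \<in> \<theta> \<Longrightarrow> commut H (\<phi> a) (\<phi> b) = \<one>\<^bsub>H\<^esub>"
    and xf: "\<And>i j. i \<in> {1..n} \<Longrightarrow> j \<in> {1..n} \<Longrightarrow> commut H (commut H \<tau> (\<phi> i)) (\<phi> j) = \<one>\<^bsub>H\<^esub>"
    and xx: "\<And>a b. (a, b) \<in> \<theta> \<Longrightarrow> commut H (commut H \<tau> (\<phi> a)) (commut H \<tau> (\<phi> b)) = \<one>\<^bsub>H\<^esub>"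
  obtains h where "h \<in> hom P H" "h t = \<tau>" "\<And>i. i \<in> {1..n} \<Longrightarrow> h (f i) = \<phi> i"
proof -
  interpret H: group H by fact
  define \<psi> where "\<psi> s = (case s of T \<Rightarrow> \<tau> | F i \<Rightarrow> \<phi> i)" for s
  have \<psi>: "\<psi> ` S \<subseteq> carrier H" using assms(2,3) by (auto simp: fp_gens_def \<psi>_def)
  interpret E: group_hom Fr H "eval_word H \<psi>"
    by (intro group_hom.intro group_hom_axioms.intro Fr.group_axioms H.group_axioms eval_word_hom \<psi>)
  have g: "eval_word H \<psi> (free_gen s) = \<psi> s" if "s \<in> S" for s
    using that \<psi> by (auto simp: eval_word_def eval_letter_def free_gen_def)
  have "eval_word H \<psi> r = \<one>\<^bsub>H\<^esub>" if "r \<in> R" for r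
  proof -
    from that consider
      (ff) a b where "(a, b) \<in> \<theta>" "r = commut Fr (free_gen (F a)) (free_gen (F b))"
    | (xf) i j where "i \<in> {1..n}" "j \<in> {1..n}" "r = commut Fr (commut Fr (free_gen T) (free_gen (F i))) (free_gen (F j))"
    | (xx) a b where "(a, b) \<in> \<theta>" "r = commut Fr (commut Fr (free_gen T) (free_gen (F a))) (commut Fr (free_gen T) (free_gen (F b)))"
      unfolding fp_relators_def Let_def by blast
    then show ?thesis
    proof cases
      case ff
      then show ?thesis using assms(4)[OF ff(1)] theta_range[OF ff(1)] by (simp add: E.hom_commut g \<psi>_def)
    next
      case xf
      then show ?thesis using assms(5)[OF xf(1,2)]
        by (simp add: E.hom_commut g \<psi>_def Fr.commut_closed)
    next
      case xx
      then show ?thesis using assms(6)[OF xx(1)] theta_range[OF xx(1)]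
        by (simp add: E.hom_commut g \<psi>_def Fr.commut_closed)
    qed
  qed
  from presented_group_universal[OF H.group_axioms \<psi> R_closed this]
  obtain h where h: "h \<in> hom (presented_group S R) H" "\<And>s. s \<in> S \<Longrightarrow> h (\<pi> (free_gen s)) = \<psi> s"
    by blast
  show ?thesis
  proof (rule that)
    show "h \<in> hom P H" using h(1) by (simp add: FP_def)
    show "h t = \<tau>" using h(2)[of T] by (simp add: \<pi>_free_gen \<psi>_def)
    show "h (f i) = \<phi> i" if "i \<in> {1..n}" for i
      using h(2)[of "F i"] that by (simp add: \<pi>_free_gen \<psi>_def)
  qed
qed

end

section \<open>Two power series representations\<close>

lemma fps_const_X_power: "fps_const c * (fps_X ^ k * a) = fps_X ^ k * (fps_const c * (a :: 'r::ring_1 fps))"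
  by (metis mult.assoc fps_mult_fps_X_power_commute)

lemma app_sum: "app (sum f A) \<phi> w = (\<Sum>k\<in>A. app (f k) \<phi> w)"
  by (induction A rule: infinite_finite_induct) simp_all

lemma leading_monomial: "leading d c (1 + fps_X ^ d * fps_const c)"
  by (auto simp: leading_def)

lemma (in group) commut_inv_eq_one:
  assumes "y \<in> carrier G" "z \<in> carrier G" "commut G y z = \<one>"
  shows "commut G y (inv z) = \<one>" "commut G (inv y) (inv z) = \<one>"
proof -
  have yz: "y \<otimes> z = z \<otimes> y" using assms by (simp add: commut_eq_one_iff)
  then have "y \<otimes> inv z = inv z \<otimes> y" using assms by (metis inv_closed inv_comm inv_solve_left inv_solve_right m_assoc m_closed)
  then show "commut G y (inv z) = \<one>" using assms by (simp add: commut_eq_one_iff)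
  have "inv y \<otimes> inv z = inv z \<otimes> inv y" using assms yz by (metis inv_mult_group)
  then show "commut G (inv y) (inv z) = \<one>" using assms by (simp add: commut_eq_one_iff)
qed

context formanek_procesi
begin

definition e_H :: "nat \<Rightarrow> fp_gen word set" where
  "e_H i = (if i \<in> {1..n} then f i else \<one>\<^bsub>P\<^esub>)"

definition wt_H :: "nat \<Rightarrow> nat" where
  "wt_H i = 1"

text \<open>Here the letter \<open>F i\<close> stands for \<open>x\<^sub>i = [t, f\<^sub>i]\<close>.\<close>

definition e_J :: "fp_gen \<Rightarrow> fp_gen word set" where
  "e_J s = (case s of T \<Rightarrow> t | F i \<Rightarrow> if i \<in> {1..n} then x i else \<one>\<^bsub>P\<^esub>)"

definition wt_J :: "fp_gen \<Rightarrow> nat" where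
  "wt_J s = (case s of T \<Rightarrow> 1 | F i \<Rightarrow> 2)"

definition \<Theta>_J :: "(fp_gen \<times> fp_gen) set" where
  "\<Theta>_J = {(F a, F b) |a b. (a, b) \<in> \<theta>}"

end

text \<open>The Magnus expansion of the right-angled Artin group, pulled back along the retraction
  that kills \<open>t\<close>; all relators containing \<open>t\<close> become trivial.\<close>

lemma (in formanek_procesi) magnus_H:
  obtains M where "magnus P {1..n} \<theta> e_H wt_H M"
    and "M t = 1"
proof -
  define \<phi> where "\<phi> i = 1 + fps_X ^ 1 * fps_const (letter_op {1..n} \<theta> i)" for i
  have \<phi>: "\<phi> i \<in> carrier fps_units" for i by (simp add: \<phi>_def)
  have 1: "commut fps_units 1 (\<phi> i) = 1" for i
    using U.commut_one(2)[OF \<phi>] by simp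
  have 2: "commut fps_units (1 :: nat op fps) 1 = 1" using U.commut_self[of 1] by simp
  have "\<phi> a * \<phi> b = \<phi> b * \<phi> a" if "(a, b) \<in> \<theta>" for a b
  proof -
    have "fps_const (letter_op {1..n} \<theta> a) * fps_const (letter_op {1..n} \<theta> b) =
        fps_const (letter_op {1..n} \<theta> b) * fps_const (letter_op {1..n} \<theta> a)"
      by (simp add: letter_op_commute[OF that])
    then show ?thesis
      by (simp add: \<phi>_def algebra_simps fps_const_X_power[of _ 1, simplified])
  qed
  then have ff: "commut fps_units (\<phi> a) (\<phi> b) = \<one>\<^bsub>fps_units\<^esub>" if "(a, b) \<in> \<theta>" for a b
    using \<phi> that by (subst U.commut_eq_one_iff) simp_all
  obtain M where M: "M \<in> hom P fps_units" "M t = 1" "\<And>i. i \<in> {1..n} \<Longrightarrow> M (f i) = \<phi> i"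
    by (rule universal[OF fps_units_group, of 1 \<phi>]) (use \<phi> 1 2 ff in auto)
  show ?thesis
  proof (rule that[of M], unfold_locales)
    fix i
    show "e_H i \<in> lower_central P (wt_H i)" by (simp add: e_H_def wt_H_def)
    show "leading (wt_H i) (letter_op {1..n} \<theta> i) (M (e_H i))"
      using M leading_monomial[of 1 "letter_op {1..n} \<theta> i"] leading_1
        hom_one[OF M(1) P.group_axioms fps_units_group]
      by (auto simp: \<phi>_def letter_op_def e_H_def wt_H_def)
  next
    fix i j assume "(i, j) \<in> \<theta>"
    then show "commut P (e_H i) (e_H j) = \<one>\<^bsub>P\<^esub>"
      using theta_range[of i j] commut_f_f by (simp add: e_H_def)
  qed (use M in \<open>auto simp: e_H_def wt_H_def\<close>)
qed

text \<open>On power series in the letters, \<open>sig i\<close> is the transpose of the substitution fixing every \<open>F j\<close> and sending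
  \<open>1 + z T\<close> to \<open>(1 + z T) (1 + z\<^sup>2 F i)\<close>; the third argument is the exponent of \<open>z\<close>.\<close>

fun sig :: "nat \<Rightarrow> fp_gen list \<Rightarrow> nat \<Rightarrow> (fp_gen list \<Rightarrow> int) \<Rightarrow> int" where
  "sig i [] k \<phi> = (if k = 0 then \<phi> [] else 0)"
| "sig i (F j # w) k \<phi> = sig i w k (\<lambda>v. \<phi> (F j # v))"
| "sig i (T # w) k \<phi> = sig i w k (\<lambda>v. \<phi> (T # v)) +
     (if k \<ge> 1 then sig i w (k - 1) (\<lambda>v. \<phi> (F i # v)) else 0) +
     (if k \<ge> 2 then sig i w (k - 2) (\<lambda>v. \<phi> (T # F i # v)) else 0)"

lemma sig_add: "sig i w k (\<lambda>v. \<phi> v + \<psi> v) = sig i w k \<phi> + sig i w k \<psi>"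
  by (induction i w k \<phi> arbitrary: \<psi> rule: sig.induct) simp_all

lemma sig_0: "sig i w 0 \<phi> = \<phi> w"
proof (induction w arbitrary: \<phi>)
  case (Cons a w)
  then show ?case by (cases a) simp_all
qed simp

lift_definition sig_op :: "nat \<Rightarrow> nat \<Rightarrow> fp_gen op" is "\<lambda>i k \<phi> w. sig i w k \<phi>"
  by (auto simp: Modules.additive_def fun_eq_iff plus_fun_def sig_add)

section \<open>Substitutions as power series of operators, and their descent to traces\<close>

definition sigma :: "nat \<Rightarrow> fp_gen op fps" where
  "sigma i = Abs_fps (sig_op i)"

abbreviation sh :: "fp_gen \<Rightarrow> fp_gen op fps" where
  "sh y \<equiv> fps_const (shift y)"

text \<open>With \<open>z = fps_X\<close>: expand \<open>(1 + z T) (1 + z\<^sup>2 F i)\<close>,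
  subtract 1 and divide by \<open>z\<close>.\<close>

definition subst_T :: "nat \<Rightarrow> fp_gen op fps" where
  "subst_T i = sh T + fps_X * sh (F i) + fps_X ^ 2 * (sh T * sh (F i))"

lemma sigma_nth: "fps_nth (sigma i) k = sig_op i k"
  by (simp add: sigma_def)

lemma sigma_nth_0: "fps_nth (sigma i) 0 = 1"
  by (rule op_eqI) (simp add: sigma_nth sig_op.rep_eq sig_0)

text \<open>This and \<open>sigma_T\<close> say that conjugation by the unit \<open>sigma i\<close>
  performs the substitution: it fixes each \<open>F j\<close> and replaces \<open>T\<close> by
  \<open>subst_T i\<close>.\<close>

lemma sigma_F: "sigma i * sh (F j) = sh (F j) * sigma i"
  by (rule fps_ext, rule op_eqI) (simp add: sigma_nth sig_op.rep_eq shift.rep_eq)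

lemma sigma_T: "sigma i * sh T = subst_T i * sigma i"
proof (rule fps_ext)
  fix k
  have "fps_nth (subst_T i * sigma i) k = shift T * sig_op i k +
      (if k = 0 then 0 else shift (F i) * sig_op i (k - 1)) +
      (if k < 2 then 0 else shift T * shift (F i) * sig_op i (k - 2))"
    by (simp only: subst_T_def distrib_right mult.assoc fps_add_nth fps_X_power_mult_nth
        fps_mult_left_const_nth fps_X_mult_nth sigma_nth)
  also have "\<dots> = sig_op i k * shift T"
    by (rule op_eqI, rule ext) (simp add: sig_op.rep_eq shift.rep_eq)
  finally show "fps_nth (sigma i * sh T) k = fps_nth (subst_T i * sigma i) k"
    by (simp add: sigma_nth)
qed

text \<open>Composition being diagrammatic, this says that \<open>u\<close> maps functions constant
  on traces to such functions.\<close>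

definition trace_stable :: "('x \<times> 'x) set \<Rightarrow> 'x op fps \<Rightarrow> bool" where
  "trace_stable \<Theta> u \<longleftrightarrow> fps_const (project \<Theta>) * u * fps_const (project \<Theta>) = fps_const (project \<Theta>) * u"

lemma trace_stable_1: "trace_stable \<Theta> 1"
  by (simp add: trace_stable_def project_idem)

lemma trace_stable_add: "trace_stable \<Theta> u \<Longrightarrow> trace_stable \<Theta> v \<Longrightarrow> trace_stable \<Theta> (u + v)"
  by (simp only: trace_stable_def distrib_left distrib_right)

lemma trace_stable_mult:
  assumes "trace_stable \<Theta> u" "trace_stable \<Theta> v"
  shows "trace_stable \<Theta> (u * v)"
proof -
  let ?e = "fps_const (project \<Theta>)"
  note u = assms(1)[unfolded trace_stable_def] and v = assms(2)[unfolded trace_stable_def]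
  have "?e * (u * v) * ?e = ?e * u * v * ?e" by (simp only: mult.assoc)
  also have "\<dots> = ?e * u * ?e * v * ?e" by (simp only: u)
  also have "\<dots> = ?e * u * (?e * v * ?e)" by (simp only: mult.assoc)
  also have "\<dots> = ?e * u * ?e * v" by (simp only: v) (simp only: mult.assoc)
  also have "\<dots> = ?e * (u * v)" by (simp only: u) (simp only: mult.assoc)
  finally show ?thesis by (simp only: trace_stable_def)
qed

lemma project_const_idem: "fps_const (project \<Theta>) * fps_const (project \<Theta>) = fps_const (project \<Theta>)"
  by (simp add: project_idem)

lemma trace_stable_left: "trace_stable \<Theta> u \<Longrightarrow>
    fps_const (project \<Theta>) * u * (fps_const (project \<Theta>) * v) = fps_const (project \<Theta>) * (u * v)"
  by (simp only: trace_stable_def mult.assoc[symmetric])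

lemma trace_stable_X: "trace_stable \<Theta> (fps_X ^ k)"
proof -
  let ?e = "fps_const (project \<Theta>)"
  have "?e * fps_X ^ k * ?e = fps_X ^ k * (?e * ?e)"
    by (simp only: fps_mult_fps_X_power_commute[symmetric] mult.assoc)
  also have "\<dots> = ?e * fps_X ^ k"
    by (simp only: project_const_idem fps_mult_fps_X_power_commute)
  finally show ?thesis by (simp only: trace_stable_def)
qed

lemma trace_stable_shift: "trace_stable \<Theta> (fps_const (shift y))"
  by (simp add: trace_stable_def project_shift)

text \<open>Commutation relations involve only letters \<open>F j\<close>, which \<open>sig\<close>
  copies unchanged, so a swap in the input becomes a swap in the output.\<close>

lemma trace_stable_sigma: "trace_stable \<Theta> (sigma i)" if \<Theta>: "\<Theta> \<subseteq> range F \<times> range F"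
proof -
  have *: "sig i (u @ a # b # v) k \<phi> = sig i (u @ b # a # v) k \<phi>"
    if inv: "\<And>u v. \<phi> (u @ a # b # v) = \<phi> (u @ b # a # v)" and ab: "(a, b) \<in> \<Theta>" for a b u v k \<phi>
    using inv
  proof (induction u arbitrary: k \<phi>)
    case Nil
    then show ?case using ab \<Theta> Nil[of "[]"] by (auto simp del: append_Cons)
  next
    case (Cons y u)
    have 1: "\<phi> (ys @ u @ a # b # v) = \<phi> (ys @ u @ b # a # v)" for ys u v
      using Cons.prems[of "ys @ u"] by simp
    have 2: "sig i (u @ a # b # v) k (\<lambda>v. \<phi> (ys @ v)) = sig i (u @ b # a # v) k (\<lambda>v. \<phi> (ys @ v))" for k ys
      by (rule Cons.IH) (rule 1)
    show ?case
      using 2[of _ "[T]"] 2[of _ "[F i]"] 2[of _ "[T, F i]"] 2[of _ "[y]"]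
      by (cases y) simp_all
  qed
  have "app (fps_nth (sigma i) k) (app (project \<Theta>) \<phi>) (normal_word \<Theta> w) =
      app (fps_nth (sigma i) k) (app (project \<Theta>) \<phi>) w" for k \<phi> w
  proof (rule sym, rule equivclp_invariant[OF normal_word_equiv])
    fix v w assume "swap \<Theta> v w"
    then show "app (fps_nth (sigma i) k) (app (project \<Theta>) \<phi>) v = app (fps_nth (sigma i) k) (app (project \<Theta>) \<phi>) w"
      by cases (auto simp: sigma_nth sig_op.rep_eq project.rep_eq intro!: * arg_cong[OF normal_word_swap])
  qed
  then show ?thesis
    unfolding trace_stable_def by (intro fps_ext op_eqI) (simp add: project.rep_eq[abs_def])
qed

text \<open>Projecting the whole series would spoil the constant term 1, so only the remainder is
  projected. On stable series this is multiplicative, by \<open>hat_mult\<close>.\<close>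

definition hat :: "('x \<times> 'x) set \<Rightarrow> 'x op fps \<Rightarrow> 'x op fps" where
  "hat \<Theta> u = 1 + fps_const (project \<Theta>) * (u - 1)"

lemma hat_nth_0: "fps_nth u 0 = 1 \<Longrightarrow> fps_nth (hat \<Theta> u) 0 = 1"
  by (simp add: hat_def)

lemma hat_mult:
  assumes "trace_stable \<Theta> u"
  shows "hat \<Theta> u * hat \<Theta> v = hat \<Theta> (u * v)"
proof -
  let ?e = "fps_const (project \<Theta>)"
  have e: "?e * ?e = ?e" by (simp add: project_idem)
  have "?e * (u - 1) * ?e = ?e * (u - 1)"
    using assms by (simp only: trace_stable_def right_diff_distrib left_diff_distrib mult_1_right e)
  then have "trace_stable \<Theta> (u - 1)" by (simp only: trace_stable_def)
  then have "?e * (u - 1) * (?e * (v - 1)) = ?e * ((u - 1) * (v - 1))" by (rule trace_stable_left)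
  then have "hat \<Theta> u * hat \<Theta> v = 1 + ?e * (u - 1) + ?e * (v - 1) + ?e * ((u - 1) * (v - 1))"
    by (simp add: hat_def distrib_left distrib_right add.assoc)
  also have "\<dots> = hat \<Theta> (u * v)"
    by (simp add: hat_def algebra_simps)
  finally show ?thesis .
qed

lemma hat_cong:
  "fps_const (project \<Theta>) * u = fps_const (project \<Theta>) * v \<Longrightarrow> hat \<Theta> u = hat \<Theta> v"
  by (simp add: hat_def right_diff_distrib)

lemma project_shift_commute:
  "(a, b) \<in> \<Theta> \<Longrightarrow> project \<Theta> * (shift a * shift b) = project \<Theta> * (shift b * shift a)"
  using normal_word_swap[of a b \<Theta> "[]"]
  by (auto simp: project.rep_eq shift.rep_eq intro!: op_eqI)

text \<open>The two composite substitutions send \<open>T\<close> to series that differ in the order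
  of \<open>F a\<close> and \<open>F b\<close>, so equality can be expected only after
  projection.\<close>

lemma project_sigma_commute:
  assumes \<Theta>: "\<Theta> \<subseteq> range F \<times> range F" and ab: "(F a, F b) \<in> \<Theta>"
  shows "fps_const (project \<Theta>) * (sigma a * sigma b) = fps_const (project \<Theta>) * (sigma b * sigma a)"
proof -
  let ?e = "fps_const (project \<Theta>)"
  have X: "u * (fps_X ^ k * v) = fps_X ^ k * (u * v)" for k and u v :: "fp_gen op fps"
    by (simp only: fps_mult_fps_X_power_commute[of k] mult.assoc)
  note X1 = X[where k = 1, simplified]
  define L where "L i = sh (F i)" for i
  \<comment> \<open>The image of \<open>T\<close> under the composite:
    \<open>(1 + z T) (1 + z\<^sup>2 F a) (1 + z\<^sup>2 F b)\<close>, less 1 and divided by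
    \<open>z\<close>.\<close>
  define D where "D a b = subst_T a + fps_X * L b + fps_X ^ 2 * (subst_T a * L b)" for a b
  have sL: "sigma i * L j = L j * sigma i" for i j by (simp only: L_def sigma_F)
  have D: "sigma a * sigma b * sh T = D a b * (sigma a * sigma b)" for a b
  proof -
    have "sigma a * subst_T b = sigma a * sh T + fps_X * (sigma a * L b) + fps_X ^ 2 * (sigma a * sh T * L b)"
      by (simp only: subst_T_def L_def distrib_left X X1 mult.assoc)
    also have "\<dots> = subst_T a * sigma a + fps_X * (L b * sigma a) + fps_X ^ 2 * (subst_T a * (sigma a * L b))"
      by (simp only: sigma_T sL mult.assoc)
    also have "\<dots> = D a b * sigma a"
      by (simp only: sL D_def distrib_right mult.assoc)
    finally have 1: "sigma a * subst_T b = D a b * sigma a" .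
    have "sigma a * sigma b * sh T = sigma a * subst_T b * sigma b"
      by (simp only: mult.assoc sigma_T)
    also have "\<dots> = D a b * (sigma a * sigma b)"
      by (simp only: 1 mult.assoc)
    finally show ?thesis .
  qed
  have gD: "trace_stable \<Theta> (D a b)" for a b
    unfolding D_def subst_T_def L_def
    by (intro trace_stable_add trace_stable_mult trace_stable_X trace_stable_X[of _ 1, simplified] trace_stable_shift)
  have eF: "?e * (L a * L b) = ?e * (L b * L a)"
    by (simp add: L_def project_shift_commute[OF ab])
  have "?e * (sh T * (L a * L b)) = ?e * sh T * (?e * (L a * L b))"
    by (simp only: trace_stable_left[OF trace_stable_shift])
  then have eTF: "?e * (sh T * (L a * L b)) = ?e * (sh T * (L b * L a))"
    by (simp only: eF trace_stable_left[OF trace_stable_shift])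
  \<comment> \<open>The terms of \<open>D a b\<close> that are visibly symmetric; the other two
    contain the product \<open>L a * L b\<close>.\<close>
  define C where "C a b = sh T + (fps_X * L a + fps_X * L b) +
      (fps_X ^ 2 * (sh T * L a) + fps_X ^ 2 * (sh T * L b))" for a b
  have "D a b = C a b + fps_X ^ 2 * (fps_X * (L a * L b)) + fps_X ^ 2 * (fps_X ^ 2 * (sh T * (L a * L b)))" for a b
    by (simp only: D_def C_def subst_T_def L_def[symmetric] distrib_left distrib_right mult.assoc add_ac)
  then have DC: "?e * D a b = ?e * C a b + fps_X ^ 2 * (fps_X * (?e * (L a * L b))) +
      fps_X ^ 2 * (fps_X ^ 2 * (?e * (sh T * (L a * L b))))" for a b
    by (simp only: distrib_left X[of ?e] X1[of ?e])
  have "C a b = C b a" by (simp only: C_def add_ac)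
  then have eD: "?e * D a b = ?e * D b a"
    by (simp only: DC eF eTF)
  define \<delta> where "\<delta> = sigma a * sigma b - sigma b * sigma a"
  define \<Delta> where "\<Delta> = ?e * \<delta>"
  have \<Delta>F: "\<Delta> * sh (F j) = ?e * sh (F j) * \<Delta>" for j
  proof -
    have "sigma a * sigma b * sh (F j) = sigma a * (sh (F j) * sigma b)" for a b
      by (simp only: mult.assoc sigma_F)
    also have "sigma a * (sh (F j) * sigma b) = sh (F j) * (sigma a * sigma b)" for a b
      by (simp only: mult.assoc[symmetric] sigma_F)
    finally have "\<delta> * sh (F j) = sh (F j) * \<delta>"
      by (simp only: \<delta>_def left_diff_distrib right_diff_distrib)
    then show ?thesis
      by (simp only: \<Delta>_def trace_stable_left[OF trace_stable_shift]) (simp only: mult.assoc)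
  qed
  have \<Delta>T: "\<Delta> * sh T = ?e * D a b * \<Delta>"
  proof -
    have "\<Delta> * sh T = ?e * (\<delta> * sh T)" by (simp only: \<Delta>_def mult.assoc)
    also have "\<dots> = ?e * D a b * (sigma a * sigma b) - ?e * D b a * (sigma b * sigma a)"
      by (simp only: \<delta>_def left_diff_distrib right_diff_distrib D) (simp only: mult.assoc)
    also have "\<dots> = ?e * D a b * \<delta>"
      by (simp only: eD \<delta>_def right_diff_distrib)
    also have "\<dots> = ?e * D a b * \<Delta>"
      by (simp only: \<Delta>_def trace_stable_left[OF gD]) (simp only: mult.assoc)
    finally show ?thesis .
  qed
  \<comment> \<open>By the two intertwining rules a first letter passes to the other side of
    \<open>\<Delta>\<close>, which leaves values at the shorter word. At \<open>[]\<close> both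
    composites reduce to their constant term and cancel.\<close>
  have "app (fps_nth \<Delta> m) \<phi> w = 0" for m \<phi> w
  proof (induction w arbitrary: m \<phi>)
    case Nil
    have "app (fps_nth (sigma a * sigma b) m) \<phi> [] = (if m = 0 then \<phi> [] else 0)" for a b m \<phi>
    proof (cases "m = 0")
      case True
      then show ?thesis by (simp add: sigma_nth_0)
    next
      case False
      then have "app (sig_op a k * sig_op b (m - k)) \<phi> [] = 0" if "k \<in> {0..m}" for k
        using that by (cases "k = m") (simp_all add: sig_op.rep_eq)
      with False show ?thesis by (simp add: fps_mult_nth sigma_nth app_sum)
    qed
    then show ?case by (simp add: \<Delta>_def \<delta>_def)
  next
    case (Cons y w)
    have *: "app (fps_nth (u * \<Delta>) m) \<phi> w = 0" for u
      by (simp add: fps_mult_nth app_sum Cons.IH)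
    have "app (fps_nth \<Delta> m) \<phi> (y # w) = app (fps_nth (\<Delta> * sh y) m) \<phi> w"
      by (simp add: shift.rep_eq)
    then show ?case by (cases y) (simp_all add: \<Delta>F \<Delta>T * Cons.IH)
  qed
  then have "\<Delta> = 0" by (intro fps_ext op_eqI) (simp add: fun_eq_iff)
  then show ?thesis by (simp add: \<Delta>_def \<delta>_def right_diff_distrib)
qed

text \<open>The substitutions are units of the same ring as the letters, so the expansion of
  \<open>t\<close> and the \<open>x i\<close> extends to the elements \<open>f i\<close>. The
  relators become commutation rules between the series \<open>\<xi> i\<close> and
  \<open>sigma j\<close>.\<close>

lemma (in formanek_procesi) magnus_J:
  obtains M where "magnus P S \<Theta>_J e_J wt_J M"
proof -
  define A where "A = insert T (F ` {1..n})"
  define \<Theta> where "\<Theta> = \<Theta>_J"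
  define \<tau> where "\<tau> = 1 + fps_X * sh T"
  define \<xi> where "\<xi> i = 1 + fps_X ^ 2 * sh (F i)" for i
  let ?h = "hat \<Theta>"
  have range: "\<Theta> \<subseteq> range F \<times> range F" by (auto simp: \<Theta>_def \<Theta>_J_def)
  have trace_stable: "trace_stable \<Theta> \<tau>" "trace_stable \<Theta> (\<xi> i)" "trace_stable \<Theta> (sigma i)" for i
    unfolding \<tau>_def \<xi>_def
    by (intro trace_stable_add trace_stable_1 trace_stable_mult trace_stable_X trace_stable_X[of _ 1, simplified] trace_stable_shift trace_stable_sigma range)+
  have U: "?h \<tau> \<in> carrier fps_units" "?h (\<xi> i) \<in> carrier fps_units" "?h (sigma i) \<in> carrier fps_units" for i
    by (simp_all add: hat_nth_0 \<tau>_def \<xi>_def sigma_nth_0 fps_X_power_mult_nth)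
  have X: "u * (fps_X ^ k * v) = fps_X ^ k * (u * v)" for k and u v :: "fp_gen op fps"
    by (simp only: fps_mult_fps_X_power_commute[of k] mult.assoc)
  note X1 = X[where k = 1, simplified]
  have XX: "fps_X * (fps_X * v) = fps_X ^ 2 * v" for v :: "fp_gen op fps"
    by (simp only: power2_eq_square mult.assoc)
  \<comment> \<open>The substitution applied to \<open>1 + z T\<close>, written as an intertwining
    relation.\<close>
  have "sigma i * \<tau> = \<tau> * \<xi> i * sigma i" for i
  proof -
    have "sigma i * \<tau> = sigma i + fps_X * (subst_T i * sigma i)"
      by (simp only: \<tau>_def distrib_left mult_1_right X1 sigma_T)
    also have "\<dots> = \<tau> * \<xi> i * sigma i"
      by (simp only: \<tau>_def \<xi>_def subst_T_def distrib_left distrib_right mult_1_left mult_1_right mult.assoc X[of "sh T"] XX add_ac)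
    finally show ?thesis .
  qed
  then have st: "?h (sigma i) * ?h \<tau> = ?h \<tau> * ?h (\<xi> i) * ?h (sigma i)" for i
    by (simp only: hat_mult trace_stable trace_stable_mult)
  have "sigma i * \<xi> j = \<xi> j * sigma i" for i j
    by (simp only: \<xi>_def distrib_left distrib_right mult_1_left mult_1_right X sigma_F mult.assoc)
  then have sx: "?h (sigma i) * ?h (\<xi> j) = ?h (\<xi> j) * ?h (sigma i)" for i j
    by (simp only: hat_mult trace_stable)
  have ss: "?h (sigma a) * ?h (sigma b) = ?h (sigma b) * ?h (sigma a)" if "(a, b) \<in> \<theta>" for a b
  proof -
    have "(F a, F b) \<in> \<Theta>" using that by (auto simp: \<Theta>_def \<Theta>_J_def)
    from hat_cong[OF project_sigma_commute[OF range this]] show ?thesis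
      by (simp only: hat_mult trace_stable)
  qed
  have lT: "?h \<tau> = 1 + fps_X ^ 1 * fps_const (letter_op A \<Theta> T)"
    by (simp add: hat_def \<tau>_def letter_op_def A_def X1)
  have lF: "?h (\<xi> i) = 1 + fps_X ^ 2 * fps_const (letter_op A \<Theta> (F i))" if "i \<in> {1..n}" for i
    using that by (simp add: hat_def \<xi>_def letter_op_def A_def X)
  have xx: "?h (\<xi> a) * ?h (\<xi> b) = ?h (\<xi> b) * ?h (\<xi> a)" if ab: "(a, b) \<in> \<theta>" for a b
  proof -
    let ?a = "fps_const (letter_op A \<Theta> (F a))" and ?b = "fps_const (letter_op A \<Theta> (F b))"
    have "(F a, F b) \<in> \<Theta>" using that by (auto simp: \<Theta>_def \<Theta>_J_def)
    from letter_op_commute[OF this] have comm: "?a * ?b = ?b * ?a" by simp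
    have e: "(1 + fps_X ^ 2 * u) * (1 + fps_X ^ 2 * v) = 1 + (fps_X ^ 2 * u + fps_X ^ 2 * v) + fps_X ^ 2 * (fps_X ^ 2 * (u * v))"
      for u v :: "fp_gen op fps"
      by (simp only: distrib_left distrib_right mult_1_left mult_1_right X[of u] mult.assoc add_ac)
    have "a \<in> {1..n}" "b \<in> {1..n}" using theta_range[OF ab] by blast+
    then show ?thesis
      by (simp only: lF e comm add.commute[of "fps_X ^ 2 * ?a"])
  qed
  \<comment> \<open>The inverse is dictated by the commutator convention:
    \<open>[t, f\<^sub>i]\<close> then becomes the inverse of \<open>\<tau>\<close> times the
    conjugate of \<open>\<tau>\<close> by \<open>sigma i\<close>, which is
    \<open>\<xi> i\<close>.\<close>
  define \<phi> where "\<phi> i = inv\<^bsub>fps_units\<^esub> ?h (sigma i)" for i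
  have \<phi>: "\<phi> i \<in> carrier fps_units" for i unfolding \<phi>_def by (rule U.inv_closed[OF U(3)])
  have tf: "commut fps_units (?h \<tau>) (\<phi> i) = ?h (\<xi> i)" for i
  proof -
    let ?s = "?h (sigma i)"
    have "commut fps_units (?h \<tau>) (\<phi> i) = inv\<^bsub>fps_units\<^esub> ?h \<tau> \<otimes>\<^bsub>fps_units\<^esub> (?s \<otimes>\<^bsub>fps_units\<^esub> ?h \<tau>) \<otimes>\<^bsub>fps_units\<^esub> inv\<^bsub>fps_units\<^esub> ?s"
      unfolding commut_def \<phi>_def by (simp only: U.inv_inv[OF U(3)] U.m_assoc U.inv_closed U.m_closed U)
    also have "?s \<otimes>\<^bsub>fps_units\<^esub> ?h \<tau> = ?h \<tau> \<otimes>\<^bsub>fps_units\<^esub> ?h (\<xi> i) \<otimes>\<^bsub>fps_units\<^esub> ?s"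
      by (simp only: fps_units_simps st)
    also have "inv\<^bsub>fps_units\<^esub> ?h \<tau> \<otimes>\<^bsub>fps_units\<^esub> (?h \<tau> \<otimes>\<^bsub>fps_units\<^esub> ?h (\<xi> i) \<otimes>\<^bsub>fps_units\<^esub> ?s) \<otimes>\<^bsub>fps_units\<^esub> inv\<^bsub>fps_units\<^esub> ?s = ?h (\<xi> i)"
      by (simp only: U.m_assoc U.inv_closed U.m_closed U U.inv_mult_cancel U.r_inv U.r_one)
    finally show ?thesis .
  qed
  obtain M where M: "M \<in> hom P fps_units" "M t = ?h \<tau>" "\<And>i. i \<in> {1..n} \<Longrightarrow> M (f i) = \<phi> i"
  proof (rule universal[OF fps_units_group, of "?h \<tau>" \<phi>])
    show "commut fps_units (\<phi> a) (\<phi> b) = \<one>\<^bsub>fps_units\<^esub>" if "(a, b) \<in> \<theta>" for a b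
      unfolding \<phi>_def
      by (intro U.commut_inv_eq_one U) (subst U.commut_eq_one_iff[OF U(3) U(3)], simp only: fps_units_simps ss[OF that])
    show "commut fps_units (commut fps_units (?h \<tau>) (\<phi> i)) (\<phi> j) = \<one>\<^bsub>fps_units\<^esub>" for i j
      unfolding tf unfolding \<phi>_def
      by (intro U.commut_inv_eq_one U) (subst U.commut_eq_one_iff[OF U(2) U(3)], simp only: fps_units_simps sx)
    show "commut fps_units (commut fps_units (?h \<tau>) (\<phi> a)) (commut fps_units (?h \<tau>) (\<phi> b)) = \<one>\<^bsub>fps_units\<^esub>"
      if "(a, b) \<in> \<theta>" for a b
      unfolding tf by (subst U.commut_eq_one_iff[OF U(2) U(2)], simp only: fps_units_simps xx[OF that])
  qed (use U(1) \<phi> in blast)+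
  interpret M: group_hom P fps_units M
    by (intro group_hom.intro group_hom_axioms.intro P.group_axioms fps_units_group M)
  have Mx: "M (x i) = ?h (\<xi> i)" if "i \<in> {1..n}" for i
    using that by (simp only: x_def M.hom_commut t_closed f_closed M tf)
  have x2: "x i \<in> lower_central P 2" if "i \<in> {1..n}" for i
    using P.commut_\<gamma>_carrier[of 1 t "f i"] that by (simp add: x_def numeral_2_eq_2)
  have "magnus P A \<Theta> e_J wt_J M"
  proof unfold_locales
    fix s
    show "wt_J s \<ge> 1" by (simp add: wt_J_def split: fp_gen.split)
    show "e_J s \<in> lower_central P (wt_J s)"
      using x2 P.\<gamma>_one by (simp add: e_J_def wt_J_def split: fp_gen.split)
    show "e_J s = \<one>\<^bsub>P\<^esub>" if "s \<notin> A" using that by (auto simp: A_def e_J_def split: fp_gen.split)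
    show "leading (wt_J s) (letter_op A \<Theta> s) (M (e_J s))"
    proof (cases s)
      case T
      then show ?thesis using leading_monomial[of 1 "letter_op A \<Theta> T"] by (simp add: M lT e_J_def wt_J_def)
    next
      case (F i)
      show ?thesis
      proof (cases "i \<in> {1..n}")
        case True
        have "leading 2 (letter_op A \<Theta> (F i)) (M (x i))"
          unfolding Mx[OF True] lF[OF True] by (rule leading_monomial)
        with True F show ?thesis by (simp add: e_J_def wt_J_def)
      next
        case False
        then have "letter_op A \<Theta> s = 0" by (auto simp: letter_op_def A_def F)
        moreover have "e_J s = \<one>\<^bsub>P\<^esub>" using False by (auto simp: e_J_def F)
        ultimately show ?thesis using leading_1[of 2] by (simp add: wt_J_def F)
      qed
    qed
  next
    fix r s assume "(r, s) \<in> \<Theta>"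
    then obtain a b where ab: "r = F a" "s = F b" "(a, b) \<in> \<theta>" by (auto simp: \<Theta>_def \<Theta>_J_def)
    with theta_range[OF ab(3)] commut_x_x[OF ab(3)] show "commut P (e_J r) (e_J s) = \<one>\<^bsub>P\<^esub>"
      by (simp add: e_J_def)
  qed (auto simp: A_def M)
  then show ?thesis unfolding A_def \<Theta>_def fp_gens_def[symmetric] by (rule that)
qed

section \<open>Finitely generated torsion-free abelian groups\<close>

text \<open>A nonzero relation \<open>p\<close> among finitely many generators is shrunk by elementary
  transformations until it involves a single generator, which is then trivial by
  torsion-freeness and can be omitted.\<close>

lemma (in comm_group) drop_generator:
  fixes I :: "'i set"
  assumes tf: "\<And>x (m :: int). x \<in> carrier G \<Longrightarrow> m \<noteq> 0 \<Longrightarrow> x [^] m = \<one> \<Longrightarrow> x = \<one>"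
    and I: "finite I" and h: "h \<in> hom (free_Abelian_group I) G"
    and surj: "h ` carrier (free_Abelian_group I) = carrier G"
    and p: "p \<noteq> 0" "Poly_Mapping.keys p \<subseteq> I" "h p = \<one>"
  shows "\<exists>i\<in>I. \<exists>h'. h' \<in> hom (free_Abelian_group (I - {i})) G \<and>
    h' ` carrier (free_Abelian_group (I - {i})) = carrier G"
  using h surj p
proof (induction "\<Sum>i\<in>I. nat \<bar>Poly_Mapping.lookup p i\<bar>" arbitrary: h p rule: less_induct)
  case less
  let ?l = "Poly_Mapping.lookup"
  interpret h: group_hom "free_Abelian_group I" G h
    by (intro group_hom.intro group_hom_axioms.intro group_free_Abelian_group is_group less.prems)
  have hadd: "h (a + b) = h a \<otimes> h b" if "Poly_Mapping.keys a \<subseteq> I" "Poly_Mapping.keys b \<subseteq> I" for a b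
    using h.hom_mult[of a b] that by simp
  have hc: "h a \<in> carrier G" if "Poly_Mapping.keys a \<subseteq> I" for a
    using h.hom_closed[of a] that by simp
  obtain i where i: "i \<in> Poly_Mapping.keys p"
    using less.prems(3) by (metis keys_eq_empty ex_in_conv)
  show ?case
  proof (cases "Poly_Mapping.keys p = {i}")
    case True
    have iI: "i \<in> I" using i less.prems(4) by blast
    have peq: "frag_cmul (?l p i) (frag_of i) = p"
    proof (rule poly_mapping_eqI)
      fix k
      show "?l (frag_cmul (?l p i) (frag_of i)) k = ?l p k"
      proof (cases "k = i")
        case False
        then have "k \<notin> Poly_Mapping.keys p" using True by simp
        then show ?thesis using False by (simp add: in_keys_iff)
      qed simp
    qed
    have pow: "h (frag_cmul k (frag_of i)) = h (frag_of i) [^] k" for k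
      using h.hom_int_pow[of "frag_of i" k] iI by simp
    have "h (frag_of i) [^] ?l p i = \<one>"
      unfolding pow[symmetric] peq by (rule less.prems(5))
    moreover have "h (frag_of i) \<in> carrier G" using h.hom_closed[of "frag_of i"] iI by simp
    moreover have "?l p i \<noteq> 0" using i by (simp add: in_keys_iff)
    ultimately have h1: "h (frag_of i) = \<one>"
      using tf[of "h (frag_of i)" "?l p i"] by blast
    have "h ` carrier (free_Abelian_group (I - {i})) = carrier G"
    proof
      show "h ` carrier (free_Abelian_group (I - {i})) \<subseteq> carrier G"
        by (auto intro!: hc)
      show "carrier G \<subseteq> h ` carrier (free_Abelian_group (I - {i}))"
      proof
        fix y assume "y \<in> carrier G"
        then have "y \<in> h ` carrier (free_Abelian_group I)" by (simp only: less.prems(2))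
        then obtain q where q: "Poly_Mapping.keys q \<subseteq> I" "y = h q" by auto
        let ?q = "q - frag_cmul (?l q i) (frag_of i)"
        have k: "Poly_Mapping.keys ?q \<subseteq> I - {i}"
        proof
          fix k assume "k \<in> Poly_Mapping.keys ?q"
          then have "?l ?q k \<noteq> 0" by (simp add: in_keys_iff)
          then have "k \<noteq> i" "?l q k \<noteq> 0" by (auto simp: lookup_minus split: if_splits)
          then show "k \<in> I - {i}" using q(1) by (auto simp: in_keys_iff)
        qed
        have c: "h (frag_cmul (?l q i) (frag_of i)) = \<one>"
          by (simp add: pow h1)
        have "h q = h (?q + frag_cmul (?l q i) (frag_of i))" by simp
        also have "\<dots> = h ?q \<otimes> h (frag_cmul (?l q i) (frag_of i))"
          by (rule hadd) (use k iI in \<open>auto simp: keys_cmul_iff\<close>)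
        also have "\<dots> = h ?q" unfolding c using k by (intro r_one hc) blast
        finally show "y \<in> h ` carrier (free_Abelian_group (I - {i}))"
          using q k by auto
      qed
    qed
    moreover have "h \<in> hom (free_Abelian_group (I - {i})) G"
      by (auto simp: hom_def intro!: hc hadd)
    ultimately show ?thesis using iI by blast
  next
    case False
    with i obtain j' where j': "j' \<in> Poly_Mapping.keys p" "j' \<noteq> i" by blast
    obtain i j where ij: "i \<in> Poly_Mapping.keys p" "j \<in> Poly_Mapping.keys p" "i \<noteq> j" "\<bar>?l p j\<bar> \<le> \<bar>?l p i\<bar>"
    proof (cases "\<bar>?l p j'\<bar> \<le> \<bar>?l p i\<bar>")
      case True
      then show ?thesis using that[of i j'] i j' by auto
    next
      case False
      then show ?thesis using that[of j' i] i j' by auto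
    qed
    have I2: "i \<in> I" "j \<in> I" using ij less.prems(4) by blast+
    \<comment> \<open>The sign for which subtracting \<open>s\<close> times the \<open>j\<close>-th
      coefficient shrinks the \<open>i\<close>-th in absolute value.\<close>
    define s where "s = sgn (?l p i) * sgn (?l p j)"
    \<comment> \<open>A change of basis \<open>\<Phi>\<close> and its inverse \<open>\<Psi>\<close>:
      replacing \<open>h\<close> by its composite with \<open>\<Phi>\<close> and \<open>p\<close> by
      \<open>\<Psi> p\<close> preserves the relation.\<close>
    define \<Phi> where "\<Phi> q = q + frag_cmul (s * ?l q j) (frag_of i)" for q :: "'i \<Rightarrow>\<^sub>0 int"
    define \<Psi> where "\<Psi> q = q - frag_cmul (s * ?l q j) (frag_of i)" for q :: "'i \<Rightarrow>\<^sub>0 int"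
    have kc: "Poly_Mapping.keys (frag_cmul k (frag_of i)) \<subseteq> I" for k
      using I2 by (auto simp: keys_cmul_iff)
    have k\<Phi>: "Poly_Mapping.keys (\<Phi> q) \<subseteq> I" if "Poly_Mapping.keys q \<subseteq> I" for q
      unfolding \<Phi>_def using keys_add[of q "frag_cmul (s * ?l q j) (frag_of i)"] that kc by blast
    have k\<Psi>: "Poly_Mapping.keys (\<Psi> q) \<subseteq> I" if "Poly_Mapping.keys q \<subseteq> I" for q
      unfolding \<Psi>_def by (rule keys_diff_subset[OF that kc])
    have \<Phi>\<Psi>: "\<Phi> (\<Psi> q) = q" for q
      using ij(3) by (simp add: \<Phi>_def \<Psi>_def lookup_minus lookup_single)
    have \<Phi>_add: "\<Phi> (a + b) = \<Phi> a + \<Phi> b" for a b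
      by (simp add: \<Phi>_def lookup_add distrib_left frag_cmul_distrib)
    let ?h = "\<lambda>q. h (\<Phi> q)" and ?p = "\<Psi> p"
    have li: "\<bar>?l ?p i\<bar> = \<bar>?l p i\<bar> - \<bar>?l p j\<bar>"
    proof -
      have "?l ?p i = ?l p i - s * ?l p j" by (simp add: \<Psi>_def lookup_minus)
      also have "\<dots> = sgn (?l p i) * (\<bar>?l p i\<bar> - \<bar>?l p j\<bar>)"
        by (simp add: s_def right_diff_distrib mult.assoc sgn_mult_abs abs_sgn[symmetric] mult_sgn_abs mult.commute[of "sgn (?l p j)"])
      finally show ?thesis
        using ij by (simp add: abs_mult in_keys_iff)
    qed
    have lk: "?l ?p k = ?l p k" if "k \<noteq> i" for k
      using that by (simp add: \<Psi>_def lookup_minus lookup_single)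
    show ?thesis
    proof (rule less.hyps)
      have "nat \<bar>?l ?p i\<bar> < nat \<bar>?l p i\<bar>" using li ij by (simp add: in_keys_iff)
      moreover have "nat \<bar>?l ?p k\<bar> \<le> nat \<bar>?l p k\<bar>" for k
        using li lk[of k] by (cases "k = i") auto
      ultimately show "(\<Sum>i\<in>I. nat \<bar>?l ?p i\<bar>) < (\<Sum>i\<in>I. nat \<bar>?l p i\<bar>)"
        using I I2 by (intro sum_strict_mono_ex1) auto
      show "?h \<in> hom (free_Abelian_group I) G"
        by (auto simp: hom_def \<Phi>_add hc hadd k\<Phi>)
      show "?h ` carrier (free_Abelian_group I) = carrier G"
      proof
        show "?h ` carrier (free_Abelian_group I) \<subseteq> carrier G"
          by (auto simp: hc k\<Phi>)
        show "carrier G \<subseteq> ?h ` carrier (free_Abelian_group I)"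
        proof
          fix y assume "y \<in> carrier G"
        then have "y \<in> h ` carrier (free_Abelian_group I)" by (simp only: less.prems(2))
          then obtain q where q: "Poly_Mapping.keys q \<subseteq> I" "y = h q" by auto
          then have "y = ?h (\<Psi> q)" "Poly_Mapping.keys (\<Psi> q) \<subseteq> I" by (simp_all add: \<Phi>\<Psi> k\<Psi>)
          then show "y \<in> ?h ` carrier (free_Abelian_group I)" by auto
        qed
      qed
      show "?p \<noteq> 0" using lk[of j] ij by (auto simp: in_keys_iff)
      show "Poly_Mapping.keys ?p \<subseteq> I" by (rule k\<Psi>) fact
      show "?h ?p = \<one>" by (simp add: \<Phi>\<Psi> less.prems)
    qed
  qed
qed

text \<open>Induction on the number of generators: a nonzero relation lets one be dropped, and in
  its absence the map from the free abelian group is an isomorphism.\<close>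

theorem (in comm_group) free_if_torsion_free:
  assumes tf: "\<And>x (m :: nat). x \<in> carrier G \<Longrightarrow> m > 0 \<Longrightarrow> x [^] m = \<one> \<Longrightarrow> x = \<one>"
    and Y: "finite Y" "Y \<subseteq> carrier G" "carrier G = generate G Y"
  shows "free_abelian_of_finite_rank G"
proof -
  have tf': "x = \<one>" if x: "x \<in> carrier G" "m \<noteq> 0" "x [^] m = \<one>" for x and m :: int
  proof -
    obtain k where k: "m = int k \<or> m = - int k" using int_cases2[of m] by blast
    then have "x [^] k = \<one> \<or> inv (x [^] k) = \<one>"
      using x(1,3) int_pow_neg_int[of x k] by (auto simp: int_pow_int)
    then have "x [^] k = \<one>"
      using x(1) by (metis inv_eq_1_iff nat_pow_closed)
    moreover have "k > 0" using k x(2) by (cases k) auto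
    ultimately show ?thesis using tf x(1) by blast
  qed
  have main: "\<exists>J :: 'a set. finite J \<and> G \<cong> free_Abelian_group J"
    if "finite I" "h \<in> hom (free_Abelian_group I) G" "h ` carrier (free_Abelian_group I) = carrier G"
    for I :: "'a set" and h
    using that
  proof (induction "card I" arbitrary: I h rule: less_induct)
    case less
    interpret h: group_hom "free_Abelian_group I" G h
      by (intro group_hom.intro group_hom_axioms.intro group_free_Abelian_group is_group less.prems)
    show ?case
    proof (cases "\<exists>p. p \<noteq> 0 \<and> Poly_Mapping.keys p \<subseteq> I \<and> h p = \<one>")
      case True
      then obtain p where p: "p \<noteq> 0" "Poly_Mapping.keys p \<subseteq> I" "h p = \<one>" by blast
      have "\<exists>i\<in>I. \<exists>h'. h' \<in> hom (free_Abelian_group (I - {i})) G \<and>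
          h' ` carrier (free_Abelian_group (I - {i})) = carrier G"
        by (rule drop_generator[OF _ less.prems p]) (rule tf')
      then obtain i h' where i: "i \<in> I" and h': "h' \<in> hom (free_Abelian_group (I - {i})) G"
        "h' ` carrier (free_Abelian_group (I - {i})) = carrier G" by blast
      have "card (I - {i}) < card I" using i less.prems(1) by (rule card_Diff1_less[rotated])
      moreover have "finite (I - {i})" using less.prems(1) by simp
      ultimately show ?thesis using h' by (rule less.hyps)
    next
      case False
      then have "inj_on h (carrier (free_Abelian_group I))"
        by (intro h.inj_on_one_iff[THEN iffD2]) auto
      then have "h \<in> iso (free_Abelian_group I) G"
        using less.prems by (simp add: iso_def bij_betw_def)
      then have "free_Abelian_group I \<cong> G" by (auto simp: is_iso_def)
      then have "G \<cong> free_Abelian_group I" by (rule group.iso_sym[OF group_free_Abelian_group])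
      with less.prems(1) show ?thesis by blast
    qed
  qed
  have "(\<lambda>y. y) ` Y \<subseteq> carrier G" using Y by simp
  then obtain h where h: "h \<in> hom (free_Abelian_group Y) G" "\<And>y. y \<in> Y \<Longrightarrow> h (frag_of y) = y"
    by (rule free_Abelian_group_universal) (rule that, auto)
  interpret h: group_hom "free_Abelian_group Y" G h
    by (intro group_hom.intro group_hom_axioms.intro group_free_Abelian_group is_group h)
  have "Y \<subseteq> h ` carrier (free_Abelian_group Y)"
  proof
    fix y assume "y \<in> Y"
    then show "y \<in> h ` carrier (free_Abelian_group Y)"
      by (intro image_eqI[of _ _ "frag_of y"]) (simp_all add: h(2))
  qed
  then have "carrier G \<subseteq> h ` carrier (free_Abelian_group Y)"
    unfolding Y(3) by (rule generate_subgroup_incl) (rule h.img_is_subgroup)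
  then have "h ` carrier (free_Abelian_group Y) = carrier G" using h.hom_closed by blast
  from main[OF Y(1) h(1) this] obtain J :: "'a set" where J: "finite J" "G \<cong> free_Abelian_group J" by blast
  then have "J \<approx> {..<card J}" by (simp add: eqpoll_iff_card)
  then have "free_Abelian_group J \<cong> free_Abelian_group {..<card J}"
    by (simp add: isomorphic_free_Abelian_groups)
  with J have "G \<cong> free_Abelian_group {..<card J}" by (metis iso_trans)
  then show ?thesis unfolding free_abelian_of_finite_rank_def using is_group by blast
qed

section \<open>Generators of the graded pieces\<close>

declare lower_central.simps(3) [simp del]

lemma (in group) cls_commut_mult_right:
  assumes "i \<ge> 1" "j \<ge> 1" "g \<in> \<gamma> i" "h \<in> \<gamma> j" "h' \<in> \<gamma> j"
  shows "cls (i + j) (commut G g (h \<otimes> h')) = cls (i + j) (commut G g h') \<otimes>\<^bsub>gr G (i + j)\<^esub> cls (i + j) (commut G g h)"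
proof -
  have c: "g \<in> carrier G" "h \<in> carrier G" "h' \<in> carrier G" using assms \<gamma>_carrier by auto
  have "commut G g h \<in> \<gamma> (i + j)" "commut G g h' \<in> \<gamma> (i + j)" using assms by (simp_all add: commut_\<gamma>)
  then show ?thesis
    using assms(1) c by (simp add: commut_mult_right cls_mult \<gamma>_conj cls_conj)
qed

lemma (in group) cls_eq_one: "g \<in> \<gamma> (Suc d) \<Longrightarrow> cls d g = \<one>\<^bsub>gr G d\<^esub>"
  using cls_one_iff[of g d] \<gamma>_Suc_subset[of d] by blast

text \<open>As the commutator with \<open>s\<close> is additive only on classes, the induction
  carries a representative along.\<close>

lemma (in weighted_letters) ev_gr_commut_subgroup:
  assumes d: "d \<ge> 1" and s: "s \<in> carrier G" and Z: "subgroup Z (gr G (d + 1))"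
    and tree: "\<And>\<tau>. weight \<tau> = d \<Longrightarrow> cls (d + 1) (commut G (ev \<tau>) s) \<in> Z"
  shows "\<exists>g\<in>\<gamma> d. cls d g = ev_gr d p \<and> cls (d + 1) (commut G g s) \<in> Z"
proof (induction p rule: frag_induct)
  case zero
  show ?case using s subgroup.one_closed[OF Z]
    by (intro bexI[of _ \<one>]) (simp_all add: ev_gr_0[OF d] commut_one \<gamma>_one)
next
  case (of \<tau>)
  show ?case
  proof (cases "weight \<tau> = d")
    case True
    then show ?thesis using tree[OF True] ev_\<gamma>[of \<tau>]
      by (intro bexI[of _ "ev \<tau>"]) (simp_all add: ev_gr_of[OF d] tree_cls_def)
  next
    case False
    then show ?thesis using s subgroup.one_closed[OF Z]
      by (intro bexI[of _ \<one>]) (simp_all add: ev_gr_of[OF d] tree_cls_def commut_one \<gamma>_one)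
  qed
next
  case (diff p q)
  then obtain g h where g: "g \<in> \<gamma> d" "h \<in> \<gamma> d" "cls d g = ev_gr d p" "cls d h = ev_gr d q"
    "cls (d + 1) (commut G g s) \<in> Z" "cls (d + 1) (commut G h s) \<in> Z" by blast
  have s1: "s \<in> \<gamma> 1" using s by simp
  have "cls (d + 1) (commut G (g \<otimes> inv h) s) =
      cls (d + 1) (commut G g s) \<otimes>\<^bsub>gr G (d + 1)\<^esub> inv\<^bsub>gr G (d + 1)\<^esub> cls (d + 1) (commut G h s)"
    using cls_commut_mult_left[OF d le_refl g(1) \<gamma>_inv[OF g(2)] s1] cls_commut_inv_left[OF d le_refl g(2) s1]
    by simp
  also have "\<dots> \<in> Z"
    by (intro subgroup.m_closed[OF Z] subgroup.m_inv_closed[OF Z] g)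
  finally show ?case
    using g by (intro bexI[of _ "g \<otimes> inv h"]) (simp_all add: ev_gr_diff[OF d] cls_mult cls_inv \<gamma>_mult \<gamma>_inv)
qed

text \<open>Trees with a letter outside \<open>A\<close> lie in the ideal. Restricting to the finite
  alphabet \<open>A\<close> is what makes the rank finite.\<close>

lemma (in magnus) ev_gr_mem_subgroup:
  assumes d: "d \<ge> 1" and W: "subgroup W (gr G d)"
    and tree: "\<And>\<tau>. set_tree \<tau> \<subseteq> A \<Longrightarrow> weight \<tau> = d \<Longrightarrow> cls d (ev \<tau>) \<in> W"
  shows "ev_gr d p \<in> W"
proof (induction p rule: frag_induct)
  case zero
  then show ?case by (simp add: ev_gr_0[OF d] subgroup.one_closed[OF W])
next
  case (of \<tau>)
  show ?case
  proof (cases "set_tree \<tau> \<subseteq> A")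
    case True
    then show ?thesis using tree[OF True]
      by (simp add: ev_gr_of[OF d] tree_cls_def subgroup.one_closed[OF W])
  next
    case False
    then show ?thesis
      by (simp add: ev_gr_lie_ideal[OF lie_ideal_outside d] subgroup.one_closed[OF W])
  qed
next
  case (diff p q)
  then show ?case
    by (simp add: ev_gr_diff[OF d] subgroup.m_closed[OF W] subgroup.m_inv_closed[OF W])
qed

lemma (in magnus) finite_weight_trees: "finite {\<tau>. set_tree \<tau> \<subseteq> A \<and> weight \<tau> = d}"
proof (rule finite_subset)
  have "leaves \<tau> \<le> weight \<tau>" for \<tau>
    using wt_pos by (induction \<tau>) (auto simp: add_mono)
  then show "{\<tau>. set_tree \<tau> \<subseteq> A \<and> weight \<tau> = d} \<subseteq> (\<Union>m\<le>d. {\<tau>. set_tree \<tau> \<subseteq> A \<and> leaves \<tau> = m})"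
    by auto
  show "finite (\<Union>m\<le>d. {\<tau>. set_tree \<tau> \<subseteq> A \<and> leaves \<tau> = m})"
    using finite_trees[OF finite_A] by blast
qed

section \<open>The generators acting on the two families of Lie monomials\<close>

locale fp_magnus = formanek_procesi n \<theta> + J: magnus P S \<Theta>_J e_J wt_J M_J + H: magnus P "{1..n}" \<theta> e_H wt_H M_H
  for n \<theta> M_J M_H +
  assumes M_H_t: "M_H t = 1"
begin

abbreviation c :: "fp_gen word set \<Rightarrow> fp_gen word set \<Rightarrow> fp_gen word set" where
  "c \<equiv> commut P"

lemma e_values:
  "H.ev (Leaf i) = (if i \<in> {1..n} then f i else \<one>\<^bsub>P\<^esub>)" "J.ev (Leaf T) = t"
  "J.ev (Leaf (F i)) = (if i \<in> {1..n} then x i else \<one>\<^bsub>P\<^esub>)"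
  "H.weight (Leaf i) = 1" "J.weight (Leaf T) = 1" "J.weight (Leaf (F i)) = 2"
  unfolding H.ev.simps J.ev.simps J.weight.simps H.weight.simps
  by (simp_all only: e_H_def e_J_def wt_H_def wt_J_def fp_gen.case)

declare H.ev.simps(1) [simp del] H.weight.simps(1) [simp del] J.ev.simps(1) [simp del] J.weight.simps(1) [simp del]

lemma x_commutes_H:
  assumes i: "i \<in> {1..n}"
  shows "c (x i) (H.ev \<tau>) = \<one>\<^bsub>P\<^esub>"
proof -
  have "{\<one>\<^bsub>P\<^esub>} \<lhd> P" by (rule P.one_is_normal)
  then have C: "subgroup {w \<in> carrier P. \<forall>y\<in>{x i}. c y w \<in> {\<one>\<^bsub>P\<^esub>}} P" (is "subgroup ?C P")
    by (rule P.centralising_subgroup) (use i in simp)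
  have "H.ev \<tau> \<in> ?C"
  proof (induction \<tau>)
    case (Leaf j)
    show ?case using commut_x_f[OF i, of j] P.commut_one[OF x_closed[OF i]] by (simp add: e_values(1))
  next
    case (Node a b)
    have "inv\<^bsub>P\<^esub> H.ev a \<otimes>\<^bsub>P\<^esub> inv\<^bsub>P\<^esub> H.ev b \<otimes>\<^bsub>P\<^esub> H.ev a \<otimes>\<^bsub>P\<^esub> H.ev b \<in> ?C"
      by (rule subgroup.m_closed[OF C] subgroup.m_inv_closed[OF C] Node)+
    then show ?case by (simp only: H.ev.simps(2) commut_def[of P "H.ev a"])
  qed
  then show ?thesis by blast
qed

text \<open>Both memberships are one term deeper than weights predict. A leaf gives
  \<open>[f\<^sub>i, t]\<close>, the inverse of \<open>x i\<close>, which commutes with every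
  \<open>f j\<close>. For a node, Jacobi expresses \<open>[\<tau>, t]\<close> by terms of the first
  kind for the two subtrees; hence the induction needs that claim for arbitrary
  \<open>\<sigma>\<close>.\<close>

lemma H_tree_t_aux:
  "c (c (H.ev \<tau>) t) (H.ev \<sigma>) \<in> P.\<gamma> (H.weight \<tau> + H.weight \<sigma> + 2) \<and>
   (\<forall>a b. \<tau> = Node a b \<longrightarrow> c (H.ev \<tau>) t \<in> P.\<gamma> (H.weight \<tau> + 2))"
proof (induction \<tau> arbitrary: \<sigma>)
  case (Leaf i)
  have "c (c (H.ev (Leaf i)) t) (H.ev \<sigma>) = \<one>\<^bsub>P\<^esub>"
  proof (cases "i \<in> {1..n}")
    case True
    have cx: "c (f i) t = inv\<^bsub>P\<^esub> x i" using True by (simp add: x_def P.commut_inv)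
    have "x i \<otimes>\<^bsub>P\<^esub> H.ev \<sigma> = H.ev \<sigma> \<otimes>\<^bsub>P\<^esub> x i"
      using x_commutes_H[OF True, of \<sigma>] True by (simp add: P.commut_eq_one_iff)
    then have "c (H.ev \<sigma>) (x i) = \<one>\<^bsub>P\<^esub>" using True by (simp add: P.commut_eq_one_iff)
    then have "c (H.ev \<sigma>) (inv\<^bsub>P\<^esub> x i) = \<one>\<^bsub>P\<^esub>" using True by (simp add: P.commut_inv_eq_one)
    then have "c (inv\<^bsub>P\<^esub> x i) (H.ev \<sigma>) = \<one>\<^bsub>P\<^esub>"
      using True P.commut_inv[of "H.ev \<sigma>" "inv\<^bsub>P\<^esub> x i"] by simp
    then show ?thesis using True by (simp add: e_values(1) cx)
  next
    case False
    then have "H.ev (Leaf i) = \<one>\<^bsub>P\<^esub>" by (simp only: e_values(1) if_False)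
    then show ?thesis by (simp add: P.commut_one)
  qed
  then show ?case using P.\<gamma>_one by simp
next
  case (Node a b)
  let ?i = "H.weight a" and ?j = "H.weight b"
  define k where "k = ?i + ?j + 1"
  have n: "k \<ge> 1" and k: "?i + 1 + ?j = k" "?j + 1 + ?i = k" by (simp_all add: k_def)
  interpret Q: comm_group "gr P k" by (rule P.gr_comm_group[OF n])
  have t1: "t \<in> P.\<gamma> 1" by simp
  have at: "c (H.ev a) t \<in> P.\<gamma> (?i + 1)"
    by (rule P.commut_\<gamma>[OF H.weight_pos le_refl H.ev_\<gamma> t1])
  have 1: "P.cls k (c (c (H.ev b) t) (H.ev a)) = \<one>\<^bsub>gr P k\<^esub>"
    using Node.IH(2)[of a] by (intro P.cls_eq_one) (simp add: k_def add_ac)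
  have "P.cls k (c (inv\<^bsub>P\<^esub> c (H.ev a) t) (H.ev b)) = inv\<^bsub>gr P k\<^esub> P.cls k (c (c (H.ev a) t) (H.ev b))"
    unfolding k(1)[symmetric] by (rule P.cls_commut_inv_left[OF _ H.weight_pos at H.ev_\<gamma>]) simp
  moreover have "P.cls k (c (c (H.ev a) t) (H.ev b)) = \<one>\<^bsub>gr P k\<^esub>"
    using Node.IH(1)[of b] by (intro P.cls_eq_one) (simp add: k_def add_ac)
  moreover have "inv\<^bsub>P\<^esub> c (H.ev a) t = c t (H.ev a)" by (simp add: P.commut_inv)
  ultimately have 2: "P.cls k (c (c t (H.ev a)) (H.ev b)) = \<one>\<^bsub>gr P k\<^esub>"
    by simp
  have m: "c (c (H.ev a) (H.ev b)) t \<in> P.\<gamma> k"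
    unfolding k_def by (rule P.commut_\<gamma>[OF _ le_refl _ t1]) (use H.weight_pos[of a] H.ev_\<gamma>[of "Node a b"] in simp_all)
  have "P.cls k (c (c (H.ev a) (H.ev b)) t) = \<one>\<^bsub>gr P k\<^esub>"
    using P.cls_jacobi[OF H.weight_pos H.weight_pos le_refl H.ev_\<gamma> H.ev_\<gamma> t1, of a b, folded k_def] 1 2 m by simp
  then have "c (c (H.ev a) (H.ev b)) t \<in> P.\<gamma> (Suc k)"
    using P.cls_one_iff[OF m] by blast
  then have 3: "c (H.ev (Node a b)) t \<in> P.\<gamma> (H.weight (Node a b) + 2)" by (simp add: k_def)
  have "c (c (H.ev (Node a b)) t) (H.ev \<sigma>) \<in> P.\<gamma> (H.weight (Node a b) + 2 + H.weight \<sigma>)"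
    by (rule P.commut_\<gamma>[OF _ H.weight_pos 3 H.ev_\<gamma>]) simp
  with 3 show ?case by (simp add: add_ac del: H.ev.simps)
qed

text \<open>Bracketing with \<open>f i\<close> is the derivation that sends \<open>t\<close> to
  \<open>x i\<close> and every \<open>x j\<close> to zero; it preserves the Lie ring generated by
  these letters. Jacobi gives the product rule at a node.\<close>

lemma J_tree_f:
  assumes i: "i \<in> {1..n}"
  shows "\<exists>p. P.cls (J.weight \<tau> + 1) (c (J.ev \<tau>) (f i)) = J.ev_gr (J.weight \<tau> + 1) p"
proof (induction \<tau>)
  case (Leaf s)
  show ?case
  proof (cases s)
    case T
    have "J.ev_gr 2 (frag_of (Leaf (F i))) = P.cls 2 (x i)"
      using i by (simp add: J.ev_gr_of J.tree_cls_def e_values)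
    then show ?thesis
      using T by (intro exI[of _ "frag_of (Leaf (F i))"]) (simp add: e_values x_def numeral_2_eq_2)
  next
    case (F j)
    have "c (J.ev (Leaf (F j))) (f i) = \<one>\<^bsub>P\<^esub>"
      using commut_x_f[of j i] P.commut_one[OF f_closed[OF i]] i by (simp add: e_values)
    then show ?thesis using F
      by (intro exI[of _ 0]) (simp add: J.ev_gr_0)
  qed
next
  case (Node a b)
  let ?i = "J.weight a" and ?j = "J.weight b"
  define k where "k = ?i + ?j + 1"
  have n: "k \<ge> 1" and k: "?i + 1 + ?j = k" "?j + 1 + ?i = k" by (simp_all add: k_def)
  interpret Q: comm_group "gr P k" by (rule P.gr_comm_group[OF n])
  have f1: "f i \<in> P.\<gamma> 1" using i by simp
  have af: "c (J.ev a) (f i) \<in> P.\<gamma> (?i + 1)" "c (J.ev b) (f i) \<in> P.\<gamma> (?j + 1)"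
    by (rule P.commut_\<gamma>[OF J.weight_pos le_refl J.ev_\<gamma> f1])+
  from Node.IH obtain p q where p: "P.cls (?i + 1) (c (J.ev a) (f i)) = J.ev_gr (?i + 1) p"
    and q: "P.cls (?j + 1) (c (J.ev b) (f i)) = J.ev_gr (?j + 1) q" by blast
  have 1: "P.cls k (c (c (J.ev b) (f i)) (J.ev a)) = J.ev_gr k (br q (frag_of a))"
    using J.ev_gr_bracket[OF _ af(2) q[symmetric], of a] unfolding k(2) by simp
  have "inv\<^bsub>P\<^esub> c (J.ev a) (f i) = c (f i) (J.ev a)" using i by (simp add: P.commut_inv)
  moreover have "J.ev_gr (?i + 1) (- p) = P.cls (?i + 1) (inv\<^bsub>P\<^esub> c (J.ev a) (f i))"
    using p af(1) by (simp add: J.ev_gr_minus P.cls_inv)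
  ultimately have 2: "P.cls k (c (c (f i) (J.ev a)) (J.ev b)) = J.ev_gr k (br (- p) (frag_of b))"
    using J.ev_gr_bracket[OF _ P.\<gamma>_inv[OF af(1)], of "- p" b] unfolding k(1) by simp
  have m: "c (c (J.ev a) (J.ev b)) (f i) \<in> P.\<gamma> k"
    unfolding k_def by (rule P.commut_\<gamma>[OF _ le_refl _ f1]) (use J.weight_pos[of a] J.ev_\<gamma>[of "Node a b"] in simp_all)
  have "P.cls k (c (c (J.ev a) (J.ev b)) (f i)) \<otimes>\<^bsub>gr P k\<^esub> J.ev_gr k (br q (frag_of a) + br (- p) (frag_of b)) = \<one>\<^bsub>gr P k\<^esub>"
    using P.cls_jacobi[OF J.weight_pos J.weight_pos le_refl J.ev_\<gamma> J.ev_\<gamma> f1, of a b, folded k_def] m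
    by (simp add: 1 2 J.ev_gr_add[OF n] Q.m_assoc J.ev_gr_closed[OF n])
  then have "P.cls k (c (c (J.ev a) (J.ev b)) (f i)) = J.ev_gr k (- (br q (frag_of a) + br (- p) (frag_of b)))"
    unfolding J.ev_gr_minus[OF n] by (intro Q.inv_equality[symmetric] P.cls_closed m J.ev_gr_closed[OF n])
  then show ?case by (auto simp: k_def)
qed

end

section \<open>The two families span the graded pieces\<close>

context fp_magnus
begin

definition img :: "nat \<Rightarrow> fp_gen word set set set" where
  "img d = {J.ev_gr d p \<otimes>\<^bsub>gr P d\<^esub> H.ev_gr d q |p q. True}"

lemma img_subgroup:
  assumes d: "d \<ge> 1"
  shows "subgroup (img d) (gr P d)"
proof -
  interpret Q: comm_group "gr P d" by (rule P.gr_comm_group[OF d])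
  note closed = J.ev_gr_closed[OF d] H.ev_gr_closed[OF d]
  show ?thesis
  proof
    show "img d \<subseteq> carrier (gr P d)" using closed by (auto simp: img_def)
    show "\<one>\<^bsub>gr P d\<^esub> \<in> img d"
      unfolding img_def
      by (intro CollectI exI[of _ 0]) (simp add: J.ev_gr_0[OF d] H.ev_gr_0[OF d])
    show "a \<otimes>\<^bsub>gr P d\<^esub> b \<in> img d" if "a \<in> img d" "b \<in> img d" for a b
    proof -
      from that obtain p q p' q' where ab: "a = J.ev_gr d p \<otimes>\<^bsub>gr P d\<^esub> H.ev_gr d q"
        "b = J.ev_gr d p' \<otimes>\<^bsub>gr P d\<^esub> H.ev_gr d q'" by (auto simp: img_def)
      have "a \<otimes>\<^bsub>gr P d\<^esub> b = J.ev_gr d (p + p') \<otimes>\<^bsub>gr P d\<^esub> H.ev_gr d (q + q')"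
        unfolding ab J.ev_gr_add[OF d] H.ev_gr_add[OF d]
        by (simp only: Q.m_ac closed Q.m_closed)
      then show ?thesis unfolding img_def by blast
    qed
    show "inv\<^bsub>gr P d\<^esub> a \<in> img d" if "a \<in> img d" for a
    proof -
      from that obtain p q where a: "a = J.ev_gr d p \<otimes>\<^bsub>gr P d\<^esub> H.ev_gr d q" by (auto simp: img_def)
      have "inv\<^bsub>gr P d\<^esub> a = J.ev_gr d (- p) \<otimes>\<^bsub>gr P d\<^esub> H.ev_gr d (- q)"
        unfolding a J.ev_gr_minus[OF d] H.ev_gr_minus[OF d] by (intro Q.inv_mult closed)
      then show ?thesis unfolding img_def by blast
    qed
  qed
qed

lemma ev_gr_img:
  assumes d: "d \<ge> 1"
  shows "J.ev_gr d p \<in> img d" "H.ev_gr d q \<in> img d"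
proof -
  interpret Q: comm_group "gr P d" by (rule P.gr_comm_group[OF d])
  have "J.ev_gr d p = J.ev_gr d p \<otimes>\<^bsub>gr P d\<^esub> H.ev_gr d 0"
    "H.ev_gr d q = J.ev_gr d 0 \<otimes>\<^bsub>gr P d\<^esub> H.ev_gr d q"
    by (simp_all add: J.ev_gr_0[OF d] H.ev_gr_0[OF d] J.ev_gr_closed[OF d] H.ev_gr_closed[OF d])
  then show "J.ev_gr d p \<in> img d" "H.ev_gr d q \<in> img d" unfolding img_def by blast+
qed

lemma cls_ev_img:
  "P.cls (J.weight \<tau>) (J.ev \<tau>) \<in> img (J.weight \<tau>)"
  "P.cls (H.weight \<sigma>) (H.ev \<sigma>) \<in> img (H.weight \<sigma>)"
  using ev_gr_img(1)[OF J.weight_pos, of \<tau> "frag_of \<tau>"] ev_gr_img(2)[OF H.weight_pos, of \<sigma> "frag_of \<sigma>"]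
    J.ev_gr_of[OF J.weight_pos, of \<tau> \<tau>] H.ev_gr_of[OF H.weight_pos, of \<sigma> \<sigma>]
  by (simp_all add: J.tree_cls_def H.tree_cls_def)

text \<open>A tree bracketed with a letter of its own family is again a tree. In the mixed cases,
  \<open>f i\<close> acts by \<open>J_tree_f\<close>, while \<open>t\<close> turns a leaf
  \<open>f i\<close> into the inverse of \<open>x i\<close> and kills larger trees by
  \<open>H_tree_t_aux\<close>.\<close>

lemma tree_commut_img:
  assumes s: "s \<in> insert t (f ` {1..n})"
  shows "P.cls (J.weight \<tau> + 1) (c (J.ev \<tau>) s) \<in> img (J.weight \<tau> + 1)"
    and "P.cls (H.weight \<sigma> + 1) (c (H.ev \<sigma>) s) \<in> img (H.weight \<sigma> + 1)"
proof -
  consider "s = t" | i where "i \<in> {1..n}" "s = f i" using s by blast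
  note s_cases = this
  show "P.cls (J.weight \<tau> + 1) (c (J.ev \<tau>) s) \<in> img (J.weight \<tau> + 1)"
    using s_cases
  proof cases
    case 1
    then show ?thesis using cls_ev_img(1)[of "Node \<tau> (Leaf T)"] by (simp add: e_values(2,5))
  next
    case 2
    then show ?thesis using J_tree_f[OF 2(1), of \<tau>] ev_gr_img(1)[of "J.weight \<tau> + 1"] by auto
  qed
  show "P.cls (H.weight \<sigma> + 1) (c (H.ev \<sigma>) s) \<in> img (H.weight \<sigma> + 1)"
    using s_cases
  proof cases
    case 1
    show ?thesis
    proof (cases \<sigma>)
      case (Leaf i)
      have x: "P.cls 2 (inv\<^bsub>P\<^esub> x i) \<in> img 2" if "i \<in> {1..n}"
      proof -
        have "x i \<in> P.\<gamma> 2" using J.ev_\<gamma>[of "Leaf (F i)"] that by (simp add: e_values(3,6))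
        then have "P.cls 2 (inv\<^bsub>P\<^esub> x i) = inv\<^bsub>gr P 2\<^esub> P.cls 2 (x i)" by (rule P.cls_inv)
        moreover have "P.cls 2 (x i) \<in> img 2"
          using cls_ev_img(1)[of "Leaf (F i)"] that by (simp add: e_values(3,6))
        ultimately show ?thesis by (simp add: subgroup.m_inv_closed[OF img_subgroup])
      qed
      show ?thesis
      proof (cases "i \<in> {1..n}")
        case True
        then have "c (f i) t = inv\<^bsub>P\<^esub> x i" by (simp add: x_def P.commut_inv)
        moreover have "H.ev \<sigma> = f i" "H.weight \<sigma> = 1" using True by (simp_all only: Leaf e_values if_True)
        ultimately show ?thesis using x[OF True] 1 by (simp add: numeral_2_eq_2)
      next
        case False
        then have "H.ev \<sigma> = \<one>\<^bsub>P\<^esub>" by (simp only: Leaf e_values if_False)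
        then show ?thesis using 1 subgroup.one_closed[OF img_subgroup] by (simp add: P.commut_one)
      qed
    next
      case (Node a b)
      then have "c (H.ev \<sigma>) t \<in> P.\<gamma> (H.weight \<sigma> + 2)" using H_tree_t_aux by blast
      then have "P.cls (H.weight \<sigma> + 1) (c (H.ev \<sigma>) t) = \<one>\<^bsub>gr P (H.weight \<sigma> + 1)\<^esub>"
        by (intro P.cls_eq_one) simp
      then show ?thesis using 1 subgroup.one_closed[OF img_subgroup] by simp
    qed
  next
    case (2 i)
    then have "H.ev (Leaf i) = f i" by (simp only: e_values if_True)
    then show ?thesis using cls_ev_img(2)[of "Node \<sigma> (Leaf i)"] 2 by (simp add: e_values(4))
  qed
qed

lemma commut_gen_img:
  assumes d: "d \<ge> 1" and img: "P.cls d g \<in> img d" and g: "g \<in> P.\<gamma> d" and s: "s \<in> insert t (f ` {1..n})"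
  shows "P.cls (d + 1) (c g s) \<in> img (d + 1)"
proof -
  have Z: "subgroup (img (d + 1)) (gr P (d + 1))" by (rule img_subgroup) simp
  have sc: "s \<in> carrier P" using s by auto
  have s1: "s \<in> P.\<gamma> 1" using sc by simp
  obtain p q where pq: "P.cls d g = J.ev_gr d p \<otimes>\<^bsub>gr P d\<^esub> H.ev_gr d q" using img by (auto simp: img_def)
  obtain g1 where g1: "g1 \<in> P.\<gamma> d" "P.cls d g1 = J.ev_gr d p" "P.cls (d + 1) (c g1 s) \<in> img (d + 1)"
    using J.ev_gr_commut_subgroup[OF d sc Z, of p] tree_commut_img(1)[OF s] by blast
  obtain g2 where g2: "g2 \<in> P.\<gamma> d" "P.cls d g2 = H.ev_gr d q" "P.cls (d + 1) (c g2 s) \<in> img (d + 1)"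
    using H.ev_gr_commut_subgroup[OF d sc Z, of q] tree_commut_img(2)[OF s] by blast
  have "P.cls d g = P.cls d (g1 \<otimes>\<^bsub>P\<^esub> g2)" using pq g1 g2 by (simp add: P.cls_mult)
  then have "P.cls (d + 1) (c g s) = P.cls (d + 1) (c (g1 \<otimes>\<^bsub>P\<^esub> g2) s)"
    by (intro P.cls_commut_cong_left d g P.\<gamma>_mult g1 g2 s1 le_refl)
  also have "\<dots> = P.cls (d + 1) (c g1 s) \<otimes>\<^bsub>gr P (d + 1)\<^esub> P.cls (d + 1) (c g2 s)"
    by (rule P.cls_commut_mult_left[OF d le_refl g1(1) g2(1) s1])
  also have "\<dots> \<in> img (d + 1)" by (rule subgroup.m_closed[OF Z g1(3) g2(3)])
  finally show ?thesis .
qed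

lemma cls_commut_img:
  assumes d: "d \<ge> 1" and img: "\<And>g. g \<in> P.\<gamma> d \<Longrightarrow> P.cls d g \<in> img d" and s: "s \<in> carrier P"
  shows "\<forall>g\<in>P.\<gamma> d. P.cls (d + 1) (c g s) \<in> img (d + 1)"
proof -
  have Z: "subgroup (img (d + 1)) (gr P (d + 1))" by (rule img_subgroup) simp
  have "s \<in> generate P (insert t (f ` {1..n}))" using s generated by simp
  then have "s \<in> carrier P \<and> (\<forall>g\<in>P.\<gamma> d. P.cls (d + 1) (c g s) \<in> img (d + 1))"
  proof (induction rule: generate.induct)
    case one
    then show ?case using subgroup.one_closed[OF Z] by (simp add: P.commut_one P.\<gamma>_carrier)
  next
    case (incl s)
    then have "s \<in> carrier P" by auto
    with commut_gen_img[OF d img _ incl] show ?case by blast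
  next
    case (inv s)
    then have sc: "s \<in> carrier P" by auto
    then have "P.cls (d + 1) (c g (inv\<^bsub>P\<^esub> s)) = inv\<^bsub>gr P (d + 1)\<^esub> P.cls (d + 1) (c g s)" if "g \<in> P.\<gamma> d" for g
      by (intro P.cls_commut_inv_right d that) simp_all
    with sc commut_gen_img[OF d img _ inv] subgroup.m_inv_closed[OF Z] show ?case by simp
  next
    case (eng s r)
    then have sr: "s \<in> P.\<gamma> 1" "r \<in> P.\<gamma> 1" by simp_all
    have "P.cls (d + 1) (c g (s \<otimes>\<^bsub>P\<^esub> r)) \<in> img (d + 1)" if "g \<in> P.\<gamma> d" for g
      unfolding P.cls_commut_mult_right[OF d le_refl that sr]
      using eng.IH that by (intro subgroup.m_closed[OF Z]) blast+
    with eng.IH show ?case by blast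
  qed
  then show ?thesis by blast
qed

lemma cls_img:
  assumes "d \<ge> 1" "g \<in> P.\<gamma> d"
  shows "P.cls d g \<in> img d"
  using assms
proof (induction d arbitrary: g rule: nat_induct_at_least)
  case base
  have Z: "subgroup (img 1) (gr P 1)" by (rule img_subgroup) simp
  have gen: "P.cls 1 s \<in> img 1" if "s \<in> insert t (f ` {1..n})" for s
  proof -
    from that consider "s = t" | i where "i \<in> {1..n}" "s = f i" by blast
    then show ?thesis
    proof cases
      case 1
      then show ?thesis using cls_ev_img(1)[of "Leaf T"] by (simp add: e_values(2,5))
    next
      case 2
      then have "H.ev (Leaf i) = f i" by (simp only: e_values if_True)
      then show ?thesis using cls_ev_img(2)[of "Leaf i"] 2 by (simp add: e_values(4))
    qed
  qed
  have "g \<in> generate P (insert t (f ` {1..n}))" using base generated by simp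
  then have "g \<in> P.\<gamma> 1 \<and> P.cls 1 g \<in> img 1"
  proof (induction rule: generate.induct)
    case one
    then show ?case using subgroup.one_closed[OF Z] by simp
  next
    case (incl s)
    then show ?case using gen[OF incl] by auto
  next
    case (inv s)
    have "P.cls 1 s \<in> img 1" by (rule gen[OF inv])
    moreover have "s \<in> P.\<gamma> 1" using inv by auto
    ultimately show ?case
      by (simp only: P.cls_inv P.\<gamma>_inv subgroup.m_inv_closed[OF Z])
  next
    case (eng s r)
    then show ?case
      by (simp only: P.cls_mult P.\<gamma>_mult subgroup.m_closed[OF Z])
  qed
  then show ?case by blast
next
  case (Suc d)
  have Z: "subgroup (img (Suc d)) (gr P (Suc d))" by (rule img_subgroup) simp
  let ?S = "{c g s |g s. g \<in> P.\<gamma> d \<and> s \<in> carrier P}"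
  have S: "s \<in> P.\<gamma> (Suc d) \<and> P.cls (Suc d) s \<in> img (Suc d)" if "s \<in> ?S" for s
    using that cls_commut_img[OF Suc.hyps Suc.IH] P.commut_\<gamma>_carrier[OF Suc.hyps] by auto
  obtain d' where d': "d = Suc d'" using Suc.hyps by (cases d) auto
  have "g \<in> generate P ?S" using Suc.prems by (simp add: d' lower_central.simps(3))
  then have "g \<in> P.\<gamma> (Suc d) \<and> P.cls (Suc d) g \<in> img (Suc d)"
  proof (induction rule: generate.induct)
    case one
    then show ?case using subgroup.one_closed[OF Z] by (simp add: P.\<gamma>_one)
  next
    case (incl s)
    then show ?case by (rule S)
  next
    case (inv s)
    from S[OF inv] show ?case
      by (simp only: P.cls_inv P.\<gamma>_inv subgroup.m_inv_closed[OF Z])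
  next
    case (eng s r)
    then show ?case
      by (simp only: P.cls_mult P.\<gamma>_mult subgroup.m_closed[OF Z])
  qed
  then show ?case by blast
qed

lemma carrier_gr_img: "d \<ge> 1 \<Longrightarrow> carrier (gr P d) = img d"
  using subgroup.subset[OF img_subgroup] by (intro equalityI) (auto simp: P.carrier_gr cls_img)

subsection \<open>Torsion-freeness\<close>

text \<open>The representation \<open>M_H\<close> kills \<open>t\<close> and the \<open>x\<^sub>i\<close>, so it separates the two factors.\<close>

lemma M_H_J_tree: "M_H (J.ev \<tau>) = 1"
proof (induction \<tau>)
  case (Leaf s)
  show ?case
  proof (cases s)
    case (F i)
    have "M_H (x i) = 1" if "i \<in> {1..n}"
    proof -
      have "commut fps_units (M_H t) (M_H (f i)) = \<one>\<^bsub>fps_units\<^esub>"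
        using H.M.hom_closed[OF f_closed[OF that]] by (simp only: M_H_t U.commut_one(2) fps_units_simps(3)[symmetric])
      then show ?thesis using that by (simp add: x_def H.M.hom_commut)
    qed
    then show ?thesis using H.M.hom_one by (simp add: F e_values(3))
  qed (simp add: e_values(2) M_H_t)
next
  case (Node a b)
  then show ?case using U.commut_self[of 1] by (simp add: H.M.hom_commut)
qed

lemma M_H_J:
  assumes d: "d \<ge> 1"
  shows "\<exists>g\<in>P.\<gamma> d. P.cls d g = J.ev_gr d p \<and> M_H g = 1"
proof (induction p rule: frag_induct)
  case zero
  show ?case using H.M.hom_one by (intro bexI[of _ "\<one>\<^bsub>P\<^esub>"]) (simp_all add: J.ev_gr_0[OF d] P.\<gamma>_one)
next
  case (of \<tau>)
  show ?case
  proof (cases "J.weight \<tau> = d")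
    case True
    then show ?thesis using J.ev_\<gamma>[of \<tau>] M_H_J_tree
      by (intro bexI[of _ "J.ev \<tau>"]) (simp_all add: J.ev_gr_of[OF d] J.tree_cls_def)
  next
    case False
    then show ?thesis using H.M.hom_one
      by (intro bexI[of _ "\<one>\<^bsub>P\<^esub>"]) (simp_all add: J.ev_gr_of[OF d] J.tree_cls_def P.\<gamma>_one)
  qed
next
  case (diff p q)
  then obtain g h where g: "g \<in> P.\<gamma> d" "h \<in> P.\<gamma> d" "P.cls d g = J.ev_gr d p" "P.cls d h = J.ev_gr d q"
    "M_H g = 1" "M_H h = 1" by blast
  have "M_H (inv\<^bsub>P\<^esub> h) = 1"
    using H.M.hom_inv[OF P.\<gamma>_carrier[OF g(2)]] g(6) U.inv_one by (simp only: fps_units_simps)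
  then have "M_H (g \<otimes>\<^bsub>P\<^esub> inv\<^bsub>P\<^esub> h) = 1"
    using g P.\<gamma>_carrier by (simp add: H.M.hom_mult)
  then show ?case using g
    by (intro bexI[of _ "g \<otimes>\<^bsub>P\<^esub> inv\<^bsub>P\<^esub> h"])
      (simp_all add: J.ev_gr_diff[OF d] P.cls_mult P.cls_inv P.\<gamma>_mult P.\<gamma>_inv)
qed

text \<open>The first factor has a representative killed by \<open>M_H\<close>, so
  \<open>M_H\<close> of the product shows the leading coefficient of the second factor. The product
  lies one term deeper, hence this coefficient is zero.\<close>

lemma ev_gr_independent:
  assumes d: "d \<ge> 1" and pq: "J.ev_gr d p \<otimes>\<^bsub>gr P d\<^esub> H.ev_gr d q = \<one>\<^bsub>gr P d\<^esub>"
  shows "J.ev_gr d p = \<one>\<^bsub>gr P d\<^esub>" "H.ev_gr d q = \<one>\<^bsub>gr P d\<^esub>"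
proof -
  interpret Q: comm_group "gr P d" by (rule P.gr_comm_group[OF d])
  let ?r = "frag_ext H.rep (H.weight_part d q)"
  obtain g where g: "g \<in> P.\<gamma> d" "P.cls d g = J.ev_gr d p" "M_H g = 1" using M_H_J[OF d] by blast
  obtain h where h: "h \<in> P.\<gamma> d" "H.ev_gr d q = P.cls d h" "leading d ?r (M_H h)"
    using H.ev_gr_leading[OF d] by blast
  have "P.cls d (g \<otimes>\<^bsub>P\<^esub> h) = \<one>\<^bsub>gr P d\<^esub>" using g h pq by (simp add: P.cls_mult)
  then have "g \<otimes>\<^bsub>P\<^esub> h \<in> P.\<gamma> (Suc d)" using P.cls_one_iff[OF P.\<gamma>_mult[OF g(1) h(1)]] by blast
  then obtain k where "leading (Suc d) k (M_H (g \<otimes>\<^bsub>P\<^esub> h))"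
    using P.leading_lower_central[OF H.M, of "Suc d"] by auto
  moreover have "M_H (g \<otimes>\<^bsub>P\<^esub> h) = M_H h"
    using g h P.\<gamma>_carrier by (simp add: H.M.hom_mult)
  ultimately have "leading d 0 (M_H h)" using leading_Suc by simp
  then have "?r = 0" using leading_unique[OF d h(3)] by simp
  then show q: "H.ev_gr d q = \<one>\<^bsub>gr P d\<^esub>" by (rule H.ev_gr_one_if_ring[OF d])
  show "J.ev_gr d p = \<one>\<^bsub>gr P d\<^esub>" using pq by (simp add: q J.ev_gr_closed[OF d])
qed

theorem gr_free_abelian:
  assumes d: "d \<ge> 1"
  shows "free_abelian_of_finite_rank (gr P d)"
proof -
  interpret Q: comm_group "gr P d" by (rule P.gr_comm_group[OF d])
  define Y where "Y = (\<lambda>\<tau>. P.cls d (J.ev \<tau>)) ` {\<tau>. set_tree \<tau> \<subseteq> S \<and> J.weight \<tau> = d} \<union>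
    (\<lambda>\<tau>. P.cls d (H.ev \<tau>)) ` {\<tau>. set_tree \<tau> \<subseteq> {1..n} \<and> H.weight \<tau> = d}"
  have fin: "finite Y" unfolding Y_def by (intro finite_UnI finite_imageI J.finite_weight_trees H.finite_weight_trees)
  have Yc: "Y \<subseteq> carrier (gr P d)" unfolding Y_def using J.ev_\<gamma> H.ev_\<gamma> by blast
  have G: "subgroup (generate (gr P d) Y) (gr P d)" by (rule Q.generate_is_subgroup[OF Yc])
  have "J.ev_gr d p \<in> generate (gr P d) Y" for p
    by (rule J.ev_gr_mem_subgroup[OF d G]) (auto simp: Y_def intro: generate.incl)
  moreover have "H.ev_gr d q \<in> generate (gr P d) Y" for q
    by (rule H.ev_gr_mem_subgroup[OF d G]) (auto simp: Y_def intro: generate.incl)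
  ultimately have "carrier (gr P d) \<subseteq> generate (gr P d) Y"
    unfolding carrier_gr_img[OF d] img_def by (auto intro: generate.eng)
  with subgroup.subset[OF G] have gen: "carrier (gr P d) = generate (gr P d) Y" by blast
  show ?thesis
  proof (rule Q.free_if_torsion_free[OF _ fin Yc gen])
    fix a and m :: nat
    assume a: "a \<in> carrier (gr P d)" and m: "m > 0" and am: "a [^]\<^bsub>gr P d\<^esub> m = \<one>\<^bsub>gr P d\<^esub>"
    from a obtain p q where pq: "a = J.ev_gr d p \<otimes>\<^bsub>gr P d\<^esub> H.ev_gr d q"
      unfolding carrier_gr_img[OF d] img_def by blast
    \<comment> \<open>Raising to the power \<open>m\<close> multiplies both polynomials by
      \<open>m\<close>; independence then separates the factors, and each is torsion-free by
      itself.\<close>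
    have "J.ev_gr d (zmul (int m) p) \<otimes>\<^bsub>gr P d\<^esub> H.ev_gr d (zmul (int m) q) = \<one>\<^bsub>gr P d\<^esub>"
      using am by (simp add: pq Q.nat_pow_distrib J.ev_gr_closed[OF d] H.ev_gr_closed[OF d] J.ev_gr_zmul[OF d] H.ev_gr_zmul[OF d])
    from ev_gr_independent[OF d this]
    have "J.ev_gr d p = \<one>\<^bsub>gr P d\<^esub>" "H.ev_gr d q = \<one>\<^bsub>gr P d\<^esub>"
      using J.ev_gr_torsion_free[OF d m] H.ev_gr_torsion_free[OF d m]
      by (simp_all add: J.ev_gr_zmul[OF d] H.ev_gr_zmul[OF d])
    then show "a = \<one>\<^bsub>gr P d\<^esub>" by (simp add: pq)
  qed
qed

end

theorem corollary4p13:
  fixes n d :: nat and \<theta> :: "(nat \<times> nat) set"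
  assumes "n \<ge> 2" and "partial_commutation n \<theta>" and "\<theta> \<noteq> {}" and "d \<ge> 1"
  shows "free_abelian_of_finite_rank (gr (FP n \<theta>) d)"
proof -
  interpret formanek_procesi n \<theta> by standard fact
  obtain M_J where J: "magnus P S \<Theta>_J e_J wt_J M_J" by (rule magnus_J)
  obtain M_H where H: "magnus P {1..n} \<theta> e_H wt_H M_H" "M_H t = 1" by (rule magnus_H)
  interpret fp_magnus n \<theta> M_J M_H
    by (intro fp_magnus.intro fp_magnus_axioms.intro formanek_procesi_axioms J H)
  show ?thesis by (rule gr_free_abelian) fact
qed

end
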